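(* Let $q\in(-1,1)$ and suppose that $\dim(H_{\mathbb{R}})\ge2$. Let $\mathrm{vN}(G_q(H_{\mathbb{R}}))$ be the von Neumann algebra generated by $\{G_q(x)\mid x\in H_{\mathbb{R}}\}$, $G_q(x)=d_q(x)+d_q^\ast(x)$, acting on the completion of the $q$-Fock space of type D. Then the vacuum state $a\mapsto\langle\Omega,a\Omega\rangle_q$ is a trace on $\mathrm{vN}(G_q(H_{\mathbb{R}}))$ if and only if $q=0$.
   Context: Fock space. $H$ is a complex Hilbert space with inner product $\langle\cdot,\cdot\rangle$ linear in the right argument and antilinear in the left one; $x\mapsto\overline{x}$ is a fixed selfadjoint involution on $H$, i.e. a bounded selfadjoint linear operator whose square is the identity. $H_{\mathbb{R}}$ is a real Hilbert subspace of $H$ such that $H=H_{\mathbb{R}}\oplus iH_{\mathbb{R}}$; in particular $\langle x,y\rangle=\langle y,x\rangle$ for $x,y\in H_{\mathbb{R}}$. Let $B(n)$ be the group of permutations $\sigma$ of $\{\pm1,\dots,\pm n\}$ with $\sigma(-k)=-\sigma(k)$; put $\pi_i=(i,i+1)(-i,-i-1)$ for $1\le i\le n-1$, $\overline{\pi}_n=(n,-n)$ and $\widehat{\pi}_{n-1}=\overline{\pi}_n\pi_{n-1}\overline{\pi}_n$. The Coxeter group $D(n)$ of type D is $D(1)=\{e\}$ and, for $n\ge2$, the subgroup of $B(n)$ generated by $\pi_1,\dots,\pi_{n-1},\widehat{\pi}_{n-1}$; $\ell(\sigma)$ is the minimal number of these generators in a product expression of $\sigma\in D(n)$. For $n\ge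 2$, $D(n)$ acts on $H^{\otimes n}$ by $\pi_i(x_1\otimes\cdots\otimes x_n)=x_1\otimes\cdots\otimes x_{i-1}\otimes x_{i+1}\otimes x_i\otimes x_{i+2}\otimes\cdots\otimes x_n$ and $\widehat{\pi}_{n-1}(x_1\otimes\cdots\otimes x_n)=x_1\otimes\cdots\otimes x_{n-2}\otimes\overline{x}_n\otimes\overline{x}_{n-1}$; $D(1)$ acts trivially on $H$. Put $\widehat{P}_q^{(n)}=\sum_{\sigma\in D(n)}q^{\ell(\sigma)}\sigma$ for $n\ge1$ and $\widehat P_q^{(0)}=I$ (convention $0^0=1$). Let $\mathcal{F}_{\rm fin}(H)=\bigoplus_{n\ge0}H^{\otimes n}$ be the algebraic direct sum, $H^{\otimes0}=\mathbb{C}\Omega$ with $\Omega$ a unit vector, with the usual inner product $\langle x_1\otimes\cdots\otimes x_m,y_1\otimes\cdots\otimes y_n\rangle_0=\delta_{m,n}\prod_i\langle x_i,y_i\rangle$, and $\widehat P_q=\bigoplus_n\widehat P_q^{(n)}$. For $q\in(-1,1)$, $\widehat P_q$ is known to be strictly positive, so $\langle f,g\rangle_q:=\langle f,\widehat P_q g\rangle_0$ is an inner product; $\mathcal{F}_{\rm fin}(H)$ with this inner product is the $q$-Fock space of type D. The creation operator is $d_q^\ast(x)(x_1\otimes\cdots\otimes x_n)=x\otimes x_1\otimes\cdots\otimes x_n$, $d_q^\ast(x)\Omega=x$, and $d_q(x)$ is its adjoint with respect to $\langle\cdot,\cdot\rangle_q$; both are bounded for $\|\cdot\|_q$ and extend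 to the completion. *)

theory Defs
  imports "HOL-Analysis.Analysis" "HOL-Combinatorics.Permutations"
begin

section \<open>Complex Hilbert spaces\<close>

class complex_vector = real_vector +
  fixes scaleC :: "complex \<Rightarrow> 'a \<Rightarrow> 'a"  (infixr "*\<^sub>C" 75)
  assumes scaleC_add_right: "c *\<^sub>C (x + y) = c *\<^sub>C x + c *\<^sub>C y"
    and scaleC_add_left: "(c + d) *\<^sub>C x = c *\<^sub>C x + d *\<^sub>C x"
    and scaleC_scaleC: "c *\<^sub>C (d *\<^sub>C x) = (c * d) *\<^sub>C x"
    and scaleC_of_real: "complex_of_real r *\<^sub>C x = r *\<^sub>R x"

lemma scaleC_one: "1 *\<^sub>C x = (x :: 'a::complex_vector)"
  using scaleC_of_real[of 1 x] by simp

lemma vector_space_scaleC: "vector_space (scaleC :: complex \<Rightarrow> 'a::complex_vector \<Rightarrow> 'a)"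
  by unfold_locales (simp_all add: scaleC_add_right scaleC_add_left scaleC_scaleC scaleC_one)

abbreviation clinear :: "('a::complex_vector \<Rightarrow> 'b::complex_vector) \<Rightarrow> bool" where
  "clinear \<equiv> Vector_Spaces.linear scaleC scaleC"

lemma clinear_iff:
  "clinear f \<longleftrightarrow> (\<forall>x y. f (x + y) = f x + f y) \<and> (\<forall>c x. f (c *\<^sub>C x) = c *\<^sub>C f x)"
  by (auto simp: Vector_Spaces.linear_iff vector_space_scaleC)

instantiation complex :: complex_vector
begin
definition scaleC_complex :: "complex \<Rightarrow> complex \<Rightarrow> complex" where
  "scaleC_complex = (*)"
instance by standard (auto simp: scaleC_complex_def algebra_simps scaleR_conv_of_real)
end

text \<open>The inner product is linear in the right and antilinear in the left argument. The norm and
  the topology are those of the underlying real Hilbert space with inner product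
  \<open>Re \<langle>x, y\<rangle>\<close>; since \<open>\<langle>x, x\<rangle>\<close> is real, \<open>\<parallel>x\<parallel>\<^sup>2 = \<langle>x, x\<rangle>\<close>, and positive definiteness is inherited.\<close>

class complex_hilbert = complex_vector + real_inner + complete_space +
  fixes cinner :: "'a \<Rightarrow> 'a \<Rightarrow> complex"
  assumes cinner_add_right: "cinner x (y + z) = cinner x y + cinner x z"
    and cinner_scaleC_right: "cinner x (c *\<^sub>C y) = c * cinner x y"
    and cinner_commute: "cinner x y = cnj (cinner y x)"
    and inner_eq_Re_cinner: "inner x y = Re (cinner x y)"

instantiation complex :: complex_hilbert
begin
definition cinner_complex :: "complex \<Rightarrow> complex \<Rightarrow> complex" where
  "cinner_complex x y = cnj x * y"
instance by standard (auto simp: cinner_complex_def scaleC_complex_def algebra_simps inner_complex_def)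
end

definition bounded_clinear :: "('a::complex_hilbert \<Rightarrow> 'b::complex_hilbert) \<Rightarrow> bool" where
  "bounded_clinear A \<longleftrightarrow> clinear A \<and> bounded_linear A"

definition adj :: "('k::complex_hilbert \<Rightarrow> 'k) \<Rightarrow> 'k \<Rightarrow> 'k" where
  "adj A = (THE B. bounded_clinear B \<and> (\<forall>x y. cinner (B x) y = cinner x (A y)))"

definition selfadjoint_involution :: "('h::complex_hilbert \<Rightarrow> 'h) \<Rightarrow> bool" where
  "selfadjoint_involution bar \<longleftrightarrow> bounded_clinear bar \<and>
     (\<forall>x y. cinner (bar x) y = cinner x (bar y)) \<and> (\<forall>x. bar (bar x) = x)"

text \<open>A closed real subspace, a real Hilbert space under the restriction of the inner product,
  with \<open>H = H\<^sub>\<real> \<oplus> iH\<^sub>\<real>\<close>.\<close>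

definition real_hilbert_form :: "'h::complex_hilbert set \<Rightarrow> bool" where
  "real_hilbert_form HR \<longleftrightarrow> subspace HR \<and> closed HR \<and>
     (\<forall>x\<in>HR. \<forall>y\<in>HR. cinner x y \<in> \<real>) \<and>
     (\<forall>z. \<exists>!(x, y). x \<in> HR \<and> y \<in> HR \<and> z = x + \<i> *\<^sub>C y)"

text \<open>The completion of a complex inner product space, up to unitary equivalence: a Hilbert space
  together with a linear isometry onto a dense subspace.\<close>

definition is_completion ::
    "('v::complex_vector \<Rightarrow> 'v \<Rightarrow> complex) \<Rightarrow> ('v \<Rightarrow> 'k::complex_hilbert) \<Rightarrow> bool" where
  "is_completion ip J \<longleftrightarrow> clinear J \<and> (\<forall>f g. cinner (J f) (J g) = ip f g) \<and> closure (range J) = UNIV"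

definition extension :: "('v \<Rightarrow> 'k::complex_hilbert) \<Rightarrow> ('v \<Rightarrow> 'v) \<Rightarrow> 'k \<Rightarrow> 'k" where
  "extension J A = (THE T. bounded_clinear T \<and> (\<forall>f. T (J f) = J (A f)))"


section \<open>Von Neumann algebras\<close>

definition commutant :: "('k::complex_hilbert \<Rightarrow> 'k) set \<Rightarrow> ('k \<Rightarrow> 'k) set" where
  "commutant S = {b. bounded_clinear b \<and> (\<forall>a\<in>S. a \<circ> b = b \<circ> a)}"

definition von_neumann_algebra :: "('k::complex_hilbert \<Rightarrow> 'k) set \<Rightarrow> bool" where
  "von_neumann_algebra M \<longleftrightarrow> (\<forall>a\<in>M. bounded_clinear a \<and> adj a \<in> M) \<and> commutant (commutant M) = M"

definition vN_generated :: "('k::complex_hilbert \<Rightarrow> 'k) set \<Rightarrow> ('k \<Rightarrow> 'k) set" where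
  "vN_generated S = \<Inter>{M. von_neumann_algebra M \<and> S \<subseteq> M}"

definition is_trace :: "('k \<Rightarrow> 'k) set \<Rightarrow> (('k \<Rightarrow> 'k) \<Rightarrow> complex) \<Rightarrow> bool" where
  "is_trace M \<tau> \<longleftrightarrow> (\<forall>a\<in>M. \<forall>b\<in>M. \<tau> (a \<circ> b) = \<tau> (b \<circ> a))"


section \<open>The Coxeter groups of type D\<close>

definition coxB :: "nat \<Rightarrow> (int \<Rightarrow> int) set" where
  "coxB n = {\<sigma>. \<sigma> permutes ({- int n..int n} - {0}) \<and> (\<forall>k. \<sigma> (- k) = - \<sigma> k)}"

definition swap :: "nat \<Rightarrow> int \<Rightarrow> int" where
  "swap i = Transposition.transpose (int i) (int i + 1) \<circ> Transposition.transpose (- int i) (- int i - 1)"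

definition flip :: "nat \<Rightarrow> int \<Rightarrow> int" where
  "flip n = Transposition.transpose (int n) (- int n)"

definition hat_swap :: "nat \<Rightarrow> int \<Rightarrow> int" where
  "hat_swap n = flip n \<circ> swap (n - 1) \<circ> flip n"

definition gensD :: "nat \<Rightarrow> (int \<Rightarrow> int) set" where
  "gensD n = (if n \<ge> 2 then {swap i | i. 1 \<le> i \<and> i \<le> n - 1} \<union> {hat_swap n} else {})"

definition word_prod :: "('a \<Rightarrow> 'a) list \<Rightarrow> 'a \<Rightarrow> 'a" where
  "word_prod w = foldr (\<circ>) w id"

text \<open>The generators are involutions, so products of generators already form a subgroup; see
  \<open>coxD_inv\<close> below. For \<open>n \<le> 1\<close> this is the trivial group.\<close>

definition coxD :: "nat \<Rightarrow> (int \<Rightarrow> int) set" where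
  "coxD n = word_prod ` lists (gensD n)"

definition len :: "nat \<Rightarrow> (int \<Rightarrow> int) \<Rightarrow> nat" where
  "len n \<sigma> = (LEAST k. \<exists>w\<in>lists (gensD n). length w = k \<and> word_prod w = \<sigma>)"

lemma word_prod_simps [simp]:
  "word_prod [] = id" "word_prod (s # w) = s \<circ> word_prod w"
  by (simp_all add: word_prod_def)

lemma word_prod_append: "word_prod (v @ w) = word_prod v \<circ> word_prod w"
  by (induction v) (auto simp: o_assoc)

lemma swap_coxB: "1 \<le> i \<Longrightarrow> i < n \<Longrightarrow> swap i \<in> coxB n"
  unfolding coxB_def swap_def
  by (auto intro!: permutes_compose permutes_swap_id simp: Transposition.transpose_def)

lemma flip_coxB: "1 \<le> n \<Longrightarrow> flip n \<in> coxB n"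
  unfolding coxB_def flip_def
  by (auto intro!: permutes_swap_id simp: Transposition.transpose_def)

lemma coxB_comp: "\<sigma> \<in> coxB n \<Longrightarrow> \<tau> \<in> coxB n \<Longrightarrow> \<sigma> \<circ> \<tau> \<in> coxB n"
  unfolding coxB_def by (auto intro: permutes_compose)

lemma coxB_id: "id \<in> coxB n"
  unfolding coxB_def by (auto intro: permutes_id)

lemma gensD_coxB: "gensD n \<subseteq> coxB n"
  by (auto simp: gensD_def hat_swap_def intro!: coxB_comp swap_coxB flip_coxB split: if_splits)

lemma coxD_coxB: "coxD n \<subseteq> coxB n"
proof -
  have "word_prod w \<in> coxB n" if "w \<in> lists (gensD n)" for w
    using that
  proof (induction w)
    case Nil
    show ?case by (simp only: word_prod_simps coxB_id)
  next
    case (Cons s w)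
    then have "s \<in> coxB n" "word_prod w \<in> coxB n" using gensD_coxB by auto
    then show ?case unfolding word_prod_simps by (rule coxB_comp)
  qed
  then show ?thesis by (auto simp: coxD_def)
qed

lemma finite_coxD: "finite (coxD n)"
proof (rule finite_subset)
  show "coxD n \<subseteq> {\<sigma>. \<sigma> permutes ({- int n..int n} - {0})}"
    using coxD_coxB by (auto simp: coxB_def)
qed (auto intro: finite_permutations)

lemma swap_invol: "swap i \<circ> swap i = id" if "i \<ge> 1"
  using that by (auto simp: swap_def fun_eq_iff Transposition.transpose_def)

lemma flip_invol: "flip n \<circ> flip n = id"
  by (simp add: flip_def)

lemma gensD_invol: "s \<in> gensD n \<Longrightarrow> s \<circ> s = id"
  using swap_invol flip_invol
  by (fastforce simp: gensD_def hat_swap_def fun_eq_iff split: if_splits)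

lemma coxD_id: "id \<in> coxD n"
  unfolding coxD_def by (rule image_eqI[of _ _ "[]"]) auto

lemma coxD_comp: "\<sigma> \<in> coxD n \<Longrightarrow> \<tau> \<in> coxD n \<Longrightarrow> \<sigma> \<circ> \<tau> \<in> coxD n"
proof -
  assume "\<sigma> \<in> coxD n" "\<tau> \<in> coxD n"
  then obtain v w where "v @ w \<in> lists (gensD n)" "\<sigma> \<circ> \<tau> = word_prod (v @ w)"
    unfolding coxD_def word_prod_append by auto
  then show ?thesis unfolding coxD_def by blast
qed

lemma word_prod_rev:
  "w \<in> lists (gensD n) \<Longrightarrow> word_prod (rev w) \<circ> word_prod w = id"
proof (induction w)
  case (Cons s w)
  have "word_prod (rev (s # w)) \<circ> word_prod (s # w) = word_prod (rev w) \<circ> (s \<circ> s) \<circ> word_prod w"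
    by (simp add: word_prod_append o_assoc)
  also have "\<dots> = word_prod (rev w) \<circ> word_prod w" using Cons gensD_invol[of s n] by simp
  also have "\<dots> = id" using Cons.prems by (intro Cons.IH) auto
  finally show ?case .
qed auto

lemma coxD_inv: "\<sigma> \<in> coxD n \<Longrightarrow> inv \<sigma> \<in> coxD n"
proof -
  assume "\<sigma> \<in> coxD n"
  then obtain w where w: "w \<in> lists (gensD n)" "\<sigma> = word_prod w" by (auto simp: coxD_def)
  have "bij \<sigma>" using coxD_coxB \<open>\<sigma> \<in> coxD n\<close> by (auto simp: coxB_def intro: permutes_bij)
  then have "inv \<sigma> = word_prod (rev w) \<circ> \<sigma> \<circ> inv \<sigma>"
    using word_prod_rev[OF w(1)] w(2) by simp
  also have "\<dots> = word_prod (rev w)"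
    using \<open>bij \<sigma>\<close> by (simp add: fun_eq_iff bij_is_surj surj_f_inv_f)
  finally show ?thesis using w(1) by (auto simp: coxD_def)
qed

text \<open>With the convention \<open>x\<^sub>-\<^sub>k = bar x\<^sub>k\<close>, a signed permutation acts on simple tensors by
  \<open>\<sigma>(x\<^sub>1 \<otimes> \<dots> \<otimes> x\<^sub>n) = x\<^bsub>\<sigma>\<inverse>(1)\<^esub> \<otimes> \<dots> \<otimes> x\<^bsub>\<sigma>\<inverse>(n)\<^esub>\<close>. The lemmas \<open>act_id\<close>, \<open>act_comp\<close>, \<open>act_swap\<close>,
  \<open>act_hat_swap\<close> state that this is a left action which is the prescribed one on the generators,
  which determines it on the group they generate.\<close>

definition letter :: "('h \<Rightarrow> 'h) \<Rightarrow> 'h list \<Rightarrow> int \<Rightarrow> 'h" where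
  "letter bar xs k = (if k > 0 then xs ! (nat k - 1) else bar (xs ! (nat (- k) - 1)))"

definition act :: "('h \<Rightarrow> 'h) \<Rightarrow> (int \<Rightarrow> int) \<Rightarrow> 'h list \<Rightarrow> 'h list" where
  "act bar \<sigma> xs = map (\<lambda>j. letter bar xs (inv \<sigma> j)) [1..int (length xs)]"

lemma length_act [simp]: "length (act bar \<sigma> xs) = length xs"
  by (simp add: act_def)

lemma nth_act: "i < length xs \<Longrightarrow> act bar \<sigma> xs ! i = letter bar xs (inv \<sigma> (int i + 1))"
  by (simp add: act_def nth_upto algebra_simps)

lemma act_id: "act bar id xs = xs"
  by (rule nth_equalityI) (auto simp: nth_act letter_def nat_add_distrib)

lemma coxB_inv_facts:
  assumes "\<sigma> \<in> coxB n"
  shows "bij \<sigma>" "inv \<sigma> (- k) = - inv \<sigma> k"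
    "k \<in> {- int n..int n} - {0} \<Longrightarrow> inv \<sigma> k \<in> {- int n..int n} - {0}"
proof -
  from assms have p: "\<sigma> permutes ({- int n..int n} - {0})" and o: "\<And>k. \<sigma> (- k) = - \<sigma> k"
    by (auto simp: coxB_def)
  show b: "bij \<sigma>" using p by (rule permutes_bij)
  have "\<sigma> (- inv \<sigma> k) = - k" using o b by (simp add: bij_is_surj surj_f_inv_f)
  then show "inv \<sigma> (- k) = - inv \<sigma> k" using b by (metis bij_inv_eq_iff)
  show "inv \<sigma> k \<in> {- int n..int n} - {0}" if "k \<in> {- int n..int n} - {0}"
    using permutes_in_image[OF permutes_inv[OF p]] that by blast
qed

lemma act_comp:
  assumes "\<sigma> \<in> coxB (length xs)" "\<tau> \<in> coxB (length xs)" "\<And>x. bar (bar x) = x"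
  shows "act bar (\<sigma> \<circ> \<tau>) xs = act bar \<sigma> (act bar \<tau> xs)"
proof (rule nth_equalityI)
  fix i assume i: "i < length (act bar (\<sigma> \<circ> \<tau>) xs)"
  define n where "n = length xs"
  define m where "m = inv \<sigma> (int i + 1)"
  have m: "m \<in> {- int n..int n} - {0}"
    unfolding m_def n_def using i by (intro coxB_inv_facts(3)[OF assms(1)]) auto
  have c: "inv (\<sigma> \<circ> \<tau>) (int i + 1) = inv \<tau> m"
    using coxB_inv_facts(1)[OF assms(1)] coxB_inv_facts(1)[OF assms(2)]
    by (simp add: o_inv_distrib m_def)
  have neg: "letter bar xs (inv \<tau> (- m)) = letter bar xs (- inv \<tau> m)"
    using coxB_inv_facts(2)[OF assms(2)] by simp
  have "inv \<tau> m \<noteq> 0" using coxB_inv_facts(3)[OF assms(2)] m by (auto simp: n_def)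
  then have bl: "bar (letter bar xs (- inv \<tau> m)) = letter bar xs (inv \<tau> m)"
    using assms(3) by (auto simp: letter_def)
  show "act bar (\<sigma> \<circ> \<tau>) xs ! i = act bar \<sigma> (act bar \<tau> xs) ! i"
  proof (cases "m > 0")
    case True
    then have "letter bar (act bar \<tau> xs) m = act bar \<tau> xs ! (nat m - 1)" by (simp add: letter_def)
    also have "\<dots> = letter bar xs (inv \<tau> m)" using True m by (subst nth_act) (auto simp: n_def)
    finally show ?thesis using i c by (simp add: nth_act m_def)
  next
    case False
    then have "letter bar (act bar \<tau> xs) m = bar (act bar \<tau> xs ! (nat (- m) - 1))"
      by (simp add: letter_def)
    also have "\<dots> = bar (letter bar xs (inv \<tau> (- m)))"
      using False m by (subst nth_act) (auto simp: n_def)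
    finally show ?thesis using i c neg bl by (simp add: nth_act m_def)
  qed
qed auto

lemma inv_invol: "s \<circ> s = id \<Longrightarrow> inv s = s"
  by (rule inv_unique_comp)

lemma act_swap:
  "act bar (swap (Suc (length us))) (us @ [x, y] @ vs) = us @ [y, x] @ vs"
proof (rule nth_equalityI)
  fix i assume "i < length (act bar (swap (Suc (length us))) (us @ [x, y] @ vs))"
  then have i: "i < length (us @ [x, y] @ vs)" by simp
  have inv: "inv (swap (Suc (length us))) = swap (Suc (length us))"
    by (intro inv_invol swap_invol) simp
  consider "i < length us" | "i = length us" | "i = Suc (length us)" | "i > Suc (length us)"
    by linarith
  then show "act bar (swap (Suc (length us))) (us @ [x, y] @ vs) ! i = (us @ [y, x] @ vs) ! i"
    unfolding nth_act[OF i] inv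
    by cases (auto simp: letter_def swap_def Transposition.transpose_def nth_append nth_Cons'
      nat_add_distrib)
qed auto

lemma act_hat_swap:
  "act bar (hat_swap (length us + 2)) (us @ [x, y]) = us @ [bar y, bar x]"
proof (rule nth_equalityI)
  let ?s = "hat_swap (length us + 2)"
  fix i assume "i < length (act bar ?s (us @ [x, y]))"
  then have i: "i < length (us @ [x, y])" by simp
  have "?s \<in> gensD (length us + 2)" by (simp add: gensD_def)
  then have inv: "inv ?s = ?s" by (intro inv_invol gensD_invol)
  from i consider "i < length us" | "i = length us" | "i = Suc (length us)" by force
  then show "act bar ?s (us @ [x, y]) ! i = (us @ [bar y, bar x]) ! i"
    unfolding nth_act[OF i] inv
    by cases (auto simp: letter_def hat_swap_def flip_def swap_def Transposition.transpose_def
      nth_append nat_add_distrib)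
qed auto


section \<open>The algebraic Fock space\<close>

text \<open>The algebraic tensor powers are realised as usual in Hilbert space theory: \<open>x\<^sub>1 \<otimes> \<dots> \<otimes> x\<^sub>n\<close> is
  the form \<open>(y\<^sub>1, \<dots>, y\<^sub>n) \<mapsto> \<Prod>\<^sub>i \<langle>y\<^sub>i, x\<^sub>i\<rangle>\<close>, antilinear in each variable, and the tensor power is the
  space of finite linear combinations of these. Forms in different numbers of variables are
  independent, as forms are extended by zero to lists of other lengths; so one function on lists
  represents an element of the algebraic direct sum of all tensor powers.\<close>

definition simple_form :: "'h::complex_hilbert list \<Rightarrow> 'h list \<Rightarrow> complex" where
  "simple_form xs ys = (if length ys = length xs then \<Prod>i<length xs. cinner (ys ! i) (xs ! i) else 0)"

inductive_set fock_forms :: "('h::complex_hilbert list \<Rightarrow> complex) set" where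
  zero: "(\<lambda>ys. 0) \<in> fock_forms"
| step: "f \<in> fock_forms \<Longrightarrow> (\<lambda>ys. f ys + c * simple_form xs ys) \<in> fock_forms"

lemma fock_forms_add: "f \<in> fock_forms \<Longrightarrow> g \<in> fock_forms \<Longrightarrow> (\<lambda>ys. f ys + g ys) \<in> fock_forms"
proof (rotate_tac, induction g rule: fock_forms.induct)
  case (step g c xs)
  then show ?case using fock_forms.step[of "\<lambda>ys. f ys + g ys" c xs] by (simp add: add.assoc)
qed simp

lemma fock_forms_scale: "f \<in> fock_forms \<Longrightarrow> (\<lambda>ys. c * f ys) \<in> fock_forms"
proof (induction f rule: fock_forms.induct)
  case (step f d xs)
  then show ?case using fock_forms.step[of "\<lambda>ys. c * f ys" "c * d" xs] by (simp add: algebra_simps)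
qed (simp add: fock_forms.zero)

lemma fock_forms_simple: "simple_form xs \<in> fock_forms"
  using fock_forms.step[OF fock_forms.zero, of 1 xs] by (simp add: fun_eq_iff)

lemma fock_forms_sum:
  "(\<And>i. i \<in> I \<Longrightarrow> f i \<in> fock_forms) \<Longrightarrow> (\<lambda>ys. \<Sum>i\<in>I. f i ys) \<in> fock_forms"
  by (induction I rule: infinite_finite_induct) (auto intro: fock_forms.zero fock_forms_add)

typedef (overloaded) 'h fock = "fock_forms :: ('h::complex_hilbert list \<Rightarrow> complex) set"
  using fock_forms.zero by blast

setup_lifting type_definition_fock

instantiation fock :: (complex_hilbert) complex_vector
begin
lift_definition zero_fock :: "'a fock" is "\<lambda>ys. 0" by (rule fock_forms.zero)
lift_definition plus_fock :: "'a fock \<Rightarrow> 'a fock \<Rightarrow> 'a fock" is "\<lambda>f g ys. f ys + g ys"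
  by (rule fock_forms_add)
lift_definition uminus_fock :: "'a fock \<Rightarrow> 'a fock" is "\<lambda>f ys. - f ys"
  using fock_forms_scale[of _ "-1"] by simp
lift_definition minus_fock :: "'a fock \<Rightarrow> 'a fock \<Rightarrow> 'a fock" is "\<lambda>f g ys. f ys - g ys"
  using fock_forms_add[OF _ fock_forms_scale[of _ "-1"]] by simp
lift_definition scaleC_fock :: "complex \<Rightarrow> 'a fock \<Rightarrow> 'a fock" is "\<lambda>c f ys. c * f ys"
  by (rule fock_forms_scale)
lift_definition scaleR_fock :: "real \<Rightarrow> 'a fock \<Rightarrow> 'a fock" is "\<lambda>r f ys. complex_of_real r * f ys"
  by (rule fock_forms_scale)
instance
  by (standard; transfer) (auto simp: algebra_simps fun_eq_iff)
end

lift_definition tensor :: "'h::complex_hilbert list \<Rightarrow> 'h fock" is simple_form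
  by (rule fock_forms_simple)

abbreviation vacuum :: "'h::complex_hilbert fock" where
  "vacuum \<equiv> tensor []"

lemma fock_induct [case_names zero step]:
  assumes "P 0" "\<And>f c xs. P f \<Longrightarrow> P (f + c *\<^sub>C tensor xs)"
  shows "P (f :: 'h::complex_hilbert fock)"
proof -
  have "P (Abs_fock g)" if "g \<in> fock_forms" for g
    using that
  proof (induction g rule: fock_forms.induct)
    case zero
    then show ?case using assms(1) by (simp add: zero_fock_def)
  next
    case (step f c xs)
    have "Abs_fock (\<lambda>ys. f ys + c * simple_form xs ys) = Abs_fock f + c *\<^sub>C tensor xs"
      using step(1)
      by (simp add: Rep_fock_inject[symmetric] plus_fock.rep_eq scaleC_fock.rep_eq tensor.rep_eq
        Abs_fock_inverse fock_forms.step)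
    then show ?case using assms(2)[OF step(2)] by simp
  qed
  from this[OF Rep_fock, of f] show ?thesis by (simp add: Rep_fock_inverse)
qed

lemma clinear_fock_eqI:
  assumes "clinear L" "clinear M" "\<And>xs. L (tensor xs) = M (tensor xs)"
  shows "L = (M :: 'h::complex_hilbert fock \<Rightarrow> 'v::complex_vector)"
proof
  fix f
  have "L 0 = M 0"
    using assms(1,2) unfolding clinear_iff by (metis add_cancel_right_left)
  then show "L f = M f"
    by (induction f rule: fock_induct) (use assms in \<open>auto simp: clinear_iff\<close>)
qed

text \<open>Uniqueness is \<open>clinear_fock_eqI\<close>; existence requires \<open>\<phi>\<close> to be multilinear on lists of each
  length. For the uses below it is shown in \<open>clinear_symmetrizer\<close>, \<open>symmetrizer_tensor\<close>,
  \<open>clinear_creation\<close>, \<open>creation_tensor\<close>, and likewise for the sesquilinear form \<open>fock_inner0\<close> in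
  the lemma of that name.\<close>

definition tensor_ext ::
    "('h::complex_hilbert list \<Rightarrow> 'v::complex_vector) \<Rightarrow> 'h fock \<Rightarrow> 'v" where
  "tensor_ext \<phi> = (THE L. clinear L \<and> (\<forall>xs. L (tensor xs) = \<phi> xs))"

lemma tensor_ext_eqI:
  "clinear L \<Longrightarrow> (\<And>xs. L (tensor xs) = \<phi> xs) \<Longrightarrow> tensor_ext \<phi> = L"
  unfolding tensor_ext_def by (rule the_equality) (auto intro: clinear_fock_eqI)

definition fock_inner0 :: "'h::complex_hilbert fock \<Rightarrow> 'h fock \<Rightarrow> complex" where
  "fock_inner0 = (THE B. (\<forall>f. clinear (B f)) \<and> (\<forall>f g. B f g = cnj (B g f)) \<and>
     (\<forall>xs ys. B (tensor xs) (tensor ys) =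
       (if length xs = length ys then \<Prod>i<length xs. cinner (xs ! i) (ys ! i) else 0)))"

definition symmetrizer :: "real \<Rightarrow> ('h::complex_hilbert \<Rightarrow> 'h) \<Rightarrow> 'h fock \<Rightarrow> 'h fock" where
  "symmetrizer q bar = tensor_ext (\<lambda>xs.
     \<Sum>\<sigma>\<in>coxD (length xs). (complex_of_real q ^ len (length xs) \<sigma>) *\<^sub>C tensor (act bar \<sigma> xs))"

definition fock_inner :: "real \<Rightarrow> ('h::complex_hilbert \<Rightarrow> 'h) \<Rightarrow> 'h fock \<Rightarrow> 'h fock \<Rightarrow> complex" where
  "fock_inner q bar f g = fock_inner0 f (symmetrizer q bar g)"

definition creation :: "'h::complex_hilbert \<Rightarrow> 'h fock \<Rightarrow> 'h fock" where
  "creation x = tensor_ext (\<lambda>xs. tensor (x # xs))"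

text \<open>Here \<open>J\<close> embeds the algebraic Fock space in its completion. The annihilation operator is the
  Hilbert space adjoint of the bounded extension of the creation operator.\<close>

definition creation_op :: "('h::complex_hilbert fock \<Rightarrow> 'k::complex_hilbert) \<Rightarrow> 'h \<Rightarrow> 'k \<Rightarrow> 'k" where
  "creation_op J x = extension J (creation x)"

definition annihilation_op :: "('h::complex_hilbert fock \<Rightarrow> 'k::complex_hilbert) \<Rightarrow> 'h \<Rightarrow> 'k \<Rightarrow> 'k" where
  "annihilation_op J x = adj (creation_op J x)"

definition gaussian :: "('h::complex_hilbert fock \<Rightarrow> 'k::complex_hilbert) \<Rightarrow> 'h \<Rightarrow> 'k \<Rightarrow> 'k" where
  "gaussian J x = (\<lambda>\<xi>. annihilation_op J x \<xi> + creation_op J x \<xi>)"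

definition vacuum_state :: "('h::complex_hilbert fock \<Rightarrow> 'k::complex_hilbert) \<Rightarrow> ('k \<Rightarrow> 'k) \<Rightarrow> complex" where
  "vacuum_state J a = cinner (J vacuum) (a (J vacuum))"


subsection \<open>The maps defined by their values on simple tensors\<close>

lemma cinner_simps:
  "cinner (x + y) z = cinner x z + cinner y (z :: 'h::complex_hilbert)"
  "cinner (c *\<^sub>C x) z = cnj c * cinner x z"
  by (metis cinner_commute cinner_add_right complex_cnj_add)
     (metis cinner_commute cinner_scaleC_right complex_cnj_mult)

lemma simple_form_commute: "simple_form xs ys = cnj (simple_form ys xs)"
proof -
  have "(\<Prod>i<length xs. cinner (ys ! i) (xs ! i)) = (\<Prod>i<length xs. cnj (cinner (xs ! i) (ys ! i)))"
    by (intro prod.cong refl cinner_commute)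
  then show ?thesis by (auto simp: simple_form_def)
qed

lemma fock_inner0_exists:
  obtains B :: "'h::complex_hilbert fock \<Rightarrow> 'h fock \<Rightarrow> complex" where
    "\<And>f. clinear (B f)" "\<And>f g. B f g = cnj (B g f)" "\<And>xs g. B (tensor xs) g = Rep_fock g xs"
proof -
  have ex: "\<exists>S c. finite S \<and> (\<forall>ys. Rep_fock f ys = (\<Sum>xs\<in>S. c xs * simple_form xs ys))"
    for f :: "'h fock"
  proof (induction f rule: fock_induct)
    case zero
    show ?case by (rule exI[of _ "{}"]) (simp add: zero_fock.rep_eq)
  next
    case (step f d zs)
    then obtain S c where S: "finite S" "\<And>ys. Rep_fock f ys = (\<Sum>xs\<in>S. c xs * simple_form xs ys)"
      by auto
    define c' where "c' = (\<lambda>xs. (if xs \<in> S then c xs else 0) + (if xs = zs then d else 0))"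
    have "Rep_fock (f + d *\<^sub>C tensor zs) ys = (\<Sum>xs\<in>insert zs S. c' xs * simple_form xs ys)" for ys
    proof -
      have "(\<Sum>xs\<in>insert zs S. c' xs * simple_form xs ys) =
          (\<Sum>xs\<in>insert zs S. (if xs \<in> S then c xs * simple_form xs ys else 0)) +
          (\<Sum>xs\<in>insert zs S. (if xs = zs then d * simple_form xs ys else 0))"
        unfolding c'_def sum.distrib[symmetric] by (intro sum.cong) (auto simp: algebra_simps)
      also have "(\<Sum>xs\<in>insert zs S. (if xs \<in> S then c xs * simple_form xs ys else 0)) =
          (\<Sum>xs\<in>S. c xs * simple_form xs ys)"
        using S(1) by (intro sum.mono_neutral_cong_right) auto
      also have "(\<Sum>xs\<in>insert zs S. (if xs = zs then d * simple_form xs ys else 0)) =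
          d * simple_form zs ys"
        using S(1) by (subst sum.delta) auto
      finally show ?thesis
        by (simp add: S(2) plus_fock.rep_eq scaleC_fock.rep_eq tensor.rep_eq)
    qed
    then show ?case using S(1) by (intro exI[of _ "insert zs S"] exI[of _ c']) auto
  qed
  then obtain S c where S: "\<And>f. finite (S f)"
      "\<And>f ys. Rep_fock (f::'h fock) ys = (\<Sum>xs\<in>S f. c f xs * simple_form xs ys)"
    by metis
  define B where "B f g = (\<Sum>xs\<in>S f. cnj (c f xs) * Rep_fock g xs)" for f g :: "'h fock"
  have lin: "clinear (B f)" for f
    unfolding clinear_iff
    by (auto simp: B_def plus_fock.rep_eq scaleC_fock.rep_eq scaleC_complex_def
      algebra_simps sum.distrib sum_distrib_left)
  have sym: "B f g = cnj (B g f)" for f g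
  proof -
    have "B f g = (\<Sum>xs\<in>S f. \<Sum>ys\<in>S g. cnj (c f xs) * c g ys * simple_form ys xs)"
      by (simp add: B_def S(2)[of g] sum_distrib_left mult.assoc)
    also have "\<dots> = (\<Sum>ys\<in>S g. \<Sum>xs\<in>S f. cnj (c f xs) * c g ys * simple_form ys xs)"
      by (rule sum.swap)
    also have "\<dots> = (\<Sum>ys\<in>S g. c g ys * cnj (\<Sum>xs\<in>S f. c f xs * simple_form xs ys))"
      by (intro sum.cong refl) (simp add: sum_distrib_left simple_form_commute[symmetric]
        mult.assoc mult.left_commute)
    also have "\<dots> = cnj (B g f)"
      by (simp add: B_def S(2)[of f])
    finally show ?thesis .
  qed
  have tens: "B (tensor xs) g = Rep_fock g xs" for xs g
  proof -
    have "B (tensor xs) g = cnj (B g (tensor xs))" by (rule sym)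
    also have "\<dots> = (\<Sum>ys\<in>S g. c g ys * simple_form ys xs)"
      by (simp add: B_def tensor.rep_eq simple_form_commute[symmetric])
    finally show ?thesis by (simp add: S(2)[of g])
  qed
  show ?thesis by (rule that[OF lin sym tens])
qed

lemma fock_inner0:
  shows clinear_fock_inner0: "clinear (fock_inner0 f)"
    and fock_inner0_commute: "fock_inner0 f g = cnj (fock_inner0 g f)"
    and fock_inner0_tensor: "fock_inner0 (tensor xs) (tensor ys) =
      (if length xs = length ys then \<Prod>i<length xs. cinner (xs ! i) (ys ! i) else 0)"
    and fock_inner0_tensor_left: "fock_inner0 (tensor xs) g = Rep_fock g xs"
proof -
  let ?P = "\<lambda>B :: 'a fock \<Rightarrow> 'a fock \<Rightarrow> complex.
    (\<forall>f. clinear (B f)) \<and> (\<forall>f g. B f g = cnj (B g f)) \<and> (\<forall>xs ys. B (tensor xs) (tensor ys) =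
       (if length xs = length ys then \<Prod>i<length xs. cinner (xs ! i) (ys ! i) else 0))"
  obtain B :: "'a fock \<Rightarrow> 'a fock \<Rightarrow> complex" where B: "\<And>f. clinear (B f)"
      "\<And>f g. B f g = cnj (B g f)" "\<And>xs g. B (tensor xs) g = Rep_fock g xs"
    using fock_inner0_exists by blast
  have Bt: "B (tensor xs) (tensor ys) =
      (if length xs = length ys then \<Prod>i<length xs. cinner (xs ! i) (ys ! i) else 0)" for xs ys
    by (simp add: B(3) tensor.rep_eq simple_form_def)
  have P: "?P B"
    by (intro conjI allI B(1,2) Bt)
  have uniq: "C = B" if "?P C" for C
  proof -
    from that have C: "\<And>f. clinear (C f)" "\<And>f g. C f g = cnj (C g f)"
        "\<And>xs ys. C (tensor xs) (tensor ys) = B (tensor xs) (tensor ys)"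
      unfolding Bt by blast+
    have 1: "C (tensor xs) = B (tensor xs)" for xs
      by (rule clinear_fock_eqI[OF C(1) B(1) C(3)])
    have 2: "C f (tensor ys) = B f (tensor ys)" for f ys
      unfolding C(2)[of f "tensor ys"] B(2)[of f "tensor ys"] 1 ..
    have "C f = B f" for f
      by (rule clinear_fock_eqI[OF C(1) B(1) 2])
    then show ?thesis by blast
  qed
  have eq: "fock_inner0 = B"
    unfolding fock_inner0_def by (rule the_equality, rule P, rule uniq)
  show "clinear (fock_inner0 f)" unfolding eq by (rule B(1))
  show "fock_inner0 f g = cnj (fock_inner0 g f)" unfolding eq by (rule B(2))
  show "fock_inner0 (tensor xs) g = Rep_fock g xs" unfolding eq by (rule B(3))
  show "fock_inner0 (tensor xs) (tensor ys) =
      (if length xs = length ys then \<Prod>i<length xs. cinner (xs ! i) (ys ! i) else 0)"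
    unfolding eq by (rule Bt)
qed

lemma clinear_ext_exists:
  fixes F :: "('h::complex_hilbert list \<Rightarrow> complex) \<Rightarrow> 'h list \<Rightarrow> complex"
  assumes "\<And>ys. F (\<lambda>ys. 0) ys = 0"
    and "\<And>f g c ys. F (\<lambda>ys. f ys + c * g ys) ys = F f ys + c * F g ys"
    and "\<And>xs. F (simple_form xs) = Rep_fock (\<phi> xs)"
  shows "clinear (tensor_ext \<phi>)" "tensor_ext \<phi> (tensor xs) = \<phi> xs"
proof -
  have mem: "F f \<in> fock_forms" if "f \<in> fock_forms" for f
    using that
  proof (induction f rule: fock_forms.induct)
    case zero
    have "F (\<lambda>ys. 0) = (\<lambda>ys. 0)" using assms(1) by blast
    then show ?case by (simp add: fock_forms.zero)
  next
    case (step f c xs)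
    have "F (\<lambda>ys. f ys + c * simple_form xs ys) = (\<lambda>ys. F f ys + c * Rep_fock (\<phi> xs) ys)"
      using assms(2,3) by presburger
    then show ?case
      using fock_forms_add[OF step(2) fock_forms_scale[OF Rep_fock]] by simp
  qed
  define L where "L f = Abs_fock (F (Rep_fock f))" for f
  have rep: "Rep_fock (L f) = F (Rep_fock f)" for f
    by (simp add: L_def Abs_fock_inverse mem Rep_fock)
  have "clinear L"
    unfolding clinear_iff
  proof (intro conjI allI)
    show "L (f + g) = L f + L g" for f g
      using assms(2)[of "Rep_fock f" 1 "Rep_fock g"]
      by (simp add: Rep_fock_inject[symmetric] rep plus_fock.rep_eq fun_eq_iff)
    show "L (c *\<^sub>C f) = c *\<^sub>C L f" for c f
      using assms(2)[of "\<lambda>ys. 0" c "Rep_fock f"] assms(1)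
      by (simp add: Rep_fock_inject[symmetric] rep scaleC_fock.rep_eq fun_eq_iff)
  qed
  moreover have "L (tensor xs) = \<phi> xs" for xs
    by (simp add: Rep_fock_inject[symmetric] rep tensor.rep_eq assms(3))
  ultimately have "tensor_ext \<phi> = L" "clinear L" "\<And>xs. L (tensor xs) = \<phi> xs"
    by (auto intro: tensor_ext_eqI)
  then show "clinear (tensor_ext \<phi>)" "tensor_ext \<phi> (tensor xs) = \<phi> xs" by auto
qed

lemma clinear_creation: "clinear (creation x)"
  and creation_tensor: "creation x (tensor xs) = tensor (x # xs)"
proof -
  let ?F = "\<lambda>f ys. case ys of [] \<Rightarrow> 0 | y # ys' \<Rightarrow> cinner y x * f ys'"
  have *: "?F (simple_form xs) = Rep_fock (tensor (x # xs))" for xs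
    by (auto simp: fun_eq_iff tensor.rep_eq simple_form_def prod.lessThan_Suc_shift split: list.splits
      simp del: prod.lessThan_Suc)
  show "clinear (creation x)" "creation x (tensor xs) = tensor (x # xs)"
    unfolding creation_def
    by (rule clinear_ext_exists[of ?F]; use * in \<open>auto simp: algebra_simps split: list.splits\<close>)+
qed

lemma simple_form_act:
  assumes "selfadjoint_involution bar" "\<sigma> \<in> coxB (length xs)"
  shows "simple_form (act bar \<sigma> xs) ys = simple_form xs (act bar (inv \<sigma>) ys)"
proof (cases "length ys = length xs")
  case True
  have sa: "cinner (bar x) y = cinner x (bar y)" "bar (bar x) = x" for x y
    using assms(1) by (auto simp: selfadjoint_involution_def)
  define n where "n = length xs"
  have n: "length xs = n" "length ys = n" using True by (auto simp: n_def)
  have p: "\<sigma> permutes ({- int n..int n} - {0})" and odd: "\<sigma> (- k) = - \<sigma> k" for k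
    using assms(2) by (auto simp: coxB_def n)
  note inv = coxB_inv_facts[OF assms(2), unfolded n]
  have s1: "\<sigma> (inv \<sigma> k) = k" "inv \<sigma> (\<sigma> k) = k" for k
    using inv(1) by (auto simp: bij_is_surj bij_is_inj surj_f_inv_f)
  have s2: "\<sigma> k \<in> {- int n..int n} - {0}" if "k \<in> {- int n..int n} - {0}" for k
    using permutes_in_image[OF p] that by blast
  have s3: "inv \<sigma> k \<in> {- int n..int n} - {0}" if "k \<in> {- int n..int n} - {0}" for k
    using inv(3) that by blast
  define a where "a i = nat \<bar>inv \<sigma> (int i + 1)\<bar> - 1" for i
  define b where "b i = nat \<bar>\<sigma> (int i + 1)\<bar> - 1" for i
  have A: "inv \<sigma> (int i + 1) \<in> {- int n..int n} - {0}" "\<sigma> (int i + 1) \<in> {- int n..int n} - {0}"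
    if "i < n" for i
    using that by (auto intro!: s2 s3 simp del: Diff_iff)
  have ia: "int (a i) + 1 = \<bar>inv \<sigma> (int i + 1)\<bar>" if "i < n" for i
    using A(1)[OF that] by (auto simp: a_def)
  have ib: "int (b i) + 1 = \<bar>\<sigma> (int i + 1)\<bar>" if "i < n" for i
    using A(2)[OF that] by (auto simp: b_def)
  have ba: "b (a i) = i" if "i < n" for i
  proof -
    have "\<sigma> (int (a i) + 1) = int i + 1 \<or> \<sigma> (int (a i) + 1) = - (int i + 1)"
      unfolding ia[OF that] by (auto simp: abs_if odd s1)
    then show ?thesis by (auto simp: b_def)
  qed
  have ab: "a (b i) = i" if "i < n" for i
  proof -
    have "inv \<sigma> (int (b i) + 1) = int i + 1 \<or> inv \<sigma> (int (b i) + 1) = - (int i + 1)"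
      unfolding ib[OF that] by (auto simp: abs_if inv(2) s1)
    then show ?thesis by (auto simp: a_def)
  qed
  have "(\<Prod>i<n. cinner (ys ! i) (act bar \<sigma> xs ! i)) =
      (\<Prod>i<n. cinner (act bar (inv \<sigma>) ys ! i) (xs ! i))"
  proof (rule prod.reindex_bij_witness[of _ b a])
    fix i assume "i \<in> {..<n}"
    then have i: "i < n" by simp
    show "b (a i) = i" by (rule ba[OF i])
    show "a (b i) = i" by (rule ab[OF i])
    show la: "a i \<in> {..<n}" using A(1)[OF i] ia[OF i] by auto
    show "b i \<in> {..<n}" using A(2)[OF i] ib[OF i] by auto
    have "act bar (inv \<sigma>) ys ! a i = letter bar ys (\<sigma> (int (a i) + 1))"
      using la n inv(1) by (simp add: nth_act inv_inv_eq)
    moreover have "act bar \<sigma> xs ! i = letter bar xs (inv \<sigma> (int i + 1))"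
      using i n by (simp add: nth_act)
    moreover have "\<sigma> (int (a i) + 1) = (if inv \<sigma> (int i + 1) > 0 then int i + 1 else - (int i + 1))"
      unfolding ia[OF i] using A(1)[OF i] by (auto simp: abs_if odd s1)
    ultimately show "cinner (act bar (inv \<sigma>) ys ! a i) (xs ! a i) =
        cinner (ys ! i) (act bar \<sigma> xs ! i)"
      using A(1)[OF i] by (auto simp: letter_def a_def sa nat_add_distrib abs_if)
  qed
  then show ?thesis using n by (simp add: simple_form_def)
qed (simp add: simple_form_def)

lemma symmetrizer:
  assumes "selfadjoint_involution bar"
  shows clinear_symmetrizer: "clinear (symmetrizer q bar)"
    and symmetrizer_tensor: "symmetrizer q bar (tensor xs) =
      (\<Sum>\<sigma>\<in>coxD (length xs). (complex_of_real q ^ len (length xs) \<sigma>) *\<^sub>C tensor (act bar \<sigma> xs))"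
proof -
  let ?F = "\<lambda>f ys. \<Sum>\<sigma>\<in>coxD (length ys).
    complex_of_real q ^ len (length ys) \<sigma> * f (act bar (inv \<sigma>) ys)"
  have rep: "Rep_fock (sum f I) ys = (\<Sum>i\<in>I. Rep_fock (f i) ys)" for f :: "_ \<Rightarrow> 'a fock" and I ys
    by (induction I rule: infinite_finite_induct) (auto simp: zero_fock.rep_eq plus_fock.rep_eq)
  have *: "?F (simple_form xs) = Rep_fock (\<Sum>\<sigma>\<in>coxD (length xs).
      (complex_of_real q ^ len (length xs) \<sigma>) *\<^sub>C tensor (act bar \<sigma> xs))" for xs
  proof
    fix ys
    show "?F (simple_form xs) ys = Rep_fock (\<Sum>\<sigma>\<in>coxD (length xs).
      (complex_of_real q ^ len (length xs) \<sigma>) *\<^sub>C tensor (act bar \<sigma> xs)) ys"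
    proof (cases "length ys = length xs")
      case True
      then show ?thesis
        using subsetD[OF coxD_coxB]
        by (simp add: rep scaleC_fock.rep_eq tensor.rep_eq simple_form_act[OF assms])
    next
      case False
      then show ?thesis by (simp add: rep scaleC_fock.rep_eq tensor.rep_eq simple_form_def)
    qed
  qed
  show "clinear (symmetrizer q bar)" "symmetrizer q bar (tensor xs) =
      (\<Sum>\<sigma>\<in>coxD (length xs). (complex_of_real q ^ len (length xs) \<sigma>) *\<^sub>C tensor (act bar \<sigma> xs))"
    unfolding symmetrizer_def
    by (rule clinear_ext_exists[of ?F];
        use * in \<open>simp add: algebra_simps sum.distrib sum_distrib_left\<close>)+
qed

end

theory Submission
  imports Defs
begin

text \<open>Both directions start from the boundedness of the creation operators, uniformly over the tensor powers.
Write \<open>P\<^sup>n\<close> for the symmetrizer on \<open>n\<close>-fold tensors. The stabilizer of the first leg is a copy of \<open>D(n-1)\<close>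
acting on the remaining legs. For \<open>n \<ge> 2\<close> every element of \<open>D(n)\<close> is uniquely \<open>u c\<close> with \<open>u\<close> in that
subgroup and \<open>c\<close> one of \<open>2 n\<close> coset representatives. Lengths add in this product (\<open>len_coset\<close>), so
\<open>P\<^sup>n = (1 \<otimes> P\<^sup>n\<^sup>-\<^sup>1) R\<close> with \<open>R\<close> the sum of the representatives weighted by powers of \<open>q\<close>
(\<open>symmetrizer_factorization\<close>). The lengths of the representatives run through two intervals, so the
coefficients of \<open>R\<close> have absolute sum at most \<open>2 / (1 - \<bar>q\<bar>)\<close> for every \<open>n\<close>. Now \<open>R\<close> is symmetric
for the semi-inner product with Gram operator \<open>1 \<otimes> P\<^sup>n\<^sup>-\<^sup>1\<close>, because \<open>P\<^sup>n\<close> is selfadjoint, and its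
powers grow at most geometrically with that ratio; by a log-convexity argument the ratio bounds the
numerical range of \<open>R\<close> (\<open>symmetric_operator_bound\<close>). Applied to \<open>x \<otimes> f\<close> this reads
\<open>\<parallel>x \<otimes> f\<parallel>\<^sup>2 \<le> 2 / (1 - \<bar>q\<bar>) \<parallel>x\<parallel>\<^sup>2 \<parallel>f\<parallel>\<^sup>2\<close> (\<open>creation_bound\<close>).

Suppose that the vacuum state is a trace. Then the fourth moment of \<open>G(a) G(b) G(c) G(d)\<close> is invariant
under cyclic rotation of the arguments. It depends only on \<open>P\<^sup>2\<close>, which has four terms
(\<open>fourth_moment\<close>). For \<open>q \<noteq> 0\<close> the invariance is a quadratic identity for the Hermitian form
\<open>\<beta>(x, y) = \<langle>x, bar y\<rangle>\<close> on \<open>H\<^sub>\<real>\<close>. It forces \<open>\<beta>\<close> to be symmetric and then to have rank at most one, whereas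
\<open>\<beta>\<close> is nondegenerate because \<open>bar\<close> is invertible; this is impossible in dimension at least two
(\<open>no_cyclic_fourth_moment\<close>).

For \<open>q = 0\<close> the symmetrizer is the identity and the space is the full Fock space. Adding tensor legs on
the right gives Gaussian operators that commute with those adding legs on the left and have the same
effect on the vacuum vector. Such a mirror image of a generating set makes the vector state tracial
on its double commutant (\<open>vector_state_trace\<close>), which contains the generated von Neumann algebra.\<close>

section \<open>Bounded operators on complex Hilbert spaces\<close>

lemma cinner_zero [simp]: "cinner x 0 = 0" "cinner 0 (x :: 'k::complex_hilbert) = 0"
  using cinner_add_right[of x 0 0] cinner_simps(1)[of 0 0 x] by auto

lemma cinner_minus: "cinner x (- y) = - cinner x y" "cinner (- x) y = - cinner x (y :: 'k::complex_hilbert)"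
  using cinner_add_right[of x y "- y"] cinner_simps(1)[of x "- x" y]
  by (simp_all add: eq_neg_iff_add_eq_0 add.commute)

lemma cinner_diff:
  "cinner x (y - z) = cinner x y - cinner x z"
  "cinner (x - w) y = cinner x y - cinner w (y :: 'k::complex_hilbert)"
  using cinner_add_right[of x y "- z"] cinner_simps(1)[of x "- w" y] by (simp_all add: cinner_minus)

text \<open>Through this formula continuity of the complex inner product is inherited from the real one.\<close>

lemma cinner_eq_Complex: "cinner x y = Complex (inner x y) (- inner x (\<i> *\<^sub>C y))"
  by (simp add: complex_eq_iff inner_eq_Re_cinner cinner_scaleC_right)

lemma cinner_self: "cinner x x = complex_of_real ((norm (x :: 'k::complex_hilbert))\<^sup>2)"
proof -
  have "Im (cinner x x) = 0"
    using arg_cong[OF cinner_commute[of x x], of Im] by simp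
  moreover have "Re (cinner x x) = (norm x)\<^sup>2"
    by (simp add: inner_eq_Re_cinner[symmetric] power2_norm_eq_inner)
  ultimately show ?thesis by (simp add: complex_eq_iff)
qed

lemma cinner_eqI: "(\<And>z. cinner x z = cinner y z) \<Longrightarrow> x = (y :: 'k::complex_hilbert)"
  using cinner_self[of "x - y"] by (simp add: cinner_diff)

lemma norm_scaleC: "norm (c *\<^sub>C x) = cmod c * norm (x :: 'k::complex_hilbert)"
proof -
  have "cinner (c *\<^sub>C x) (c *\<^sub>C x) = (c * cnj c) * cinner x x"
    by (simp add: cinner_simps cinner_scaleC_right)
  then have "complex_of_real ((norm (c *\<^sub>C x))\<^sup>2) = complex_of_real ((cmod c * norm x)\<^sup>2)"
    by (simp add: cinner_self complex_norm_square[symmetric] power_mult_distrib)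
  then have "(norm (c *\<^sub>C x))\<^sup>2 = (cmod c * norm x)\<^sup>2" by (simp only: of_real_eq_iff)
  then show ?thesis by (simp add: power2_eq_iff_nonneg)
qed

lemma scaleC_zero [simp]: "c *\<^sub>C (0 :: 'a::complex_vector) = 0" "0 *\<^sub>C (x :: 'a::complex_vector) = 0"
  using scaleC_add_right[of c "0::'a" 0] scaleC_add_left[of 0 0 x] by auto

lemma bounded_linear_scaleC: "bounded_linear (\<lambda>x :: 'k::complex_hilbert. c *\<^sub>C x)"
proof (rule bounded_linear_intro[where K = "cmod c"])
  fix r :: real and x :: 'k
  show "c *\<^sub>C (r *\<^sub>R x) = r *\<^sub>R (c *\<^sub>C x)"
    by (simp add: scaleC_of_real[symmetric] scaleC_scaleC mult.commute)
qed (auto simp: scaleC_add_right norm_scaleC mult.commute)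

lemma tendsto_cinner:
  fixes f g :: "'c \<Rightarrow> 'k::complex_hilbert"
  assumes "(f \<longlongrightarrow> a) F" "(g \<longlongrightarrow> b) F"
  shows "((\<lambda>x. cinner (f x) (g x)) \<longlongrightarrow> cinner a b) F"
  unfolding cinner_eq_Complex
  by (intro tendsto_Complex tendsto_inner tendsto_minus bounded_linear.tendsto[OF
      bounded_linear_scaleC] assms)

text \<open>The representing vector minimizes \<open>\<parallel>x\<parallel>\<^sup>2 / 2 - \<phi> x\<close>. The parallelogram identity turns a minimizing
sequence into a Cauchy sequence, and the vanishing of the first variation at the minimum is the claim.\<close>

lemma riesz_representation:
  fixes \<phi> :: "'k::{real_inner, complete_space} \<Rightarrow> real"
  assumes "bounded_linear \<phi>"
  obtains z where "\<And>y. \<phi> y = inner z y"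
proof -
  interpret \<phi>: bounded_linear \<phi> by fact
  obtain K where K: "\<And>x. norm (\<phi> x) \<le> norm x * K" using \<phi>.bounded by blast
  define E where "E x = (norm x)\<^sup>2 / 2 - \<phi> x" for x
  have low: "E x \<ge> - K\<^sup>2 / 2" for x
  proof -
    have "0 \<le> (norm x - K)\<^sup>2" by simp
    then have "- K\<^sup>2 / 2 \<le> (norm x)\<^sup>2 / 2 - norm x * K" by (simp add: power2_diff)
    then show ?thesis using K[of x] unfolding E_def by (auto simp: abs_le_iff)
  qed
  then have bdd: "bdd_below (range E)" by (intro bdd_belowI2)
  define m where "m = Inf (range E)"
  have m: "m \<le> E x" for x unfolding m_def using bdd by (simp add: cInf_lower)
  have "\<exists>x. E x < m + inverse (real (Suc n))" for n
    using cInf_lessD[of "range E" "m + inverse (real (Suc n))"] by (auto simp: m_def)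
  then obtain X where X: "\<And>n. E (X n) < m + inverse (real (Suc n))" by metis
  have par: "(norm (x - y))\<^sup>2 / 4 = E x + E y - 2 * E ((1/2) *\<^sub>R (x + y))" for x y
    unfolding E_def
    by (simp add: power2_norm_eq_inner \<phi>.add \<phi>.scale inner_diff inner_add inner_commute field_simps)
  have dist: "(norm (X i - X j))\<^sup>2 \<le> 4 * (inverse (real (Suc i)) + inverse (real (Suc j)))" for i j
    using par[of "X i" "X j"] X[of i] X[of j] m[of "(1/2) *\<^sub>R (X i + X j)"]
    unfolding distrib_left by linarith
  have "Cauchy X"
  proof (rule CauchyI)
    fix e :: real assume e: "e > 0"
    then obtain M where M: "inverse (real (Suc M)) < e\<^sup>2 / 8"
      using reals_Archimedean[of "e\<^sup>2 / 8"] by auto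
    have "norm (X i - X j) < e" if "i \<ge> M" "j \<ge> M" for i j
    proof -
      have "inverse (real (Suc i)) \<le> inverse (real (Suc M))" "inverse (real (Suc j)) \<le> inverse
          (real (Suc M))"
        using that by (auto intro!: le_imp_inverse_le)
      then have "(norm (X i - X j))\<^sup>2 < e\<^sup>2" using dist[of i j] M unfolding distrib_left by linarith
      then show ?thesis by (rule power2_less_imp_less) (use e in simp)
    qed
    then show "\<exists>M. \<forall>i\<ge>M. \<forall>j\<ge>M. norm (X i - X j) < e" by blast
  qed
  then obtain z where z: "X \<longlonglongrightarrow> z" by (auto simp: Cauchy_convergent_iff convergent_def)
  have "(\<lambda>n. E (X n)) \<longlonglongrightarrow> E z"
    unfolding E_def by (intro tendsto_intros z \<phi>.tendsto) simp
  moreover have "(\<lambda>n. m + inverse (real (Suc n))) \<longlonglongrightarrow> m + 0"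
    by (intro tendsto_intros LIMSEQ_inverse_real_of_nat)
  ultimately have "E z \<le> m + 0"
    by (rule LIMSEQ_le) (use X less_imp_le in blast)
  then have min: "E z \<le> E x" for x using m[of x] by linarith
  have "\<phi> y = inner z y" for y
  proof (rule ccontr)
    define d where "d = inner z y - \<phi> y"
    assume "\<phi> y \<noteq> inner z y"
    then have d: "d \<noteq> 0" by (simp add: d_def)
    have "(norm (z + t *\<^sub>R y))\<^sup>2 = (norm z)\<^sup>2 + 2 * t * inner z y + t\<^sup>2 * (norm y)\<^sup>2" for t
      unfolding power2_norm_eq_inner
      by (simp add: inner_add inner_commute power2_eq_square algebra_simps)
    then have "E (z + t *\<^sub>R y) = E z + t * d + t\<^sup>2 * (norm y)\<^sup>2 / 2" for t
      unfolding E_def d_def by (simp add: \<phi>.add \<phi>.scale field_simps)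
    then have *: "0 \<le> t * d + t\<^sup>2 * (norm y)\<^sup>2 / 2" for t using min[of "z + t *\<^sub>R y"] by auto
    \<comment> \<open>the step \<open>- d / s\<close> would lower the energy: the quadratic term is at most half the linear gain\<close>
    define s where "s = 1 + (norm y)\<^sup>2"
    have s: "s > 0" "(norm y)\<^sup>2 / s \<le> 1" unfolding s_def by (auto simp: add_pos_nonneg)
    have "0 \<le> (- d / s) * d + (- d / s)\<^sup>2 * (norm y)\<^sup>2 / 2" by (rule *)
    also have "\<dots> = d\<^sup>2 / s * ((norm y)\<^sup>2 / s / 2 - 1)"
      using s(1) by (simp add: field_simps power2_eq_square)
    also have "\<dots> < 0" using s d by (intro mult_pos_neg) auto
    finally show False by simp
  qed
  then show thesis by (rule that)
qed

lemma bounded_clinearD: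
  assumes "bounded_clinear A"
  shows "A (x + y) = A x + A y" "A (c *\<^sub>C x) = c *\<^sub>C A x" "A (x - y) = A x - A y" "A 0 = 0"
    "bounded_linear A"
proof -
  show b: "bounded_linear A" and "A (x + y) = A x + A y" "A (c *\<^sub>C x) = c *\<^sub>C A x"
    using assms by (auto simp: bounded_clinear_def clinear_iff)
  show "A (x - y) = A x - A y" "A 0 = 0"
    using bounded_linear.linear[OF b] by (auto simp: linear_diff linear_0)
qed

lemma bounded_clinearI:
  "bounded_linear A \<Longrightarrow> (\<And>c x. A (c *\<^sub>C x) = c *\<^sub>C A x) \<Longrightarrow> bounded_clinear A"
  by (auto simp: bounded_clinear_def clinear_iff bounded_linear.linear linear_add)

lemma bounded_clinear_comp: "bounded_clinear A \<Longrightarrow> bounded_clinear B \<Longrightarrow> bounded_clinear (A \<circ> B)"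
  by (rule bounded_clinearI) (auto simp: bounded_clinearD bounded_linear_compose o_def)

lemma bounded_clinear_add:
  "bounded_clinear A \<Longrightarrow> bounded_clinear B \<Longrightarrow> bounded_clinear (\<lambda>x. A x + B x)"
  by (rule bounded_clinearI) (auto simp: bounded_clinearD bounded_linear_add scaleC_add_right)

lemma bounded_clinear_scaleC: "bounded_clinear A \<Longrightarrow> bounded_clinear (\<lambda>x. c *\<^sub>C A x)"
  by (rule bounded_clinearI)
    (auto simp: bounded_clinearD bounded_linear_compose[OF bounded_linear_scaleC] scaleC_scaleC
      mult.commute)

lemma bounded_clinear_id: "bounded_clinear id"
  by (rule bounded_clinearI) (auto simp: bounded_linear_ident id_def)

lemma adj_eqI:
  assumes "bounded_clinear B" "\<And>x y. cinner (B x) y = cinner x (A y)"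
  shows "adj A = B"
  unfolding adj_def
proof (rule the_equality)
  fix C assume C: "bounded_clinear C \<and> (\<forall>x y. cinner (C x) y = cinner x (A y))"
  show "C = B"
  proof
    fix x show "C x = B x" by (rule cinner_eqI) (simp add: C assms(2))
  qed
qed (use assms in auto)

text \<open>The adjoint is a definite description, so its existence has to be shown. The real representation
theorem provides it, as the imaginary part of \<open>\<langle>x, A y\<rangle>\<close> is determined by the
real part at \<open>\<i> y\<close>.\<close>

lemma adj:
  fixes A :: "'k::complex_hilbert \<Rightarrow> 'k"
  assumes A: "bounded_clinear A"
  shows bounded_clinear_adj: "bounded_clinear (adj A)"
    and cinner_adj_left: "cinner (adj A x) y = cinner x (A y)"
    and cinner_adj_right: "cinner x (adj A y) = cinner (A x) y"
proof -
  have "\<exists>z. \<forall>y. inner z y = inner x (A y)" for x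
    using riesz_representation[OF bounded_linear_compose[OF bounded_linear_inner_right[of x]
        bounded_clinearD(5)[OF A]]]
    by metis
  then obtain B where B: "\<And>x y. inner (B x) y = inner x (A y)" by metis
  have cB: "cinner (B x) y = cinner x (A y)" for x y
    by (simp add: cinner_eq_Complex B bounded_clinearD(2)[OF A])
  obtain K where K: "\<And>x. norm (A x) \<le> norm x * K" and "K \<ge> 0"
    using bounded_linear.nonneg_bounded[OF bounded_clinearD(5)[OF A]] by blast
  have add: "B (x + y) = B x + B y" and scale: "B (c *\<^sub>C x) = c *\<^sub>C B x" for x y c
    by (rule cinner_eqI, simp add: cB cinner_simps)+
  have "bounded_linear B"
  proof (rule bounded_linear_intro[where K = K])
    show "B (r *\<^sub>R x) = r *\<^sub>R B x" for r x
      using scale[of "complex_of_real r" x] by (simp add: scaleC_of_real)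
    show "norm (B x) \<le> norm x * K" for x
    proof (cases "norm (B x) = 0")
      case True then show ?thesis using \<open>K \<ge> 0\<close> by simp
    next
      case False
      have "(norm (B x))\<^sup>2 = inner x (A (B x))" by (simp add: power2_norm_eq_inner B)
      also have "\<dots> \<le> norm x * norm (A (B x))" by (rule norm_cauchy_schwarz)
      also have "\<dots> \<le> norm x * (norm (B x) * K)" by (intro mult_left_mono K) simp
      finally have "norm (B x) * norm (B x) \<le> norm (B x) * (norm x * K)"
        by (simp add: power2_eq_square algebra_simps)
      then show ?thesis using False by (auto simp: mult_le_cancel_left)
    qed
  qed (rule add)
  then have bB: "bounded_clinear B" using scale by (rule bounded_clinearI)
  have eq: "adj A = B" by (rule adj_eqI[OF bB cB])
  show "bounded_clinear (adj A)" using bB eq by simp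
  show l: "cinner (adj A x) y = cinner x (A y)" for x y using cB eq by simp
  show "cinner x (adj A y) = cinner (A x) y"
    by (metis cinner_commute l)
qed

lemma adj_adj: "bounded_clinear A \<Longrightarrow> adj (adj A) = A"
  by (rule adj_eqI) (auto simp: cinner_adj_right)

lemma adj_comp: "bounded_clinear A \<Longrightarrow> bounded_clinear B \<Longrightarrow> adj (A \<circ> B) = adj B \<circ> adj A"
  by (rule adj_eqI) (auto simp: cinner_adj_left bounded_clinear_comp bounded_clinear_adj)

lemma adj_add:
  "bounded_clinear A \<Longrightarrow> bounded_clinear B \<Longrightarrow> adj (\<lambda>x. A x + B x) = (\<lambda>x. adj A x + adj B x)"
  by (rule adj_eqI) (auto simp: cinner_adj_left bounded_clinear_add bounded_clinear_adj
      cinner_simps cinner_add_right)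

lemma adj_scaleC: "bounded_clinear A \<Longrightarrow> adj (\<lambda>x. c *\<^sub>C A x) = (\<lambda>x. cnj c *\<^sub>C adj A x)"
  by (rule adj_eqI)
    (auto simp: cinner_adj_left bounded_clinear_scaleC bounded_clinear_adj cinner_simps cinner_scaleC_right)

lemma commutantD: "a \<in> S \<Longrightarrow> b \<in> commutant S \<Longrightarrow> a (b x) = b (a x)"
  by (auto simp: commutant_def fun_eq_iff)

lemma commutant_bounded: "b \<in> commutant S \<Longrightarrow> bounded_clinear b"
  by (simp add: commutant_def)

lemma commutantI: "bounded_clinear b \<Longrightarrow> (\<And>a x. a \<in> S \<Longrightarrow> a (b x) = b (a x)) \<Longrightarrow> b \<in> commutant S"
  by (auto simp: commutant_def fun_eq_iff)

lemma commutant_antimono: "S \<subseteq> T \<Longrightarrow> commutant T \<subseteq> commutant S"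
  by (auto simp: commutant_def)

lemma commutant_commutant: "(\<And>a. a \<in> S \<Longrightarrow> bounded_clinear a) \<Longrightarrow> S \<subseteq> commutant (commutant S)"
  by (intro subsetI commutantI) (auto simp: commutant_def fun_eq_iff)

lemma commutant_comp: "a \<in> commutant S \<Longrightarrow> b \<in> commutant S \<Longrightarrow> a \<circ> b \<in> commutant S"
  by (rule commutantI) (simp_all add: bounded_clinear_comp commutant_bounded commutantD[of _ S a]
      commutantD[of _ S b])

lemma commutant_add:
  assumes "\<And>a. a \<in> S \<Longrightarrow> bounded_clinear a" "a \<in> commutant S" "b \<in> commutant S"
  shows "(\<lambda>x. a x + b x) \<in> commutant S"
  using assms
  by (intro commutantI)
    (simp_all add: bounded_clinear_add commutant_bounded bounded_clinearD commutantD[of _ S a]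
      commutantD[of _ S b])

lemma commutant_scaleC:
  assumes "\<And>a. a \<in> S \<Longrightarrow> bounded_clinear a" "a \<in> commutant S"
  shows "(\<lambda>x. c *\<^sub>C a x) \<in> commutant S"
  using assms
  by (intro commutantI)
    (simp_all add: bounded_clinear_scaleC commutant_bounded bounded_clinearD commutantD[of _ S a])

lemma commutant_id: "id \<in> commutant S"
  by (rule commutantI) (auto simp: bounded_clinear_id)

lemma commutant_adj:
  assumes S: "\<And>a. a \<in> S \<Longrightarrow> bounded_clinear a \<and> adj a \<in> S" and b: "b \<in> commutant S"
  shows "adj b \<in> commutant S"
proof (rule commutantI)
  note bb = commutant_bounded[OF b]
  show "bounded_clinear (adj b)" using bb by (rule bounded_clinear_adj)
  fix a x assume a: "a \<in> S"
  show "a (adj b x) = adj b (a x)"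
  proof (rule cinner_eqI)
    fix z
    have "cinner (a (adj b x)) z = cinner x (b (adj a z))"
      using S[OF a] bb by (metis cinner_adj_left cinner_adj_right)
    also have "\<dots> = cinner x (adj a (b z))" using S[OF a] b commutantD by metis
    also have "\<dots> = cinner (adj b (a x)) z"
      using S[OF a] bb by (simp add: cinner_adj_left cinner_adj_right)
    finally show "cinner (a (adj b x)) z = cinner (adj b (a x)) z" .
  qed
qed

text \<open>A selfadjoint set has a selfadjoint commutant, and taking three commutants is the same as taking one.\<close>

lemma von_neumann_algebra_double_commutant:
  assumes S: "\<And>a. a \<in> S \<Longrightarrow> bounded_clinear a \<and> adj a \<in> S"
  shows "von_neumann_algebra (commutant (commutant S))"
  unfolding von_neumann_algebra_def
proof (intro conjI ballI)
  have S': "bounded_clinear b \<and> adj b \<in> commutant S" if "b \<in> commutant S" for b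
    using that commutant_adj[OF S] commutant_bounded by blast
  fix a assume a: "a \<in> commutant (commutant S)"
  then show "bounded_clinear a" by (rule commutant_bounded)
  show "adj a \<in> commutant (commutant S)" by (rule commutant_adj[OF S' a])
next
  have "commutant (commutant (commutant S)) = commutant S"
    by (rule antisym[OF commutant_antimono commutant_commutant])
      (use S commutant_bounded commutant_commutant in blast)+
  then show "commutant (commutant (commutant (commutant S))) = commutant (commutant S)" by simp
qed

lemma vN_generated_subset:
  assumes "\<And>a. a \<in> S \<Longrightarrow> bounded_clinear a \<and> adj a \<in> S"
  shows "vN_generated S \<subseteq> commutant (commutant S)"
proof -
  have "S \<subseteq> commutant (commutant S)" using assms by (intro commutant_commutant) blast
  then show ?thesis
    using von_neumann_algebra_double_commutant[OF assms] unfolding vN_generated_def by blast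
qed

lemma vN_generated_gen: "a \<in> S \<Longrightarrow> a \<in> vN_generated S"
  by (auto simp: vN_generated_def)

text \<open>Each von Neumann algebra is a commutant and hence closed under products.\<close>

lemma vN_generated_comp:
  assumes "a \<in> vN_generated S" "b \<in> vN_generated S"
  shows "a \<circ> b \<in> vN_generated S"
  unfolding vN_generated_def
proof (rule InterI)
  fix M assume "M \<in> {M. von_neumann_algebra M \<and> S \<subseteq> M}"
  then have M: "commutant (commutant M) = M" "a \<in> M" "b \<in> M"
    using assms unfolding vN_generated_def von_neumann_algebra_def by blast+
  then show "a \<circ> b \<in> M" using commutant_comp[of a "commutant M" b] by simp
qed

lemma dense_eqI:
  fixes A B :: "'k::metric_space \<Rightarrow> 'l::t2_space"
  assumes "continuous_on UNIV A" "continuous_on UNIV B" "closure D = UNIV" "\<And>x. x \<in> D \<Longrightarrow> A x = B x"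
  shows "A = B"
proof
  fix x
  obtain X where X: "\<And>n. X n \<in> D" "X \<longlonglongrightarrow> x"
    using assms(3) closure_sequential[of x D] by auto
  have "(\<lambda>n. A (X n)) \<longlonglongrightarrow> A x" "(\<lambda>n. B (X n)) \<longlonglongrightarrow> B x"
    using assms(1,2) X(2)
    by (auto simp: continuous_on_eq_continuous_at isCont_def intro: isCont_tendsto_compose)
  then show "A x = B x" using assms(4) X(1) LIMSEQ_unique by fastforce
qed

lemma bounded_clinear_dense_eqI:
  assumes "bounded_clinear A" "bounded_clinear B" "closure D = UNIV" "\<And>x. x \<in> D \<Longrightarrow> A x = B x"
  shows "A = B"
  by (rule dense_eqI[OF _ _ assms(3,4)])
    (auto intro!: linear_continuous_on bounded_clinearD assms)

lemma clinear_sub: "clinear L \<Longrightarrow> L (x - y) = L x - L y"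
  by (metis clinear_iff add_diff_cancel_right' diff_add_cancel)

lemma clinear_0: "clinear L \<Longrightarrow> L 0 = 0"
  by (metis clinear_sub diff_self)

text \<open>The estimate also shows that \<open>J (A f)\<close> depends on \<open>J f\<close> only, so that there is a map to extend.
Linearity passes from the dense range to the whole space one argument at a time.\<close>

lemma extension:
  fixes J :: "'v::complex_vector \<Rightarrow> 'k::complex_hilbert"
  assumes J: "clinear J" "closure (range J) = UNIV" and A: "clinear A"
    and bound: "\<And>f. norm (J (A f)) \<le> C * norm (J f)"
  shows bounded_clinear_extension: "bounded_clinear (extension J A)"
    and extension_apply: "extension J A (J f) = J (A f)"
proof -
  have wd: "J (A f) = J (A g)" if "J f = J g" for f g
  proof -
    have "J (A f) - J (A g) = J (A (f - g))" using J(1) A by (simp add: clinear_sub)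
    moreover have "norm (J (A (f - g))) \<le> C * norm (J f - J g)"
      using bound[of "f - g"] J(1) by (simp add: clinear_sub)
    ultimately show ?thesis using that by simp
  qed
  define T0 where "T0 \<xi> = J (A (SOME f. J f = \<xi>))" for \<xi>
  have T0: "T0 (J f) = J (A f)" for f
    unfolding T0_def by (rule wd) (rule someI[of _ f], simp)
  have d: "dist (T0 (J f)) (T0 (J g)) \<le> C * dist (J f) (J g)" for f g
    using bound[of "f - g"] J(1) A by (simp add: dist_norm T0 clinear_sub)
  have "uniformly_continuous_on (range J) T0"
  proof (rule uniformly_continuous_on_def[THEN iffD2, rule_format])
    fix e :: real assume e: "e > 0"
    show "\<exists>d>0. \<forall>x\<in>range J. \<forall>x'\<in>range J. dist x' x < d \<longrightarrow> dist (T0 x') (T0 x) < e"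
    proof (intro exI[of _ "e / (\<bar>C\<bar> + 1)"] conjI ballI impI)
      show "e / (\<bar>C\<bar> + 1) > 0" using e by simp
      fix x x' assume x: "x \<in> range J" "x' \<in> range J" and l: "dist x' x < e / (\<bar>C\<bar> + 1)"
      have "dist (T0 x') (T0 x) \<le> C * dist x' x" using d x by blast
      also have "\<dots> \<le> (\<bar>C\<bar> + 1) * dist x' x" by (intro mult_right_mono) auto
      also have "\<dots> < e" using l by (simp add: field_simps add_pos_nonneg)
      finally show "dist (T0 x') (T0 x) < e" .
    qed
  qed
  then obtain T where T: "uniformly_continuous_on (closure (range J)) T" "\<And>x. x \<in> range J \<Longrightarrow> T0 x = T x"
    by (rule uniformly_continuous_on_extension_on_closure) blast
  have contT: "continuous_on UNIV T" using T(1) J(2) uniformly_continuous_imp_continuous by metis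
  have TJ: "T (J f) = J (A f)" for f using T(2) T0 by (metis rangeI)
  have scale: "T (c *\<^sub>C \<xi>) = c *\<^sub>C T \<xi>" for c \<xi>
  proof -
    have "(\<lambda>\<xi>. T (c *\<^sub>C \<xi>)) = (\<lambda>\<xi>. c *\<^sub>C T \<xi>)"
    proof (rule dense_eqI[OF _ _ J(2)])
      show "continuous_on UNIV (\<lambda>\<xi>. T (c *\<^sub>C \<xi>))"
        by (rule continuous_on_compose2[OF contT linear_continuous_on[OF bounded_linear_scaleC]]) auto
      show "continuous_on UNIV (\<lambda>\<xi>. c *\<^sub>C T \<xi>)"
        by (rule continuous_on_compose2[OF linear_continuous_on[OF bounded_linear_scaleC] contT]) auto
      fix \<xi> assume "\<xi> \<in> range J"
      then obtain f where "\<xi> = J f" by auto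
      then show "T (c *\<^sub>C \<xi>) = c *\<^sub>C T \<xi>"
        using J(1) A TJ by (metis clinear_iff)
    qed
    then show ?thesis by (rule fun_cong)
  qed
  have add1: "T (J f + \<eta>) = T (J f) + T \<eta>" for f \<eta>
  proof -
    have "(\<lambda>\<eta>. T (J f + \<eta>)) = (\<lambda>\<eta>. T (J f) + T \<eta>)"
    proof (rule dense_eqI[OF _ _ J(2)])
      show "continuous_on UNIV (\<lambda>\<eta>. T (J f + \<eta>))"
        by (rule continuous_on_compose2[OF contT]) (auto intro!: continuous_intros)
      show "continuous_on UNIV (\<lambda>\<eta>. T (J f) + T \<eta>)"
        by (intro continuous_intros contT)
      fix \<eta> assume "\<eta> \<in> range J"
      then obtain g where "\<eta> = J g" by auto
      then show "T (J f + \<eta>) = T (J f) + T \<eta>"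
        using J(1) A TJ by (metis clinear_iff)
    qed
    then show ?thesis by (rule fun_cong)
  qed
  have add: "T (\<xi> + \<eta>) = T \<xi> + T \<eta>" for \<xi> \<eta>
  proof -
    have "(\<lambda>\<xi>. T (\<xi> + \<eta>)) = (\<lambda>\<xi>. T \<xi> + T \<eta>)"
    proof (rule dense_eqI[OF _ _ J(2)])
      show "continuous_on UNIV (\<lambda>\<xi>. T (\<xi> + \<eta>))"
        by (rule continuous_on_compose2[OF contT]) (auto intro!: continuous_intros)
      show "continuous_on UNIV (\<lambda>\<xi>. T \<xi> + T \<eta>)"
        by (intro continuous_intros contT)
    qed (use add1 in auto)
    then show ?thesis by (rule fun_cong)
  qed
  have bd: "norm (T \<xi>) \<le> norm \<xi> * C" for \<xi>
  proof -
    obtain X where X: "\<And>n. X n \<in> range J" "X \<longlonglongrightarrow> \<xi>"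
      using J(2) closure_sequential[of \<xi> "range J"] by auto
    have "(\<lambda>n. T (X n)) \<longlonglongrightarrow> T \<xi>"
      using contT X(2) by (auto simp: continuous_on_eq_continuous_at intro: isCont_tendsto_compose)
    then have "(\<lambda>n. norm (T (X n))) \<longlonglongrightarrow> norm (T \<xi>)" "(\<lambda>n. norm (X n) * C) \<longlonglongrightarrow> norm \<xi> * C"
      using X(2) by (auto intro!: tendsto_intros)
    moreover have "norm (T (X n)) \<le> norm (X n) * C" for n
      using X(1)[of n] bound TJ by (auto simp: mult.commute)
    ultimately show ?thesis by (meson LIMSEQ_le)
  qed
  have "bounded_linear T"
    by (rule bounded_linear_intro[OF add _ bd]) (metis scale scaleC_of_real)
  then have bT: "bounded_clinear T" using scale by (rule bounded_clinearI)
  have "extension J A = T"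
    unfolding extension_def
  proof (rule the_equality)
    fix T' assume T': "bounded_clinear T' \<and> (\<forall>f. T' (J f) = J (A f))"
    show "T' = T"
      by (rule bounded_clinear_dense_eqI[OF _ bT J(2)]) (use T' TJ in auto)
  qed (use bT TJ in auto)
  then show "bounded_clinear (extension J A)" "extension J A (J f) = J (A f)" using bT TJ by auto
qed

section \<open>Traces from a commuting mirror image\<close>

text \<open>Call \<open>p\<close> in the double commutant good if some \<open>p'\<close> in the commutant satisfies \<open>p' \<Omega> = p \<Omega>\<close> and
\<open>p'\<^sup>* \<Omega> = p\<^sup>* \<Omega>\<close>. Good elements form an algebra, in which \<open>p'\<close> for a product is the product of the mirror
images in reverse order; so they carry \<open>\<Omega>\<close> to a dense subspace. For \<open>x\<close> in the double commutant,
\<open>\<langle>\<Omega>, x p \<Omega>\<rangle> = \<langle>\<Omega>, x p' \<Omega>\<rangle> = \<langle>\<Omega>, p' x \<Omega>\<rangle> = \<langle>p\<^sup>* \<Omega>, x \<Omega>\<rangle> = \<langle>\<Omega>, p x \<Omega>\<rangle>\<close>, so traciality holds against good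
elements. In particular \<open>\<parallel>p\<^sup>* \<Omega>\<parallel> = \<parallel>p \<Omega>\<parallel>\<close>, and therefore \<open>p\<^sub>n \<Omega> \<longlonglongrightarrow> b \<Omega>\<close> implies convergence of
\<open>p\<^sub>n\<^sup>* \<Omega>\<close>, which carries the identity over to \<open>b\<close>. The density hypothesis is stated as an induction
principle: a subspace that contains \<open>\<Omega>\<close> and is invariant under \<open>S\<close> is dense.\<close>

lemma vector_state_trace:
  fixes S :: "('k::complex_hilbert \<Rightarrow> 'k) set"
  assumes S: "\<And>a. a \<in> S \<Longrightarrow> bounded_clinear a \<and> adj a = a"
    and mirror: "\<And>a. a \<in> S \<Longrightarrow> \<exists>a'\<in>commutant S. adj a' = a' \<and> a' \<Omega> = a \<Omega>"
    and cyclic: "\<And>D. \<Omega> \<in> D \<Longrightarrow> (\<And>\<xi> \<eta>. \<xi> \<in> D \<Longrightarrow> \<eta> \<in> D \<Longrightarrow> \<xi> + \<eta> \<in> D) \<Longrightarrow>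
      (\<And>c \<xi>. \<xi> \<in> D \<Longrightarrow> c *\<^sub>C \<xi> \<in> D) \<Longrightarrow> (\<And>a \<xi>. a \<in> S \<Longrightarrow> \<xi> \<in> D \<Longrightarrow> a \<xi> \<in> D) \<Longrightarrow> closure D = UNIV"
    and a: "a \<in> commutant (commutant S)" and b: "b \<in> commutant (commutant S)"
  shows "cinner \<Omega> (a (b \<Omega>)) = cinner \<Omega> (b (a \<Omega>))"
proof -
  have Sb: "\<And>a. a \<in> S \<Longrightarrow> bounded_clinear a" using S by blast
  define S1 where "S1 = commutant S"
  define S2 where "S2 = commutant S1"
  have S1b: "bounded_clinear x" if "x \<in> S1" for x
    using that by (auto simp: S1_def commutant_bounded)
  have S2b: "bounded_clinear x" if "x \<in> S2" for x
    using that by (auto simp: S2_def commutant_bounded)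
  have S1adj: "adj x \<in> S1" if "x \<in> S1" for x
    using that commutant_adj[of S x] S by (auto simp: S1_def)
  have S2adj: "adj x \<in> S2" if "x \<in> S2" for x
    using that commutant_adj[of S1 x] S1b S1adj by (auto simp: S2_def)
  have comm: "x (y \<xi>) = y (x \<xi>)" if "x \<in> S1" "y \<in> S2" for x y \<xi>
    using that unfolding S2_def by (rule commutantD)
  \<comment> \<open>\<open>p'\<close> is the mirror image of \<open>p\<close>\<close>
  define good where "good p p' \<longleftrightarrow> p \<in> S2 \<and> p' \<in> S1 \<and> p' \<Omega> = p \<Omega> \<and> adj p' \<Omega> = adj p \<Omega>" for p p'
  define D where "D = {p \<Omega> | p p'. good p p'}"
  have "good id id"
    by (auto simp: good_def S1_def S2_def commutant_id)
  then have "\<Omega> \<in> D" unfolding D_def by (metis (mono_tags, lifting) id_apply mem_Collect_eq)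
  moreover have "\<xi> + \<eta> \<in> D" if "\<xi> \<in> D" "\<eta> \<in> D" for \<xi> \<eta>
  proof -
    from that obtain p p' r r' where *: "good p p'" "\<xi> = p \<Omega>" "good r r'" "\<eta> = r \<Omega>"
      by (auto simp: D_def)
    have "good (\<lambda>x. p x + r x) (\<lambda>x. p' x + r' x)"
      using * S1b S2b commutant_add[of S p' r', OF Sb] commutant_add[of S1 p r, OF S1b]
      by (auto simp: good_def adj_add S1_def[symmetric] S2_def[symmetric])
    then show ?thesis using * by (auto simp: D_def)
  qed
  moreover have "c *\<^sub>C \<xi> \<in> D" if "\<xi> \<in> D" for c \<xi>
  proof -
    from that obtain p p' where *: "good p p'" "\<xi> = p \<Omega>" by (auto simp: D_def)
    have "good (\<lambda>x. c *\<^sub>C p x) (\<lambda>x. c *\<^sub>C p' x)"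
      using * S1b S2b commutant_scaleC[of S p' c, OF Sb] commutant_scaleC[of S1 p c, OF S1b]
      by (auto simp: good_def adj_scaleC S1_def[symmetric] S2_def[symmetric])
    then show ?thesis using * by (auto simp: D_def)
  qed
  moreover have "x \<xi> \<in> D" if x: "x \<in> S" and "\<xi> \<in> D" for x \<xi>
  proof -
    from that obtain p p' where *: "good p p'" "\<xi> = p \<Omega>" by (auto simp: D_def)
    obtain x' where x': "x' \<in> S1" "adj x' = x'" "x' \<Omega> = x \<Omega>"
      using mirror[OF x] by (auto simp: S1_def)
    have x2: "x \<in> S2" using commutant_commutant[OF Sb] x by (auto simp: S1_def S2_def)
    \<comment> \<open>mirror images multiply in reverse order\<close>
    have "good (x \<circ> p) (p' \<circ> x')"
    proof -
      have "adj (p' \<circ> x') \<Omega> = x' (adj p \<Omega>)"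
        using * S1b x' by (auto simp: good_def adj_comp)
      also have "\<dots> = adj p (x \<Omega>)" using comm[OF x'(1) S2adj] * x'(3) by (auto simp: good_def)
      also have "\<dots> = adj (x \<circ> p) \<Omega>" using * S2b x2 S[OF x] by (auto simp: good_def adj_comp)
      finally have "adj (p' \<circ> x') \<Omega> = adj (x \<circ> p) \<Omega>" .
      moreover have "p' (x' \<Omega>) = x (p \<Omega>)"
        using * x'(3) comm[OF _ x2, of p'] by (auto simp: good_def)
      ultimately show ?thesis using * x2 x'(1)
        by (auto simp: good_def S1_def S2_def intro: commutant_comp)
    qed
    then show ?thesis
      unfolding D_def using * by (intro CollectI exI[of _ "x \<circ> p"] exI[of _ "p' \<circ> x'"]) auto
  qed
  ultimately have dense: "closure D = UNIV" by (rule cyclic)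
  have tr: "cinner (adj x \<Omega>) (p \<Omega>) = cinner (adj p \<Omega>) (x \<Omega>)" if "x \<in> S2" "good p p'" for x p p'
  proof -
    have "cinner (adj x \<Omega>) (p \<Omega>) = cinner \<Omega> (x (p' \<Omega>))"
      using that S2b by (auto simp: good_def cinner_adj_left)
    also have "\<dots> = cinner \<Omega> (p' (x \<Omega>))" using that comm[of p' x] by (auto simp: good_def)
    also have "\<dots> = cinner (adj p \<Omega>) (x \<Omega>)"
      using that S1b by (auto simp: good_def cinner_adj_left[symmetric])
    finally show ?thesis .
  qed
  have ab: "a \<in> S2" "b \<in> S2" using a b by (auto simp: S1_def S2_def)
  obtain X where X: "\<And>n. X n \<in> D" "X \<longlonglongrightarrow> b \<Omega>"
    using dense closure_sequential[of "b \<Omega>" D] by auto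
  have "\<exists>p p'. good p p' \<and> X n = p \<Omega>" for n using X(1)[of n] by (auto simp: D_def)
  then obtain p p' where p: "\<And>n. good (p n) (p' n)" "\<And>n. X n = p n \<Omega>" by metis
  define Y where "Y n = adj (p n) \<Omega>" for n
  have iso: "norm (Y i - Y j) = norm (X i - X j)" for i j
  proof -
    have i: "cinner (Y i) (Y j) = cinner (X j) (X i)" for i j
    proof -
      have "cinner (adj (adj (p j)) \<Omega>) (p i \<Omega>) = cinner (adj (p i) \<Omega>) (adj (p j) \<Omega>)"
        by (rule tr) (use p(1) in \<open>auto simp: good_def S2adj\<close>)
      moreover have "adj (adj (p j)) = p j" using p(1)[of j] S2b by (auto simp: good_def adj_adj)
      ultimately show ?thesis by (simp add: Y_def p(2))
    qed
    have "cinner (Y i - Y j) (Y i - Y j) = cinner (X i - X j) (X i - X j)"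
      by (simp add: cinner_diff i)
    then have "(norm (Y i - Y j))\<^sup>2 = (norm (X i - X j))\<^sup>2"
      unfolding cinner_self of_real_eq_iff .
    then show ?thesis by (simp add: power2_eq_iff_nonneg)
  qed
  have "Cauchy Y"
    using LIMSEQ_imp_Cauchy[OF X(2)] unfolding Cauchy_iff iso .
  then obtain \<eta> where \<eta>: "Y \<longlonglongrightarrow> \<eta>" by (auto simp: Cauchy_convergent_iff convergent_def)
  have lim: "cinner (adj x \<Omega>) (b \<Omega>) = cinner \<eta> (x \<Omega>)" if "x \<in> S2" for x
  proof -
    have "(\<lambda>n. cinner (adj x \<Omega>) (X n)) \<longlonglongrightarrow> cinner (adj x \<Omega>) (b \<Omega>)"
      by (intro tendsto_cinner tendsto_const X)
    moreover have "(\<lambda>n. cinner (Y n) (x \<Omega>)) \<longlonglongrightarrow> cinner \<eta> (x \<Omega>)"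
      by (intro tendsto_cinner tendsto_const \<eta>)
    moreover have "cinner (adj x \<Omega>) (X n) = cinner (Y n) (x \<Omega>)" for n
      using tr[OF that p(1)] by (simp add: Y_def p(2))
    ultimately show ?thesis using LIMSEQ_unique by force
  qed
  have "\<eta> = adj b \<Omega>"
  proof -
    have cont: "continuous_on UNIV (cinner \<zeta>)" for \<zeta> :: 'k
      by (auto simp: continuous_on_def intro: tendsto_cinner tendsto_const)
    have "(\<lambda>\<xi>. cinner \<eta> \<xi>) = (\<lambda>\<xi>. cinner (adj b \<Omega>) \<xi>)"
    proof (rule dense_eqI[OF cont cont dense])
      fix \<xi> assume "\<xi> \<in> D"
      then obtain r r' where r: "good r r'" "\<xi> = r \<Omega>" by (auto simp: D_def)
      then show "cinner \<eta> \<xi> = cinner (adj b \<Omega>) \<xi>"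
        using lim[of r] tr[OF ab(2) r(1)] by (simp add: good_def)
    qed
    then have "cinner \<eta> \<xi> = cinner (adj b \<Omega>) \<xi>" for \<xi> by (rule fun_cong)
    then show ?thesis by (rule cinner_eqI)
  qed
  then show ?thesis
    using lim[OF ab(1)] S2b ab by (simp add: cinner_adj_left)
qed

section \<open>Cosets of the parabolic subgroup of type D\<close>

text \<open>The embedding of signed permutations of \<open>1, \<dots>, n\<close> as signed permutations of \<open>2, \<dots>, n + 1\<close>: all absolute
values move up by one. It sends the generators of type \<open>D\<^sub>n\<close> to all generators of type \<open>D\<^sub>n\<^sub>+\<^sub>1\<close> other than
the one exchanging \<open>1\<close> and \<open>2\<close> (and, for \<open>n = 1\<close>, its hatted companion).\<close>

definition shift :: "(int \<Rightarrow> int) \<Rightarrow> int \<Rightarrow> int" where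
  "shift u x = (if x > 1 then u (x - 1) + sgn (u (x - 1))
     else if x < - 1 then u (x + 1) + sgn (u (x + 1)) else x)"

text \<open>The odd extension of the cycle that moves \<open>k\<close> to \<open>1\<close> and raises \<open>1, \<dots>, k - 1\<close> by one.\<close>

definition cyc :: "nat \<Rightarrow> int \<Rightarrow> int" where
  "cyc k x = (if \<bar>x\<bar> = int k then sgn x else if \<bar>x\<bar> < int k then x + sgn x else x)"

text \<open>The representative that maps \<open>p\<close> to \<open>1\<close>. The elements of type D have an even number of sign changes, so
for negative \<open>p\<close> a second sign is changed, at the value \<open>N\<close>.\<close>

definition coset_rep :: "nat \<Rightarrow> int \<Rightarrow> int \<Rightarrow> int" where
  "coset_rep N p = (if p > 0 then cyc (nat p) else flip N \<circ> cyc (nat (- p)) \<circ> flip (nat (- p)))"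

text \<open>The length of \<open>coset_rep N p\<close>. The generators act on the positions along the path
\<open>1, \<dots>, N - 1\<close>, which forks into \<open>N\<close> and \<open>- N\<close>, rejoins at \<open>- (N - 1)\<close> and continues to \<open>- 1\<close>; the depth is
the distance from \<open>1\<close>.\<close>

definition depth :: "nat \<Rightarrow> int \<Rightarrow> nat" where
  "depth N p = nat (if p > 0 then p - 1 else 2 * int N - 1 + p)"

lemma shift_swap: "1 \<le> i \<Longrightarrow> shift (swap i) = swap (Suc i)"
  by (rule ext) (auto simp: shift_def swap_def Transposition.transpose_def sgn_if)

lemma hat_swap_apply:
  assumes "n \<ge> 2"
  shows "hat_swap n x = (if x = int n then 1 - int n else if x = int n - 1 then - int n
    else if x = - int n then int n - 1 else if x = 1 - int n then int n else x)"
  using assms by (auto simp: hat_swap_def flip_def swap_def Transposition.transpose_def of_nat_diff)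

lemma shift_hat_swap: "2 \<le> n \<Longrightarrow> shift (hat_swap n) = hat_swap (Suc n)"
  by (rule ext) (auto simp: shift_def hat_swap_apply sgn_if)

lemma shift_id: "shift id = id"
  by (rule ext) (auto simp: shift_def)

lemma coxB_nonzero:
  assumes "u \<in> coxB n" shows "u x = 0 \<longleftrightarrow> x = 0" and "u (- x) = - u x" and "bij u"
proof -
  have p: "u permutes ({- int n..int n} - {0})" and "\<And>k. u (- k) = - u k"
    using assms by (auto simp: coxB_def)
  then show "u (- x) = - u x" "bij u" by (auto intro: permutes_bij)
  have "u 0 = 0" using p by (auto simp: permutes_def)
  then show "u x = 0 \<longleftrightarrow> x = 0" using p permutes_inj[OF p] by (metis injD)
qed

lemma shift_comp:
  assumes "u \<in> coxB n" "v \<in> coxB n"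
  shows "shift (u \<circ> v) = shift u \<circ> shift v"
proof
  fix x
  have nz: "v x = 0 \<longleftrightarrow> x = 0" for x using coxB_nonzero[OF assms(2)] by blast
  show "shift (u \<circ> v) x = (shift u \<circ> shift v) x"
    using nz[of "x - 1"] nz[of "x + 1"]
    by (auto simp: shift_def sgn_if)
qed

lemma coxB_inv: "u \<in> coxB n \<Longrightarrow> inv u \<in> coxB n"
  using coxB_inv_facts(2)[of u n] by (auto simp: coxB_def intro: permutes_inv)

lemma shift_coxB:
  assumes u: "u \<in> coxB n" shows "shift u \<in> coxB (Suc n)"
proof -
  have "shift u \<circ> shift (inv u) = id" "shift (inv u) \<circ> shift u = id"
    using shift_comp[OF u coxB_inv[OF u]] shift_comp[OF coxB_inv[OF u] u] coxB_nonzero(3)[OF u]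
    by (simp_all add: shift_id bij_is_inj bij_is_surj surj_iff[symmetric] inj_iff[symmetric]
        del: id_o o_id) (metis bij_def inj_iff shift_id surj_iff)+
  then have "bij (shift u)" by (intro o_bij)
  moreover have "shift u x = x" if "x \<notin> {- int (Suc n)..int (Suc n)} - {0}" for x
  proof -
    have *: "u y = y" if "y \<notin> {- int n..int n} - {0}" for y
      using u that by (auto simp: coxB_def permutes_def)
    show ?thesis using that *[of "x - 1"] *[of "x + 1"] by (auto simp: shift_def sgn_if)
  qed
  moreover have "shift u (- x) = - shift u x" for x
  proof -
    have "u (x - 1) = - u (1 - x)" "u (x + 1) = - u (- x - 1)"
      using coxB_nonzero(2)[OF u, of "1 - x"] coxB_nonzero(2)[OF u, of "- x - 1"]
      by (auto simp: add.commute)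
    then show ?thesis by (auto simp: shift_def sgn_if)
  qed
  ultimately show ?thesis
    by (auto simp: coxB_def permutes_def bij_iff)
qed

lemma shift_inj:
  assumes "u \<in> coxB n" "v \<in> coxB n" "shift u = shift v"
  shows "u = v"
proof
  fix x :: int
  have e: "y + sgn y = z + sgn z \<Longrightarrow> y = z" for y z :: int by (auto simp: sgn_if split: if_splits)
  consider "x > 0" | "x < 0" | "x = 0" by linarith
  then show "u x = v x"
  proof cases
    case 1
    then show ?thesis using fun_cong[OF assms(3), of "x + 1"] by (auto simp: shift_def intro: e)
  next
    case 2
    then show ?thesis using fun_cong[OF assms(3), of "x - 1"] by (auto simp: shift_def intro: e)
  next
    case 3
    then show ?thesis using coxB_nonzero(1)[OF assms(1)] coxB_nonzero(1)[OF assms(2)] by metis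
  qed
qed

definition positions :: "nat \<Rightarrow> int set" where
  "positions N = {- int N..int N} - {0}"

lemma odd_eqI:
  fixes f g :: "int \<Rightarrow> int"
  assumes "\<And>x. f (- x) = - f x" "\<And>x. g (- x) = - g x" "\<And>x. x > 0 \<Longrightarrow> f x = g x"
  shows "f = g"
proof
  fix x :: int
  consider "x > 0" | "x = 0" | "- x > 0" by linarith
  then show "f x = g x"
  proof cases
    case 2
    then show ?thesis using assms(1)[of 0] assms(2)[of 0] by simp
  next
    case 3
    then show ?thesis using assms(1)[of x] assms(2)[of x] assms(3)[of "- x"] by simp
  qed (use assms in auto)
qed

lemma swap_apply:
  assumes "1 \<le> i"
  shows "swap i x = (if x = int i then int i + 1 else if x = int i + 1 then int i
    else if x = - int i then - int i - 1 else if x = - int i - 1 then - int i else x)"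
  using assms by (auto simp: swap_def Transposition.transpose_def)

lemma cyc_minus: "cyc k (- x) = - cyc k x"
  by (auto simp: cyc_def)

lemma flip_minus: "flip k (- x) = - flip k x"
  by (auto simp: flip_def Transposition.transpose_def)

lemma coset_rep_minus: "coset_rep N p (- x) = - coset_rep N p x"
  by (auto simp: coset_rep_def cyc_minus flip_minus)

lemma swap_minus: "1 \<le> i \<Longrightarrow> swap i (- x) = - swap i x"
  by (auto simp: swap_apply)

lemma hat_swap_minus: "2 \<le> n \<Longrightarrow> hat_swap n (- x) = - hat_swap n x"
  by (auto simp: hat_swap_apply)

lemma coset_rep_pos:
  assumes "p > 0" "x > 0"
  shows "coset_rep N p x = (if x = p then 1 else if x < p then x + 1 else x)"
  using assms by (auto simp: coset_rep_def cyc_def)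

text \<open>On positive arguments, which suffice by oddness; the sign change at the value \<open>N\<close> is the last \<open>if\<close>.\<close>

lemma coset_rep_neg:
  assumes "N \<ge> 2" "k > 0" "x > 0"
  shows "coset_rep N (- k) x = (if x = k then - 1 else
     let y = (if x < k then x + 1 else x) in if y = int N then - y else y)"
  using assms by (auto simp: coset_rep_def cyc_def flip_def Transposition.transpose_def)

text \<open>A generator either moves the position, and then carries one representative to another, or fixes it,
and then can be moved through the representative, where it becomes a shifted generator of the smaller
group (\<open>coset_rep_move\<close> and \<open>coset_rep_fix\<close> below). This and the next lemma treat the first case.\<close>

lemma coset_rep_swap_move:
  assumes "N \<ge> 2" "p \<in> positions N" "1 \<le> i" "i < N" "swap i p \<noteq> p"
  shows "coset_rep N p \<circ> swap i = coset_rep N (swap i p)"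
proof (rule odd_eqI)
  fix x :: int assume x: "x > 0"
  have s: "swap i x = (if x = int i then int i + 1 else if x = int i + 1 then int i else x)" "swap i x > 0"
    using assms(3) x by (auto simp: swap_apply)
  have c: "coset_rep N (- int i - 1) y = (if y = int i + 1 then - 1 else
     let z = (if y < int i + 1 then y + 1 else y) in if z = int N then - z else z)" if "y > 0" for y
    using coset_rep_neg[OF assms(1), of "int i + 1" y] that assms(3) by (simp add: Let_def)
  consider "p = int i" | "p = int i + 1" | "p = - int i" | "p = - (int i + 1)"
    using assms(3,5) by (auto simp: swap_apply split: if_splits)
  then show "(coset_rep N p \<circ> swap i) x = coset_rep N (swap i p) x"
  proof cases
    case 1
    have "swap i p = int i + 1" using assms(3) 1 by (auto simp: swap_apply)
    then show ?thesis using 1 s assms x by (auto simp: coset_rep_pos)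
  next
    case 2
    have "swap i p = int i" using assms(3) 2 by (auto simp: swap_apply)
    then show ?thesis using 2 s assms x by (auto simp: coset_rep_pos)
  next
    case 3
    have "swap i p = - (int i + 1)" using assms(3) 3 by (auto simp: swap_apply)
    then show ?thesis using 3 s assms x by (auto simp: coset_rep_neg c Let_def)
  next
    case 4
    have "swap i p = - int i" using assms(3) 4 by (auto simp: swap_apply)
    then show ?thesis using 4 s assms x by (auto simp: coset_rep_neg c Let_def)
  qed
qed (use assms(3) in \<open>auto simp: coset_rep_minus swap_minus\<close>)

lemma coset_rep_hat_move:
  assumes "N \<ge> 2" "p \<in> positions N" "hat_swap N p \<noteq> p"
  shows "coset_rep N p \<circ> hat_swap N = coset_rep N (hat_swap N p)"
proof (rule odd_eqI)
  fix x :: int assume x: "x > 0"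
  have s: "hat_swap N x = (if x = int N then - (int N - 1) else if x = int N - 1 then - int N else x)"
    using assms(1) x by (auto simp: hat_swap_apply)
  consider "p = int N" | "p = int N - 1" | "p = - int N" | "p = - (int N - 1)"
    using assms(1,3) by (auto simp: hat_swap_apply split: if_splits)
  then show "(coset_rep N p \<circ> hat_swap N) x = coset_rep N (hat_swap N p) x"
  proof cases
    case 1
    have "hat_swap N p = - (int N - 1)" using assms(1) 1 by (auto simp: hat_swap_apply)
    then show ?thesis
      unfolding o_apply s
      using 1 assms(1) x
      by (auto simp: coset_rep_pos coset_rep_neg coset_rep_minus Let_def simp del: minus_diff_eq)
  next
    case 2
    have "hat_swap N p = - int N" using assms(1) 2 by (auto simp: hat_swap_apply)
    then show ?thesis
      unfolding o_apply s
      using 2 assms(1) x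
      by (auto simp: coset_rep_pos coset_rep_neg coset_rep_minus Let_def simp del: minus_diff_eq)
  next
    case 3
    have "hat_swap N p = int N - 1" using assms(1) 3 by (auto simp: hat_swap_apply)
    then show ?thesis
      unfolding o_apply s
      using 3 assms(1) x
      by (auto simp: coset_rep_pos coset_rep_neg coset_rep_minus Let_def simp del: minus_diff_eq)
  next
    case 4
    have "hat_swap N p = int N" using assms(1) 4 by (auto simp: hat_swap_apply)
    then show ?thesis
      unfolding o_apply s
      using 4 assms(1) x
      by (auto simp: coset_rep_pos coset_rep_neg coset_rep_minus Let_def simp del: minus_diff_eq)
  qed
qed (use assms(1) in \<open>auto simp: coset_rep_minus hat_swap_minus\<close>)

lemma gensD_cases:
  assumes "N \<ge> 2" "s \<in> gensD N"
  obtains i where "1 \<le> i" "i < N" "s = swap i" | "s = hat_swap N"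
  using assms by (auto simp: gensD_def)

lemma depth_move:
  assumes "N \<ge> 2" "p \<in> positions N" "s \<in> gensD N"
  shows "s p \<in> positions N" "depth N (s p) \<le> Suc (depth N p)"
proof -
  have "s p \<in> positions N \<and> depth N (s p) \<le> Suc (depth N p)"
    using assms(1,3)
  proof (cases rule: gensD_cases)
    case (1 i)
    then show ?thesis using assms(1,2) by (auto simp: positions_def depth_def swap_apply)
  next
    case 2
    then show ?thesis using assms(1,2) by (auto simp: positions_def depth_def hat_swap_apply)
  qed
  then show "s p \<in> positions N" "depth N (s p) \<le> Suc (depth N p)" by auto
qed

lemma swap_fixD:
  assumes "1 \<le> i" "swap i p = p"
  shows "p \<noteq> int i" "p \<noteq> int i + 1" "p \<noteq> - int i" "p \<noteq> - int i - 1"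
proof -
  show "p \<noteq> int i" using assms(2) swap_apply[OF assms(1), of "int i"] by auto
  show "p \<noteq> int i + 1" using assms(2) swap_apply[OF assms(1), of "int i + 1"] by auto
  show "p \<noteq> - int i" using assms swap_apply[OF assms(1), of "- int i"] by auto
  show "p \<noteq> - int i - 1" using assms swap_apply[OF assms(1), of "- int i - 1"] by auto
qed

lemma hat_swap_fixD:
  assumes "2 \<le> n" "hat_swap n p = p"
  shows "p \<noteq> int n" "p \<noteq> int n - 1" "p \<noteq> - int n" "p \<noteq> 1 - int n"
proof -
  show "p \<noteq> int n" using assms hat_swap_apply[OF assms(1), of "int n"] by auto
  show "p \<noteq> int n - 1" using assms hat_swap_apply[OF assms(1), of "int n - 1"] by auto
  show "p \<noteq> - int n" using assms hat_swap_apply[OF assms(1), of "- int n"] by auto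
  show "p \<noteq> 1 - int n" using assms hat_swap_apply[OF assms(1), of "1 - int n"] by auto
qed

text \<open>The representative raises \<open>i\<close> and \<open>i + 1\<close> by one. The transposition of the images comes out hatted
when one of them is the value \<open>N\<close>, whose sign is flipped.\<close>

lemma coset_rep_neg_swap_below:
  assumes N: "N \<ge> 2" and i: "1 \<le> i" "i < N" and k: "int i + 1 < k" "k \<le> int N" and x: "x > 0"
  shows "coset_rep N (- k) (swap i x) = (if Suc i = N - 1 then hat_swap N else swap (Suc i))
      (coset_rep N (- k) x)"
proof -
  have k0: "k > 0" using k by simp
  consider "x = int i" | "x = int i + 1" | "x = k" | "x < k" "x \<noteq> int i" "x \<noteq> int i + 1" | "x > k"
    by linarith
  then show ?thesis
  proof cases
    case 1
    have "swap i x = int i + 1" using 1 i swap_apply[of i x] by simp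
    moreover have "coset_rep N (- k) (int i + 1) = (if Suc i = N - 1 then - (int i + 2) else int i + 2)"
      using coset_rep_neg[OF N k0, of "int i + 1"] k by (auto simp: Let_def)
    moreover have "coset_rep N (- k) x = int i + 1"
      using coset_rep_neg[OF N k0, of x] x k 1 by (auto simp: Let_def)
    ultimately show ?thesis
      using i N hat_swap_apply[OF N, of "int i + 1"] swap_apply[of "Suc i" "int i + 1"] by auto
  next
    case 2
    have "swap i x = int i" using 2 i swap_apply[of i x] by simp
    moreover have "coset_rep N (- k) x = (if Suc i = N - 1 then - (int i + 2) else int i + 2)"
      using coset_rep_neg[OF N k0, of "int i + 1"] k 2 by (auto simp: Let_def)
    moreover have "coset_rep N (- k) (int i) = int i + 1"
      using coset_rep_neg[OF N k0, of "int i"] i k by (auto simp: Let_def)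
    ultimately show ?thesis
      using i N hat_swap_apply[OF N, of "- (int i + 2)"] swap_apply[of "Suc i" "int i + 2"] by auto
  next
    case 3
    have "swap i x = x" using 3 k i x swap_apply[of i x] by simp
    moreover have "coset_rep N (- k) x = - 1" using coset_rep_neg[OF N k0 x] 3 by simp
    ultimately show ?thesis
      using i N k hat_swap_apply[OF N, of "- 1"] swap_apply[of "Suc i" "- 1"] by auto
  next
    case 4
    have "swap i x = x" using 4 k i x swap_apply[of i x] by simp
    moreover have "coset_rep N (- k) x = (if x + 1 = int N then - int N else x + 1)"
      using coset_rep_neg[OF N k0 x] 4 by (auto simp: Let_def)
    ultimately show ?thesis
      using i N k 4 x hat_swap_apply[OF N, of "coset_rep N (- k) x"] swap_apply[of "Suc i"
          "coset_rep N (- k) x"]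
      by (auto)
  next
    case 5
    have "swap i x = x" using 5 k i x swap_apply[of i x] by simp
    moreover have "coset_rep N (- k) x = (if x = int N then - int N else x)"
      using coset_rep_neg[OF N k0 x] 5 by (auto simp: Let_def)
    moreover have "swap (Suc i) x = x" "swap (Suc i) (- int N) = - int N" if "Suc i \<noteq> N - 1"
      using that i k 5 swap_apply[of "Suc i" x] swap_apply[of "Suc i" "- int N"] by auto
    moreover have "hat_swap N x = x" if "Suc i = N - 1" "x \<noteq> int N"
      using that k 5 x hat_swap_apply[OF N, of x] by auto
    moreover have "x \<noteq> int N" if "Suc i = N - 1"
      using that k 5 by auto
    ultimately show ?thesis using 5 by auto
  qed
qed

lemma coset_rep_neg_swap_above:
  assumes N: "N \<ge> 2" and i: "1 \<le> i" "i < N" and k: "0 < k" "k < int i"  and x: "x > 0"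
  shows "coset_rep N (- k) (swap i x) = (if i = N - 1 then hat_swap N else swap i) (coset_rep N (- k) x)"
proof -
  consider "x = int i" | "x = int i + 1" | "x = k" | "x < k" | "x > k" "x \<noteq> int i" "x \<noteq> int i + 1"
    by linarith
  then show ?thesis
  proof cases
    case 1
    have "swap i x = int i + 1" using 1 i swap_apply[of i x] by simp
    moreover have "coset_rep N (- k) (int i + 1) = (if i = N - 1 then - (int i + 1) else int i + 1)"
      using coset_rep_neg[OF N k(1), of "int i + 1"] k i by (auto simp: Let_def)
    moreover have "coset_rep N (- k) x = int i"
      using coset_rep_neg[OF N k(1), of x] x k 1 i by (auto simp: Let_def)
    ultimately show ?thesis
      using i N hat_swap_apply[OF N, of "int i"] swap_apply[of "i" "int i"] by auto
  next
    case 2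
    have "swap i x = int i" using 2 i swap_apply[of i x] by simp
    moreover have "coset_rep N (- k) x = (if i = N - 1 then - (int i + 1) else int i + 1)"
      using coset_rep_neg[OF N k(1), of "int i + 1"] k i 2 by (auto simp: Let_def)
    moreover have "coset_rep N (- k) (int i) = int i"
      using coset_rep_neg[OF N k(1), of "int i"] i k by (auto simp: Let_def)
    ultimately show ?thesis
      using i N hat_swap_apply[OF N, of "- (int i + 1)"] swap_apply[of "i" "int i + 1"] by auto
  next
    case 3
    have "swap i x = x" using 3 k i x swap_apply[of i x] by simp
    moreover have "coset_rep N (- k) x = - 1" using coset_rep_neg[OF N k(1) x] 3 by simp
    ultimately show ?thesis
      using i N k hat_swap_apply[OF N, of "- 1"] swap_apply[of "i" "- 1"] by auto
  next
    case 4
    have "swap i x = x" using 4 k i x swap_apply[of i x] by simp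
    moreover have "coset_rep N (- k) x = x + 1"
      using coset_rep_neg[OF N k(1) x] 4 k i by (auto simp: Let_def)
    ultimately show ?thesis
      using i N k 4 x hat_swap_apply[OF N, of "x + 1"] swap_apply[of "i" "x + 1"]
      by (auto)
  next
    case 5
    have "swap i x = x" using 5 k i x swap_apply[of i x] by simp
    moreover have "coset_rep N (- k) x = (if x = int N then - int N else x)"
      using coset_rep_neg[OF N k(1) x] 5 by (auto simp: Let_def)
    moreover have "swap i (- int N) = - int N" if "i \<noteq> N - 1"
      using that i swap_apply[of i "- int N"] by auto
    moreover have "hat_swap N x = x" if "i = N - 1" "x \<noteq> int N"
      using that 5 x hat_swap_apply[OF N, of x] by auto
    ultimately show ?thesis using 5 by auto
  qed
qed

lemma coset_rep_swap_fix:
  assumes "N \<ge> 2" "p \<in> positions N" "1 \<le> i" "i < N" "swap i p = p"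
  shows "\<exists>s\<in>gensD (N - 1). coset_rep N p \<circ> swap i = shift s \<circ> coset_rep N p"
proof -
  \<comment> \<open>representatives raise the values below \<open>\<bar>p\<bar>\<close> and leave those above in place; \<open>shift\<close> raises by one\<close>
  define j where "j = (if int i < \<bar>p\<bar> then i else i - 1)"
  define hat where "hat \<longleftrightarrow> p < 0 \<and> Suc j = N - 1"
  have p: "p \<noteq> int i" "p \<noteq> int i + 1" "p \<noteq> - int i" "p \<noteq> - int i - 1" "p \<noteq> 0" "\<bar>p\<bar> \<le> int N"
    using assms(2,3) swap_fixD[OF assms(3,5)] by (auto simp: positions_def)
  have j: "1 \<le> j" "Suc j < N" using p assms(2-4) by (auto simp: j_def)
  define s where "s = (if hat then hat_swap (N - 1) else swap j)"
  have sg: "s \<in> gensD (N - 1)" using j by (auto simp: s_def gensD_def)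
  have shs: "shift s = (if hat then hat_swap N else swap (Suc j))"
    using j assms(1) by (simp add: s_def shift_swap shift_hat_swap Suc_diff_Suc)
  have "coset_rep N p \<circ> swap i = shift s \<circ> coset_rep N p"
  proof (rule odd_eqI)
    fix x :: int assume x: "x > 0"
    have s: "swap i x = (if x = int i then int i + 1 else if x = int i + 1 then int i else x)"
        "swap i x > 0"
      using assms(3) x by (auto simp: swap_apply)
    show "(coset_rep N p \<circ> swap i) x = (shift s \<circ> coset_rep N p) x"
    proof (cases "p > 0")
      case True
      then show ?thesis using s(2) p assms(1,3,4) x j
        by (auto simp: shs coset_rep_pos s(1) swap_apply hat_def j_def)
    next
      case False
      then obtain k where k: "p = - k" "k > 0"
        using p by (metis add.inverse_inverse neg_0_less_iff_less linorder_neqE_linordered_idom)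
      consider "int i + 1 < k" "k \<le> int N" "j = i" | "k < int i" "Suc j = i"
        using p k assms(3) unfolding j_def by (cases "int i < \<bar>p\<bar>") force+
      then show ?thesis
      proof cases
        case 1
        then show ?thesis
          using coset_rep_neg_swap_below[OF assms(1,3,4) 1(1,2) x] k by (simp add: shs hat_def)
      next
        case 2
        have "i = N - 1 \<longleftrightarrow> Suc j = N - 1" using 2 by simp
        then show ?thesis
          using coset_rep_neg_swap_above[OF assms(1,3,4) k(2) 2(1) x] k 2(2)
          by (simp add: shs hat_def)
      qed
    qed
  qed (use assms(1,3) in \<open>auto simp: coset_rep_minus swap_minus hat_swap_minus shs\<close>)
  then show ?thesis using sg by blast
qed

lemma coset_rep_hat_fix:
  assumes "N \<ge> 2" "p \<in> positions N" "hat_swap N p = p"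
  shows "\<exists>s\<in>gensD (N - 1). coset_rep N p \<circ> hat_swap N = shift s \<circ> coset_rep N p"
proof -
  have p: "p \<noteq> int N" "p \<noteq> int N - 1" "p \<noteq> - int N" "p \<noteq> 1 - int N" "p \<noteq> 0" "\<bar>p\<bar> \<le> int N"
    using assms(2) hat_swap_fixD[OF assms(1,3)] by (auto simp: positions_def)
  have N: "N \<ge> 3" using p by linarith
  define s where "s = (if p > 0 then hat_swap (N - 1) else swap (N - 2))"
  have sg: "s \<in> gensD (N - 1)" using N by (auto simp: s_def gensD_def)
  have shs: "shift s = (if p > 0 then hat_swap N else swap (N - 1))"
    using N shift_swap[of "N - 2"] shift_hat_swap[of "N - 1"]
    by (simp add: s_def Suc_diff_Suc numeral_2_eq_2)
  have "coset_rep N p \<circ> hat_swap N = shift s \<circ> coset_rep N p"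
  proof (rule odd_eqI)
    fix x :: int assume x: "x > 0"
    have s: "hat_swap N x = (if x = int N then - (int N - 1) else if x = int N - 1 then - int N else x)"
      using assms(1) x by (auto simp: hat_swap_apply)
    show "(coset_rep N p \<circ> hat_swap N) x = (shift s \<circ> coset_rep N p) x"
    proof (cases "p > 0")
      case True
      then show ?thesis unfolding o_apply s using p N x
        by (auto simp: shs coset_rep_pos coset_rep_minus hat_swap_apply simp del: minus_diff_eq)
    next
      case False
      then obtain k where k: "p = - k" "k > 0"
        using p by (metis add.inverse_inverse neg_0_less_iff_less linorder_neqE_linordered_idom)
      show ?thesis unfolding o_apply s using p N x k
          by (auto simp: shs coset_rep_neg coset_rep_minus swap_apply Let_def simp del: minus_diff_eq)
    qed
  qed (use N assms(1) in \<open>auto simp: coset_rep_minus swap_minus hat_swap_minus shs\<close>)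
  then show ?thesis using sg by blast
qed

lemma coset_rep_fix:
  assumes "N \<ge> 2" "p \<in> positions N" "s \<in> gensD N" "s p = p"
  shows "\<exists>s'\<in>gensD (N - 1). coset_rep N p \<circ> s = shift s' \<circ> coset_rep N p"
  using assms(1,3)
proof (cases rule: gensD_cases)
  case (1 i)
  then show ?thesis using coset_rep_swap_fix[OF assms(1,2)] assms(4) by simp
next
  case 2
  then show ?thesis using coset_rep_hat_fix[OF assms(1,2)] assms(4) by simp
qed

lemma coset_rep_move:
  assumes "N \<ge> 2" "p \<in> positions N" "s \<in> gensD N" "s p \<noteq> p"
  shows "coset_rep N p \<circ> s = coset_rep N (s p)"
  using assms(1,3)
proof (cases rule: gensD_cases)
  case (1 i)
  then show ?thesis using coset_rep_swap_move[OF assms(1,2)] assms(4) by simp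
next
  case 2
  then show ?thesis using coset_rep_hat_move[OF assms(1,2)] assms(4) by simp
qed

lemma coset_rep_1: "coset_rep N 1 = id"
  by (rule ext) (auto simp: coset_rep_def cyc_def sgn_if)

lemma coset_rep_self:
  assumes "N \<ge> 2" "p \<in> positions N"
  shows "coset_rep N p p = 1"
proof (cases "p > 0")
  case False
  then have p: "- p > 0" using assms by (auto simp: positions_def)
  show ?thesis using coset_rep_neg[OF assms(1) p p] coset_rep_minus[of N p p] by simp
qed (simp add: coset_rep_pos)

lemma coset_rep_word:
  assumes "N \<ge> 2" "p \<in> positions N"
  shows "\<exists>w\<in>lists (gensD N). length w = depth N p \<and> word_prod w = coset_rep N p"
  using assms(2)
proof (induction "depth N p" arbitrary: p)
  case 0
  then have "p = 1" using assms(1) by (auto simp: depth_def positions_def split: if_splits)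
  then show ?case using 0 by (auto simp: coset_rep_1 intro: bexI[of _ "[]"])
next
  case (Suc d)
  have "\<exists>s\<in>gensD N. \<exists>r\<in>positions N. s r = p \<and> r \<noteq> p \<and> depth N r = d"
  proof -
    have "p \<noteq> 0" "p \<noteq> 1" "- int N \<le> p" using Suc(2,3) by (auto simp: positions_def depth_def)
    then consider "p > 1" | "p = - int N" | "p < 0" "- int N < p" by linarith
    then show ?thesis
    proof cases
      case 1
      define i where "i = nat (p - 1)"
      have i: "1 \<le> i" "i < N" "int i = p - 1" using 1 Suc(3) by (auto simp: i_def positions_def)
      have "swap i (p - 1) = p" using swap_apply[OF i(1), of "p - 1"] i(3) by simp
      moreover have "swap i \<in> gensD N" using i assms(1) by (auto simp: gensD_def)
      moreover have "p - 1 \<in> positions N" "depth N (p - 1) = d"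
        using 1 Suc(2,3) by (auto simp: positions_def depth_def)
      ultimately show ?thesis by (intro bexI[of _ "swap i"] bexI[of _ "p - 1"]) auto
    next
      case 2
      have "hat_swap N (int N - 1) = p" using hat_swap_apply[OF assms(1), of "int N - 1"] 2 by simp
      moreover have "hat_swap N \<in> gensD N" using assms(1) by (auto simp: gensD_def)
      moreover have "int N - 1 \<in> positions N" "depth N (int N - 1) = d"
        using 2 Suc(2,3) assms(1) by (auto simp: positions_def depth_def)
      ultimately show ?thesis using 2 assms(1)
        by (intro bexI[of _ "hat_swap N"] bexI[of _ "int N - 1"]) auto
    next
      case 3
      define i where "i = nat (- p)"
      have i: "1 \<le> i" "i < N" "int i = - p" using 3 Suc(3) by (auto simp: i_def positions_def)
      have "swap i (p - 1) = p" using swap_apply[OF i(1), of "p - 1"] i by auto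
      moreover have "swap i \<in> gensD N" using i assms(1) by (auto simp: gensD_def)
      moreover have "p - 1 \<in> positions N" "depth N (p - 1) = d"
        using 3 Suc(2,3) by (auto simp: positions_def depth_def)
      ultimately show ?thesis by (intro bexI[of _ "swap i"] bexI[of _ "p - 1"]) auto
    qed
  qed
  then obtain s r where s: "s \<in> gensD N" "r \<in> positions N" "s r = p" "r \<noteq> p" "depth N r = d"
    by blast
  obtain w where w: "w \<in> lists (gensD N)" "length w = d" "word_prod w = coset_rep N r"
    using Suc(1)[of r] s by auto
  have "word_prod (w @ [s]) = coset_rep N p"
    using coset_rep_move[OF assms(1) s(2,1)] s w by (simp add: word_prod_append)
  then show ?case using w s Suc(2) by (intro bexI[of _ "w @ [s]"]) auto
qed

lemma shift_gensD: "s \<in> gensD n \<Longrightarrow> shift s \<in> gensD (Suc n)"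
  unfolding gensD_def by (auto simp: shift_swap shift_hat_swap split: if_splits)

lemma word_prod_coxB: "w \<in> lists (gensD n) \<Longrightarrow> word_prod w \<in> coxB n"
  using subsetD[OF coxD_coxB, of "word_prod w" n] unfolding coxD_def by blast

lemma shift_word_prod:
  "w \<in> lists (gensD n) \<Longrightarrow> shift (word_prod w) = word_prod (map shift w)"
proof (induction w)
  case (Cons s w)
  then have "s \<in> coxB n" "word_prod w \<in> coxB n" using gensD_coxB word_prod_coxB[of w n] by auto
  then have "shift (s \<circ> word_prod w) = shift s \<circ> shift (word_prod w)" by (rule shift_comp)
  moreover have "shift (word_prod w) = word_prod (map shift w)" using Cons by simp
  ultimately show ?case by (simp only: word_prod_simps list.map)
qed (simp only: word_prod_simps list.map shift_id)

text \<open>The words are read from left to right. Each letter is either absorbed by the representative or moved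
through it to lengthen the word of the smaller group; in both cases the total length accounted for
grows by at most one. This yields existence of the factorization together with the lower bound on
lengths in \<open>len_coset\<close>.\<close>

lemma coset_word:
  assumes N: "N \<ge> 2" and w: "w \<in> lists (gensD N)"
  shows "\<exists>v\<in>lists (gensD (N - 1)). \<exists>p\<in>positions N.
    word_prod w = shift (word_prod v) \<circ> coset_rep N p \<and> length v + depth N p \<le> length w"
  using w
proof (induction w rule: rev_induct)
  case Nil
  have "1 \<in> positions N" "depth N 1 = 0" using N by (auto simp: positions_def depth_def)
  then show ?case
    by (intro bexI[of _ "[]"] bexI[of _ 1]) (simp_all only: coset_rep_1 shift_id word_prod_simps
        o_id list.size, simp_all)
next
  case (snoc s w)
  have "w \<in> lists (gensD N)" using snoc.prems by simp
  then obtain v p where v: "v \<in> lists (gensD (N - 1))" "p \<in> positions N"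
      "word_prod w = shift (word_prod v) \<circ> coset_rep N p" "length v + depth N p \<le> length w"
    using snoc.IH by blast
  have s: "s \<in> gensD N" using snoc by auto
  have ws: "word_prod (w @ [s]) = shift (word_prod v) \<circ> (coset_rep N p \<circ> s)"
    by (simp add: word_prod_append v(3) o_assoc)
  show ?case
  proof (cases "s p = p")
    case False
    then show ?thesis
      using v ws coset_rep_move[OF N v(2) s] depth_move[OF N v(2) s]
      by (intro bexI[of _ v] bexI[of _ "s p"]) auto
  next
    case True
    then obtain s' where s': "s' \<in> gensD (N - 1)" "coset_rep N p \<circ> s = shift s' \<circ> coset_rep N p"
      using coset_rep_fix[OF N v(2) s] by blast
    have "shift (word_prod (v @ [s'])) = shift (word_prod v) \<circ> shift s'"
      using shift_comp[of "word_prod v" "N - 1" s'] word_prod_coxB[OF v(1)] gensD_coxB s'(1)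
      by (auto simp: word_prod_append)
    then show ?thesis
      using v ws s' by (intro bexI[of _ "v @ [s']"] bexI[of _ p]) (auto simp: o_assoc)
  qed
qed

lemma len_word_le: "w \<in> lists (gensD n) \<Longrightarrow> len n (word_prod w) \<le> length w"
  unfolding len_def by (rule Least_le) blast

lemma len_word_ex:
  assumes "\<sigma> \<in> coxD n"
  obtains w where "w \<in> lists (gensD n)" "length w = len n \<sigma>" "word_prod w = \<sigma>"
proof -
  from assms obtain w where "w \<in> lists (gensD n)" "word_prod w = \<sigma>" by (auto simp: coxD_def)
  then have "\<exists>w'\<in>lists (gensD n). length w' = len n \<sigma> \<and> word_prod w' = \<sigma>"
    unfolding len_def
    by (intro LeastI[of "\<lambda>k. \<exists>w\<in>lists (gensD n). length w = k \<and> word_prod w = \<sigma>" "length w"]) blast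
  then show thesis using that by blast
qed

text \<open>The position is recovered as the preimage of \<open>1\<close>, since shifted permutations fix \<open>1\<close>.\<close>

lemma coset_unique:
  assumes N: "N \<ge> 2" and u: "u \<in> coxB (N - 1)" "u' \<in> coxB (N - 1)"
    and p: "p \<in> positions N" "p' \<in> positions N"
    and eq: "shift u \<circ> coset_rep N p = shift u' \<circ> coset_rep N p'"
  shows "u = u'" "p = p'"
proof -
  have inj: "inj (coset_rep N r)" "surj (coset_rep N r)" if r: "r \<in> positions N" for r
    using coset_rep_word[OF N r] word_prod_coxB coxB_nonzero(3) by (metis bij_def)+
  have s1: "shift v 1 = 1" for v by (simp add: shift_def)
  have sB: "shift u' \<in> coxB (Suc (N - 1))" by (rule shift_coxB[OF u(2)])
  have "shift u' (coset_rep N p' p) = shift u (coset_rep N p p)" using fun_cong[OF eq, of p] by simp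
  also have "\<dots> = shift u' (coset_rep N p' p')" using coset_rep_self[OF N] p s1 by simp
  finally have "coset_rep N p' p = coset_rep N p' p'"
    using coxB_nonzero(3)[OF sB] by (meson bij_is_inj injD)
  then show "p = p'" using inj[OF p(2)] by (meson injD)
  then have "shift u y = shift u' y" for y
    using eq inj(2)[OF p(2)] by (metis comp_apply surjD)
  then show "u = u'" using shift_inj[OF u] by blast
qed

text \<open>A shortest word for the product factors by \<open>coset_word\<close>, and by uniqueness into the given factors; the
reverse inequality is concatenation of words.\<close>

lemma len_coset:
  assumes N: "N \<ge> 2" and u: "u \<in> coxD (N - 1)" and p: "p \<in> positions N"
  shows "shift u \<circ> coset_rep N p \<in> coxD N" "len N (shift u \<circ> coset_rep N p) = len (N - 1) u + depth N p"
proof -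
  obtain v where v: "v \<in> lists (gensD (N - 1))" "length v = len (N - 1) u" "word_prod v = u"
    using len_word_ex[OF u] .
  obtain c where c: "c \<in> lists (gensD N)" "length c = depth N p" "word_prod c = coset_rep N p"
    using coset_rep_word[OF N p] by blast
  have w: "map shift v @ c \<in> lists (gensD N)"
    using v(1) c(1) shift_gensD[of _ "N - 1"] N by auto
  have e: "word_prod (map shift v @ c) = shift u \<circ> coset_rep N p"
    using shift_word_prod[OF v(1)] v(3) c(3) by (simp add: word_prod_append)
  show m: "shift u \<circ> coset_rep N p \<in> coxD N" unfolding coxD_def e[symmetric] using w by blast
  have "len N (shift u \<circ> coset_rep N p) \<le> len (N - 1) u + depth N p"
    using len_word_le[OF w] e v(2) c(2) by simp
  moreover have "len (N - 1) u + depth N p \<le> len N (shift u \<circ> coset_rep N p)"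
  proof -
    obtain w where w: "w \<in> lists (gensD N)" "length w = len N (shift u \<circ> coset_rep N p)"
        "word_prod w = shift u \<circ> coset_rep N p"
      using len_word_ex[OF m] .
    obtain v' p' where v': "v' \<in> lists (gensD (N - 1))" "p' \<in> positions N"
        "word_prod w = shift (word_prod v') \<circ> coset_rep N p'" "length v' + depth N p' \<le> length w"
      using coset_word[OF N w(1)] by blast
    have "u \<in> coxB (N - 1)" using u coxD_coxB by blast
    then have "u = word_prod v'" "p = p'"
      using coset_unique[OF N _ word_prod_coxB[OF v'(1)] p v'(2)] w(3) v'(3) by auto
    then show ?thesis using len_word_le[OF v'(1)] v'(4) w(2) by simp
  qed
  ultimately show "len N (shift u \<circ> coset_rep N p) = len (N - 1) u + depth N p" by simp
qed

lemma sum_coxD_cosets: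
  assumes N: "N \<ge> 2"
  shows "(\<Sum>\<sigma>\<in>coxD N. g \<sigma>) = (\<Sum>p\<in>positions N. \<Sum>u\<in>coxD (N - 1). g (shift u \<circ> coset_rep N p))"
proof -
  let ?h = "\<lambda>(p, u). shift u \<circ> coset_rep N p"
  have "bij_betw ?h (positions N \<times> coxD (N - 1)) (coxD N)"
  proof (rule bij_betwI')
    fix x y assume "x \<in> positions N \<times> coxD (N - 1)" "y \<in> positions N \<times> coxD (N - 1)"
    then show "(?h x = ?h y) = (x = y)"
      using coset_unique[OF N] subsetD[OF coxD_coxB]
      by (simp add: case_prod_unfold) (metis prod.collapse mem_Sigma_iff)
  next
    fix x assume "x \<in> positions N \<times> coxD (N - 1)"
    then show "?h x \<in> coxD N" using len_coset(1)[OF N] by auto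
  next
    fix \<sigma> assume "\<sigma> \<in> coxD N"
    then obtain w where w: "w \<in> lists (gensD N)" "\<sigma> = word_prod w" by (auto simp: coxD_def)
    then obtain v p where v: "v \<in> lists (gensD (N - 1))" "p \<in> positions N" "\<sigma> = shift (word_prod
        v) \<circ> coset_rep N p"
      using coset_word[OF N w(1)] by blast
    then show "\<exists>x\<in>positions N \<times> coxD (N - 1). \<sigma> = ?h x"
      by (intro bexI[of _ "(p, word_prod v)"]) (auto simp: coxD_def)
  qed
  from sum.reindex_bij_betw[OF this, of g] show ?thesis
    by (simp add: sum.cartesian_product case_prod_unfold)
qed

lemma coset_rep_coxB:
  assumes "N \<ge> 2" "p \<in> positions N"
  shows "coset_rep N p \<in> coxB N"
proof -
  obtain w where "w \<in> lists (gensD N)" "word_prod w = coset_rep N p"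
    using coset_rep_word[OF assms] by blast
  then show ?thesis using word_prod_coxB[of w N] by simp
qed

lemma act_shift:
  assumes u: "u \<in> coxB (length xs)"
  shows "act bar (shift u) (x # xs) = x # act bar u xs"
proof (rule nth_equalityI)
  fix i assume i: "i < length (act bar (shift u) (x # xs))"
  have inv: "inv (shift u) = shift (inv u)"
  proof (rule inv_unique_comp)
    have "u \<circ> inv u = id" "inv u \<circ> u = id"
      using coxB_nonzero(3)[OF u] by (simp_all add: bij_def inj_iff surj_iff)
    then show "shift u \<circ> shift (inv u) = id" "shift (inv u) \<circ> shift u = id"
      using shift_comp[OF u coxB_inv[OF u]] shift_comp[OF coxB_inv[OF u] u] shift_id by metis+
  qed
  show "act bar (shift u) (x # xs) ! i = (x # act bar u xs) ! i"
  proof (cases i)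
    case 0
    then show ?thesis using i by (simp add: nth_act inv letter_def shift_def del: length_act)
  next
    case (Suc j)
    then have j: "j < length xs" using i by simp
    have "inv u (int j + 1) \<noteq> 0" using coxB_inv_facts(3)[OF u, of "int j + 1"] j by auto
    moreover have "nat (1 - y) - Suc (Suc 0) = nat (- y) - Suc 0" if "\<not> 0 < y" "y \<noteq> 0" for y
      using that by linarith
    ultimately show ?thesis using j Suc
      by (auto simp: nth_act inv shift_def letter_def nth_Cons' sgn_if nat_add_distrib
          add.commute[of 1 "int j"])
  qed
qed simp

lemma coxD_0_1: "n \<le> 1 \<Longrightarrow> coxD n = {id}"
  by (auto simp: coxD_def gensD_def)

lemma len_id: "len n id = 0"
  using len_word_le[of "[]" n] by simp

text \<open>The depth is injective on the positive and on the negative positions, so each part is bounded by a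
geometric series.\<close>

lemma sum_depth_le:
  assumes "\<bar>q\<bar> < (1::real)"
  shows "(\<Sum>p\<in>positions N. \<bar>q\<bar> ^ depth N p) \<le> 2 / (1 - \<bar>q\<bar>)"
proof -
  have geo: "(\<Sum>k\<in>A. \<bar>q\<bar> ^ k) \<le> 1 / (1 - \<bar>q\<bar>)" if "finite A" for A
    using sum_le_suminf[OF summable_geometric that, of "\<bar>q\<bar>"] suminf_geometric[of "\<bar>q\<bar>"] assms
    by simp
  have "positions N = {1..int N} \<union> {- int N..-1}" by (auto simp: positions_def)
  moreover have "{1..int N} \<inter> {- int N..-1} = {}" by auto
  ultimately have "(\<Sum>p\<in>positions N. \<bar>q\<bar> ^ depth N p) =
      (\<Sum>p\<in>{1..int N}. \<bar>q\<bar> ^ depth N p) + (\<Sum>p\<in>{- int N..-1}. \<bar>q\<bar> ^ depth N p)"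
    by (simp only: sum.union_disjoint finite_atLeastAtMost_int)
  also have "\<dots> = (\<Sum>k\<in>depth N ` {1..int N}. \<bar>q\<bar> ^ k) + (\<Sum>k\<in>depth N ` {- int N..-1}. \<bar>q\<bar> ^ k)"
  proof -
    have "inj_on (depth N) {1..int N}" "inj_on (depth N) {- int N..-1}"
      by (auto simp: inj_on_def depth_def)
    then show ?thesis by (simp add: sum.reindex)
  qed
  also have "\<dots> \<le> 1 / (1 - \<bar>q\<bar>) + 1 / (1 - \<bar>q\<bar>)"
    by (intro add_mono geo) auto
  finally have "(\<Sum>p\<in>positions N. \<bar>q\<bar> ^ depth N p) \<le> 1 / (1 - \<bar>q\<bar>) + 1 / (1 - \<bar>q\<bar>)" .
  then show ?thesis by simp
qed

section \<open>Operators symmetric for a semi-inner product\<close>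

text \<open>The ratios of a log-convex sequence increase. If the first exceeded \<open>D\<close>, the sequence would outgrow
every multiple of \<open>D ^ m\<close>.\<close>

lemma log_convex_growth:
  fixes b :: "nat \<Rightarrow> real"
  assumes nonneg: "\<And>m. b m \<ge> 0" and conv: "\<And>m. (b (Suc m))\<^sup>2 \<le> b m * b (Suc (Suc m))"
    and growth: "\<And>m. b m \<le> K * D ^ m" and D: "D \<ge> 0"
  shows "b 1 \<le> D * b 0"
proof (rule ccontr)
  assume "\<not> b 1 \<le> D * b 0"
  then have gt: "b 1 > D * b 0" by simp
  have b0: "b 0 > 0"
  proof (rule ccontr)
    assume "\<not> b 0 > 0"
    then have "b 0 = 0" using nonneg[of 0] by simp
    then have "b 1 = 0" using conv[of 0] by simp
    then show False using gt \<open>b 0 = 0\<close> by simp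
  qed
  \<comment> \<open>the ratios \<open>b (Suc m) / b m\<close> never fall below \<open>r\<close>\<close>
  define r where "r = b 1 / b 0"
  have r: "r > D" using gt b0 by (simp add: r_def field_simps)
  have step: "b (Suc m) \<ge> r * b m \<and> b m > 0" for m
  proof (induction m)
    case 0
    then show ?case using b0 by (simp add: r_def)
  next
    case (Suc m)
    then have pos: "b (Suc m) > 0" using r D by (meson le_less_trans less_le_trans mult_pos_pos)
    have "r * b m * b (Suc m) \<le> (b (Suc m))\<^sup>2"
      using Suc pos by (simp add: power2_eq_square)
    also have "\<dots> \<le> b m * b (Suc (Suc m))" by (rule conv)
    finally have "b m * (r * b (Suc m)) \<le> b m * b (Suc (Suc m))" by (simp add: algebra_simps)
    then show ?case using Suc pos by (simp add: mult_le_cancel_left_pos)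
  qed
  have low: "b m \<ge> r ^ m * b 0" for m
  proof (induction m)
    case (Suc m)
    have "r ^ Suc m * b 0 = r * (r ^ m * b 0)" by simp
    also have "\<dots> \<le> r * b m" using Suc r D by (intro mult_left_mono) auto
    also have "\<dots> \<le> b (Suc m)" using step by blast
    finally show ?case .
  qed simp
  have "D > 0"
    using growth[of 1] step[of 1] D by (cases "D = 0") auto
  obtain m where m: "K / b 0 < (r / D) ^ m"
    using real_arch_pow[of "r / D" "K / b 0"] r \<open>D > 0\<close> by auto
  have "r ^ m * b 0 \<le> K * D ^ m" using low[of m] growth[of m] by linarith
  then have "(r / D) ^ m \<le> K / b 0"
    using \<open>D > 0\<close> b0 by (simp add: power_divide field_simps)
  then show False using m by simp
qed

text \<open>The Hermitian form to which this is applied enters through its real part.\<close>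

locale semi_inner =
  fixes \<beta> :: "'v::real_vector \<Rightarrow> 'v \<Rightarrow> real"
  assumes bilin: "bilinear \<beta>" and sym: "\<beta> f g = \<beta> g f" and pos: "\<beta> f f \<ge> 0"
begin

abbreviation seminorm :: "'v \<Rightarrow> real" where "seminorm f \<equiv> sqrt (\<beta> f f)"

lemma cauchy_schwarz: "(\<beta> f g)\<^sup>2 \<le> \<beta> f f * \<beta> g g"
proof -
  \<comment> \<open>the discriminant of this quadratic polynomial in \<open>t\<close> is the claim\<close>
  have quad: "0 \<le> \<beta> f f + 2 * t * \<beta> f g + t\<^sup>2 * \<beta> g g" for t
  proof -
    have "\<beta> (f + t *\<^sub>R g) (f + t *\<^sub>R g) = \<beta> f f + 2 * t * \<beta> f g + t\<^sup>2 * \<beta> g g"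
      using sym[of g f]
      by (simp add: bilinear_ladd[OF bilin] bilinear_radd[OF bilin] bilinear_lmul[OF bilin]
          bilinear_rmul[OF bilin] power2_eq_square algebra_simps)
    then show ?thesis using pos[of "f + t *\<^sub>R g"] by simp
  qed
  show ?thesis
  proof (cases "\<beta> g g = 0")
    case True
    have "\<beta> f g = 0"
    proof (rule ccontr)
      assume "\<beta> f g \<noteq> 0"
      then show False using quad[of "- (\<beta> f f + 1) / (2 * \<beta> f g)"] True by (simp add: field_simps)
    qed
    then show ?thesis by (simp add: True)
  next
    case False
    then have g: "\<beta> g g > 0" using pos[of g] by simp
    have "0 \<le> \<beta> g g * (\<beta> f f + 2 * (- \<beta> f g / \<beta> g g) * \<beta> f g + (- \<beta> f g / \<beta> g g)\<^sup>2 * \<beta> g g)"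
      using g by (intro mult_nonneg_nonneg quad) simp
    also have "\<dots> = \<beta> f f * \<beta> g g - (\<beta> f g)\<^sup>2" using g by (simp add: field_simps power2_eq_square)
    finally show ?thesis by simp
  qed
qed

lemma triangle: "seminorm (f + g) \<le> seminorm f + seminorm g"
proof (rule real_le_lsqrt)
  have "\<beta> f g \<le> seminorm f * seminorm g"
    using cauchy_schwarz[of f g] real_le_rsqrt by (auto simp: real_sqrt_mult[symmetric])
  then show "\<beta> (f + g) (f + g) \<le> (seminorm f + seminorm g)\<^sup>2"
    using sym[of g f] pos
    by (simp add: bilinear_ladd[OF bilin] bilinear_radd[OF bilin] power2_sum)
qed (use pos in auto)

lemma triangle_sum: "finite I \<Longrightarrow> seminorm (sum h I) \<le> (\<Sum>i\<in>I. seminorm (h i))"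
proof (induction I rule: finite_induct)
  case empty
  show ?case using bilinear_lzero[OF bilin] by simp
next
  case (insert i I)
  then show ?case using triangle[of "h i" "sum h I"] by simp
qed

text \<open>The squared seminorms of the \<open>R ^^ m\<close>-images of \<open>f\<close> form a log-convex sequence by the Cauchy-Schwarz
inequality and symmetry of \<open>R\<close>. Geometric growth of ratio \<open>C\<close>, with an arbitrary factor, therefore
already gives \<open>\<parallel>R f\<parallel> \<le> C \<parallel>f\<parallel>\<close>, where the factor has disappeared; the claim follows by the
Cauchy-Schwarz inequality.\<close>

lemma symmetric_operator_bound:
  assumes R: "\<And>f g. \<beta> f (R g) = \<beta> (R f) g" and C: "C \<ge> 0"
    and growth: "\<And>m. seminorm ((R ^^ m) f) \<le> K * C ^ m"
  shows "\<beta> f (R f) \<le> C * \<beta> f f"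
proof -
  define b where "b m = \<beta> ((R ^^ m) f) ((R ^^ m) f)" for m
  have conv: "(b (Suc m))\<^sup>2 \<le> b m * b (Suc (Suc m))" for m
  proof -
    have "b (Suc m) = \<beta> ((R ^^ m) f) ((R ^^ Suc (Suc m)) f)"
      unfolding b_def by (simp only: funpow.simps o_apply R[symmetric])
    then show ?thesis
      using cauchy_schwarz[of "(R ^^ m) f" "(R ^^ Suc (Suc m)) f"] by (simp add: b_def)
  qed
  have gr: "b m \<le> K\<^sup>2 * (C\<^sup>2) ^ m" for m
  proof -
    have "(sqrt (b m))\<^sup>2 \<le> (K * C ^ m)\<^sup>2"
      using growth[of m] pos by (intro power_mono) (auto simp: b_def)
    then show ?thesis
      using pos by (simp add: b_def power_mult_distrib power_mult[symmetric] mult.commute)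
  qed
  have "b 1 \<le> C\<^sup>2 * b 0"
    by (rule log_convex_growth[OF _ conv gr]) (use pos in \<open>auto simp: b_def\<close>)
  then have "b 0 * b 1 \<le> b 0 * (C\<^sup>2 * b 0)"
    using pos by (intro mult_left_mono) (auto simp: b_def)
  moreover have "(\<beta> f (R f))\<^sup>2 \<le> b 0 * b 1" using cauchy_schwarz[of f "R f"] by (simp add: b_def)
  ultimately have "(\<beta> f (R f))\<^sup>2 \<le> (C * b 0)\<^sup>2" by (simp add: power2_eq_square algebra_simps)
  then have "\<beta> f (R f) \<le> C * b 0"
    by (rule power2_le_imp_le) (use C pos[of f] in \<open>auto simp: b_def\<close>)
  then show ?thesis by (simp add: b_def)
qed

end

section \<open>Boundedness of the creation operators\<close>

lemma clinear_add: "clinear L \<Longrightarrow> L (x + y) = L x + L y"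
  and clinear_scale: "clinear L \<Longrightarrow> L (c *\<^sub>C x) = c *\<^sub>C L x"
  by (auto simp: clinear_iff)

lemma clinear_compose: "clinear L \<Longrightarrow> clinear M \<Longrightarrow> clinear (\<lambda>x. L (M x))"
  by (auto simp: clinear_iff)

lemma clinear_sum: "clinear L \<Longrightarrow> L (sum h I) = (\<Sum>i\<in>I. L (h i))"
  by (induction I rule: infinite_finite_induct) (auto simp: clinear_0 clinear_add)

lemma clinear_scaleC: "clinear (\<lambda>x. c *\<^sub>C x)"
  by (auto simp: clinear_iff scaleC_add_right scaleC_scaleC mult.commute)

lemma clinear_Rep: "clinear (\<lambda>f. Rep_fock f ys)"
  unfolding clinear_iff by (auto simp: plus_fock.rep_eq scaleC_fock.rep_eq scaleC_complex_def)

lemma simple_form_Nil: "simple_form [] ys = (if ys = [] then 1 else 0)"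
  by (simp add: simple_form_def)

lemma simple_form_Cons_Cons: "simple_form (x # xs) (y # ys) = cinner y x * simple_form xs ys"
  by (simp add: simple_form_def prod.lessThan_Suc_shift del: prod.lessThan_Suc)

lemma simple_form_Cons_Nil: "simple_form (x # xs) [] = 0"
  by (simp add: simple_form_def)

lemma fock_eqI: "(\<And>ys. Rep_fock f ys = Rep_fock g ys) \<Longrightarrow> f = g"
  by (simp add: Rep_fock_inject[symmetric] fun_eq_iff)

lemma Rep_creation:
  "Rep_fock (creation x f) [] = 0"
  "Rep_fock (creation x f) (y # ys) = cinner y x * Rep_fock f ys"
proof -
  have "(\<lambda>f. Rep_fock (creation x f) []) = (\<lambda>f. 0)"
    by (rule clinear_fock_eqI[OF clinear_compose[OF clinear_Rep clinear_creation]])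
      (auto simp: clinear_iff creation_tensor tensor.rep_eq simple_form_Cons_Nil)
  then show "Rep_fock (creation x f) [] = 0" by (rule fun_cong)
  have "(\<lambda>f. Rep_fock (creation x f) (y # ys)) = (\<lambda>f. cinner y x *\<^sub>C Rep_fock f ys)"
    by (rule clinear_fock_eqI[OF clinear_compose[OF clinear_Rep clinear_creation]
        clinear_compose[OF clinear_scaleC clinear_Rep]])
      (auto simp: creation_tensor tensor.rep_eq simple_form_Cons_Cons scaleC_complex_def)
  then show "Rep_fock (creation x f) (y # ys) = cinner y x * Rep_fock f ys"
    by (auto simp: scaleC_complex_def dest: fun_cong)
qed

lemma creation_add_left: "creation (x + y) f = creation x f + creation y f"
  and creation_scaleC_left: "creation (c *\<^sub>C x) f = c *\<^sub>C creation x f"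
proof -
  show "creation (x + y) f = creation x f + creation y f"
  proof (rule fock_eqI)
    show "Rep_fock (creation (x + y) f) ys = Rep_fock (creation x f + creation y f) ys" for ys
      by (cases ys) (auto simp: Rep_creation plus_fock.rep_eq cinner_add_right algebra_simps)
  qed
  show "creation (c *\<^sub>C x) f = c *\<^sub>C creation x f"
  proof (rule fock_eqI)
    show "Rep_fock (creation (c *\<^sub>C x) f) ys = Rep_fock (c *\<^sub>C creation x f) ys" for ys
      by (cases ys) (auto simp: Rep_creation scaleC_fock.rep_eq cinner_scaleC_right algebra_simps)
  qed
qed

lemma fock_inner0_tensor_right: "fock_inner0 f (tensor ys) = cnj (Rep_fock f ys)"
  by (subst fock_inner0_commute) (simp add: fock_inner0_tensor_left)

lemma fock_inner0_add_left: "fock_inner0 (f + g) h = fock_inner0 f h + fock_inner0 g h"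
  and fock_inner0_scaleC_left: "fock_inner0 (c *\<^sub>C f) h = cnj c * fock_inner0 f h"
  unfolding fock_inner0_commute[of _ h]
  by (simp_all add: clinear_add[OF clinear_fock_inner0] clinear_scale[OF clinear_fock_inner0]
      scaleC_complex_def)

lemma fock_inner0_creation: "fock_inner0 (creation x f) (creation y g) = cinner x y * fock_inner0 f g"
proof -
  have "(\<lambda>g. fock_inner0 (creation x f) (creation y g)) = (\<lambda>g. cinner x y *\<^sub>C fock_inner0 f g)"
    by (rule clinear_fock_eqI[OF clinear_compose[OF clinear_fock_inner0 clinear_creation]
          clinear_compose[OF clinear_scaleC clinear_fock_inner0]])
      (simp add: creation_tensor fock_inner0_tensor_right Rep_creation scaleC_complex_def
        cinner_commute[symmetric])
  then show ?thesis by (auto simp: scaleC_complex_def dest: fun_cong)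
qed

lemma sesquilinear_fock_eqI:
  assumes "\<And>f. clinear (B f)" "\<And>f. clinear (C f)"
    "\<And>g. clinear (\<lambda>f. cnj (B f g))" "\<And>g. clinear (\<lambda>f. cnj (C f g))"
    "\<And>xs ys. B (tensor xs) (tensor ys) = C (tensor xs) (tensor ys)"
  shows "B f g = C f g"
proof -
  have "B (tensor xs) = C (tensor xs)" for xs
    by (rule clinear_fock_eqI[OF assms(1,2,5)])
  then have "(\<lambda>f. cnj (B f g)) = (\<lambda>f. cnj (C f g))"
    by (intro clinear_fock_eqI[OF assms(3,4)]) simp
  then show ?thesis by (metis complex_cnj_cnj)
qed

definition creation_sum :: "('h::complex_hilbert \<times> 'h fock) list \<Rightarrow> 'h fock" where
  "creation_sum L = (\<Sum>(x, g)\<leftarrow>L. creation x g)"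

lemma creation_sum_simps [simp]:
  "creation_sum [] = 0" "creation_sum ((x, g) # L) = creation x g + creation_sum L"
  by (simp_all add: creation_sum_def)

text \<open>The algebraic Fock space is the sum of the vacuum line and the range of the creation operators. The
form studied below is diagonal with respect to this decomposition.\<close>

lemma fock_decomposition: "\<exists>c L. f = c *\<^sub>C vacuum + creation_sum L"
proof (induction f rule: fock_induct)
  case zero
  show ?case by (rule exI[of _ 0], rule exI[of _ "[]"]) simp
next
  case (step f d xs)
  then obtain c L where f: "f = c *\<^sub>C vacuum + creation_sum L" by blast
  show ?case
  proof (cases xs)
    case Nil
    then have "f + d *\<^sub>C tensor xs = (c + d) *\<^sub>C vacuum + creation_sum L"
      by (simp add: f scaleC_add_left algebra_simps)
    then show ?thesis by blast
  next
    case (Cons x xs')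
    then have "f + d *\<^sub>C tensor xs = c *\<^sub>C vacuum + creation_sum ((x, d *\<^sub>C tensor xs') # L)"
      by (simp add: f clinear_scale[OF clinear_creation] creation_tensor algebra_simps)
    then show ?thesis by blast
  qed
qed

text \<open>For \<open>N \<le> 1\<close> the group is trivial and the position \<open>- 1\<close> does not occur.\<close>

definition coset_positions :: "nat \<Rightarrow> int set" where
  "coset_positions N = (if N \<le> 1 then {1} else positions N)"

lemma coset_positions_coxB: "p \<in> coset_positions N \<Longrightarrow> coset_rep N p \<in> coxB N"
  by (cases "N \<le> 1") (auto simp: coset_positions_def coset_rep_1 coxB_id[unfolded id_def] coxB_id
      coset_rep_coxB)

lemma finite_coset_positions: "finite (coset_positions N)"
  by (simp add: coset_positions_def positions_def)

lemma sum_coset_positions_le: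
  assumes "\<bar>q\<bar> < (1::real)"
  shows "(\<Sum>p\<in>coset_positions N. \<bar>q\<bar> ^ depth N p) \<le> 2 / (1 - \<bar>q\<bar>)"
proof (cases "N \<le> 1")
  case True
  have "1 \<le> 2 / (1 - \<bar>q\<bar>)" using assms by (simp add: field_simps)
  then show ?thesis using True by (simp add: coset_positions_def depth_def)
next
  case False
  then show ?thesis using sum_depth_le[OF assms] by (simp add: coset_positions_def)
qed

locale type_D_fock =
  fixes q :: real and bar :: "'h::complex_hilbert \<Rightarrow> 'h" and J :: "'h fock \<Rightarrow> 'k::complex_hilbert"
  assumes q: "\<bar>q\<bar> < 1" and bar: "selfadjoint_involution bar"
    and completion: "is_completion (fock_inner q bar) J"
begin

abbreviation P :: "'h fock \<Rightarrow> 'h fock" where "P \<equiv> symmetrizer q bar"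

lemma bar_bar: "bar (bar x) = x"
  using bar by (simp add: selfadjoint_involution_def)

lemma clinear_J: "clinear J" and J_dense: "closure (range J) = UNIV"
  and cinner_J: "cinner (J f) (J g) = fock_inner0 f (P g)"
  using completion by (auto simp: is_completion_def fock_inner_def)

lemma Rep_symmetrizer_tensor:
  "Rep_fock (P (tensor xs)) ys =
     (\<Sum>\<sigma>\<in>coxD (length ys). complex_of_real q ^ len (length ys) \<sigma> * simple_form xs (act bar (inv \<sigma>) ys))"
proof (cases "length ys = length xs")
  case True
  then show ?thesis
    using subsetD[OF coxD_coxB]
    by (simp add: symmetrizer_tensor[OF bar] clinear_sum[OF clinear_Rep] scaleC_fock.rep_eq tensor.rep_eq
        simple_form_act[OF bar])
next
  case False
  then show ?thesis
    by (simp add: symmetrizer_tensor[OF bar] clinear_sum[OF clinear_Rep] scaleC_fock.rep_eq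
        tensor.rep_eq simple_form_def)
qed

text \<open>The operator \<open>1 \<otimes> P\<close>, with the vacuum vector as a fixed point.\<close>

definition shifted_symmetrizer :: "'h fock \<Rightarrow> 'h fock" where
  "shifted_symmetrizer = tensor_ext (\<lambda>xs. case xs of [] \<Rightarrow> vacuum | x # xs' \<Rightarrow> creation x (P (tensor xs')))"

lemma clinear_shifted_symmetrizer: "clinear shifted_symmetrizer"
  and shifted_symmetrizer_vacuum: "shifted_symmetrizer vacuum = vacuum"
  and shifted_symmetrizer_tensor: "shifted_symmetrizer (tensor (x # xs)) = creation x (P (tensor xs))"
proof -
  let ?\<phi> = "\<lambda>xs. case xs of [] \<Rightarrow> vacuum | x # xs' \<Rightarrow> creation x (P (tensor xs'))"
  let ?F = "\<lambda>f ys. case ys of [] \<Rightarrow> f [] | y # ys' \<Rightarrow>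
    \<Sum>\<sigma>\<in>coxD (length ys'). complex_of_real q ^ len (length ys') \<sigma> * f (y # act bar (inv \<sigma>) ys')"
  have *: "?F (simple_form xs) = Rep_fock (?\<phi> xs)" for xs
  proof
    fix ys show "?F (simple_form xs) ys = Rep_fock (?\<phi> xs) ys"
      by (cases xs; cases ys)
        (simp_all add: simple_form_Nil simple_form_Cons_Nil simple_form_Cons_Cons tensor.rep_eq
          Rep_creation Rep_symmetrizer_tensor sum_distrib_left mult.left_commute)
  qed
  have l: "?F (\<lambda>ys. 0) ys = 0" and a: "?F (\<lambda>ys. f ys + c * g ys) ys = ?F f ys + c * ?F g ys" for f g c ys
    by (auto simp: algebra_simps sum.distrib sum_distrib_left split: list.split)
  show "clinear shifted_symmetrizer"
    unfolding shifted_symmetrizer_def by (rule clinear_ext_exists(1)[of ?F, OF l a *])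
  have "shifted_symmetrizer (tensor xs) = ?\<phi> xs" for xs
    unfolding shifted_symmetrizer_def by (rule clinear_ext_exists(2)[of ?F, OF l a *])
  from this[of "[]"] this[of "x # xs"]
  show "shifted_symmetrizer vacuum = vacuum" "shifted_symmetrizer (tensor (x # xs)) = creation x
      (P (tensor xs))"
    by simp_all
qed

lemma shifted_symmetrizer_creation: "shifted_symmetrizer (creation x f) = creation x (P f)"
proof -
  have "(\<lambda>f. shifted_symmetrizer (creation x f)) = (\<lambda>f. creation x (P f))"
    by (rule clinear_fock_eqI[OF clinear_compose[OF clinear_shifted_symmetrizer clinear_creation]
          clinear_compose[OF clinear_creation clinear_symmetrizer[OF bar]]])
      (simp add: creation_tensor shifted_symmetrizer_tensor)
  then show ?thesis by (rule fun_cong)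
qed

definition coset_sum :: "'h fock \<Rightarrow> 'h fock" where
  "coset_sum = tensor_ext (\<lambda>xs. \<Sum>p\<in>coset_positions (length xs).
     (complex_of_real q ^ depth (length xs) p) *\<^sub>C tensor (act bar (coset_rep (length xs) p) xs))"

lemma clinear_coset_sum: "clinear coset_sum"
  and coset_sum_tensor: "coset_sum (tensor xs) = (\<Sum>p\<in>coset_positions (length xs).
     (complex_of_real q ^ depth (length xs) p) *\<^sub>C tensor (act bar (coset_rep (length xs) p) xs))"
proof -
  let ?\<phi> = "\<lambda>xs :: 'h list. \<Sum>p\<in>coset_positions (length xs).
     (complex_of_real q ^ depth (length xs) p) *\<^sub>C tensor (act bar (coset_rep (length xs) p) xs)"
  let ?F = "\<lambda>f ys. \<Sum>p\<in>coset_positions (length ys).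
    complex_of_real q ^ depth (length ys) p * f (act bar (inv (coset_rep (length ys) p)) ys)"
  have *: "?F (simple_form xs) = Rep_fock (?\<phi> xs)" for xs
  proof
    fix ys show "?F (simple_form xs) ys = Rep_fock (?\<phi> xs) ys"
    proof (cases "length ys = length xs")
      case True
      then show ?thesis
        using coset_positions_coxB[of _ "length xs"]
        by (simp add: clinear_sum[OF clinear_Rep] scaleC_fock.rep_eq tensor.rep_eq simple_form_act[OF bar])
    next
      case False
      then show ?thesis
        by (simp add: clinear_sum[OF clinear_Rep] scaleC_fock.rep_eq tensor.rep_eq simple_form_def)
    qed
  qed
  have l: "?F (\<lambda>ys. 0) ys = 0" and a: "?F (\<lambda>ys. f ys + c * g ys) ys = ?F f ys + c * ?F g ys" for f g c ys
    by (auto simp: algebra_simps sum.distrib sum_distrib_left)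
  show "clinear coset_sum"
    unfolding coset_sum_def by (rule clinear_ext_exists(1)[of ?F, OF l a *])
  show "coset_sum (tensor xs) = ?\<phi> xs" for xs
    unfolding coset_sum_def by (rule clinear_ext_exists(2)[of ?F, OF l a *])
qed

lemma symmetrizer_short: "length xs \<le> 1 \<Longrightarrow> P (tensor xs) = tensor xs"
  by (simp add: symmetrizer_tensor[OF bar] coxD_0_1 len_id act_id scaleC_one del: One_nat_def)

lemma shifted_symmetrizer_sum:
  assumes "xs \<noteq> []"
  shows "shifted_symmetrizer (tensor xs) = (\<Sum>u\<in>coxD (length xs - 1).
    (complex_of_real q ^ len (length xs - 1) u) *\<^sub>C tensor (act bar (shift u) xs))"
proof -
  obtain x xs' where xs: "xs = x # xs'" using assms by (cases xs) auto
  have "act bar (shift u) xs = x # act bar u xs'" if "u \<in> coxD (length xs')" for u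
    using act_shift[of u xs'] that coxD_coxB xs by blast
  then show ?thesis
    by (simp add: xs shifted_symmetrizer_tensor symmetrizer_tensor[OF bar] clinear_sum[OF clinear_creation]
        clinear_scale[OF clinear_creation] creation_tensor)
qed

text \<open>Summation over the group is summation over coset representatives and over the subgroup, and the
weights split because lengths add. The representatives act first, the subgroup then acts on all legs
but the first.\<close>

lemma symmetrizer_factorization: "P f = shifted_symmetrizer (coset_sum f)"
proof -
  have "P = (\<lambda>f. shifted_symmetrizer (coset_sum f))"
  proof (rule clinear_fock_eqI[OF clinear_symmetrizer[OF bar] clinear_compose[OF
      clinear_shifted_symmetrizer clinear_coset_sum]])
    fix xs :: "'h list"
    show "P (tensor xs) = shifted_symmetrizer (coset_sum (tensor xs))"
    proof (cases "length xs \<le> 1")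
      case True
      have coset_sum: "coset_sum (tensor xs) = tensor xs"
        using True
        by (simp add: coset_sum_tensor coset_positions_def coset_rep_1 act_id depth_def scaleC_one)
      show ?thesis
      proof (cases xs)
        case Nil
        then show ?thesis
          using coset_sum symmetrizer_short[of xs] shifted_symmetrizer_vacuum by simp
      next
        case (Cons x xs')
        then have "xs' = []" using True by simp
        then show ?thesis using coset_sum symmetrizer_short[of xs] symmetrizer_short[of "[]"] Cons
          by (simp add: shifted_symmetrizer_tensor creation_tensor)
      qed
    next
      case False
      define N where "N = length xs"
      have N: "N \<ge> 2" "xs \<noteq> []" using False by (auto simp: N_def)
      have "P (tensor xs) = (\<Sum>p\<in>positions N. \<Sum>u\<in>coxD (N - 1).
          (complex_of_real q ^ len N (shift u \<circ> coset_rep N p)) *\<^sub>C tensor (act bar (shift u \<circ>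
            coset_rep N p) xs))"
        by (simp only: symmetrizer_tensor[OF bar] N_def[symmetric] sum_coxD_cosets[OF N(1)])
      also have "\<dots> = (\<Sum>p\<in>positions N. (complex_of_real q ^ depth N p) *\<^sub>C
          (\<Sum>u\<in>coxD (N - 1). (complex_of_real q ^ len (N - 1) u) *\<^sub>C tensor (act bar (shift u) (act
            bar (coset_rep N p) xs))))"
      proof (intro sum.cong refl)
        fix p assume p: "p \<in> positions N"
        have t: "(complex_of_real q ^ len N (shift u \<circ> coset_rep N p)) *\<^sub>C tensor (act bar (shift
            u \<circ> coset_rep N p) xs) =
           (complex_of_real q ^ depth N p) *\<^sub>C (complex_of_real q ^ len (N - 1) u) *\<^sub>C tensor (act
             bar (shift u) (act bar (coset_rep N p) xs))"
          if u: "u \<in> coxD (N - 1)" for u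
        proof -
          have "shift u \<in> coxB N" using shift_coxB[of u "N - 1"] u coxD_coxB[of "N - 1"] N by auto
          then have "act bar (shift u \<circ> coset_rep N p) xs = act bar (shift u) (act bar (coset_rep N p) xs)"
            using coset_rep_coxB[OF N(1) p] by (intro act_comp) (auto simp: N_def bar_bar)
          then show ?thesis
            by (simp only: len_coset(2)[OF N(1) u p] power_add scaleC_scaleC mult.commute)
        qed
        show "(\<Sum>u\<in>coxD (N - 1). (complex_of_real q ^ len N (shift u \<circ> coset_rep N p)) *\<^sub>C tensor
            (act bar (shift u \<circ> coset_rep N p) xs)) =
          (complex_of_real q ^ depth N p) *\<^sub>C
          (\<Sum>u\<in>coxD (N - 1). (complex_of_real q ^ len (N - 1) u) *\<^sub>C tensor (act bar (shift u) (act
            bar (coset_rep N p) xs)))"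
          unfolding clinear_sum[OF clinear_scaleC] by (intro sum.cong refl t)
      qed
      also have "\<dots> = shifted_symmetrizer (coset_sum (tensor xs))"
      proof -
        have "shifted_symmetrizer (tensor (act bar (coset_rep N p) xs)) = (\<Sum>u\<in>coxD (N - 1).
            (complex_of_real q ^ len (N - 1) u) *\<^sub>C tensor (act bar (shift u) (act bar (coset_rep
              N p) xs)))" for p
          using shifted_symmetrizer_sum[of "act bar (coset_rep N p) xs"] N
          by (simp add: N_def) (metis length_0_conv length_act)
        then show ?thesis
          using False
          by (simp add: coset_sum_tensor coset_positions_def clinear_sum[OF
              clinear_shifted_symmetrizer] clinear_scale[OF clinear_shifted_symmetrizer] N_def[symmetric])
      qed
      finally show ?thesis .
    qed
  qed
  then show ?thesis by (rule fun_cong)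
qed

definition shifted_inner :: "'h fock \<Rightarrow> 'h fock \<Rightarrow> complex" where
  "shifted_inner f g = fock_inner0 f (shifted_symmetrizer g)"

lemma clinear_shifted_inner: "clinear (shifted_inner f)"
  unfolding shifted_inner_def
  by (rule clinear_compose[OF clinear_fock_inner0 clinear_shifted_symmetrizer])

lemma shifted_inner_left:
  "shifted_inner (f + g) h = shifted_inner f h + shifted_inner g h"
  "shifted_inner (c *\<^sub>C f) h = cnj c * shifted_inner f h"
  by (simp_all add: shifted_inner_def fock_inner0_add_left fock_inner0_scaleC_left)

lemma shifted_inner_right:
  "shifted_inner f (g + h) = shifted_inner f g + shifted_inner f h"
  "shifted_inner f (c *\<^sub>C g) = c * shifted_inner f g"
  by (simp_all add: clinear_add[OF clinear_shifted_inner] clinear_scale[OF clinear_shifted_inner]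
      scaleC_complex_def)

text \<open>In this form the pairing is the product of the inner products of the first leg and of the rest, which
is what makes \<open>x \<otimes> f\<close> computable.\<close>

lemma shifted_inner_creation: "shifted_inner (creation x f) (creation y g) = cinner x y * cinner (J f) (J g)"
  by (simp add: shifted_inner_def shifted_symmetrizer_creation fock_inner0_creation cinner_J)

lemma shifted_inner_vacuum: "shifted_inner vacuum vacuum = 1" "shifted_inner vacuum (creation x f) = 0"
  by (simp_all add: shifted_inner_def shifted_symmetrizer_vacuum shifted_symmetrizer_creation
      fock_inner0_tensor_left Rep_creation tensor.rep_eq simple_form_Nil)

lemma shifted_inner_vacuum_right: "shifted_inner (creation x f) vacuum = 0"
  by (simp add: shifted_inner_def shifted_symmetrizer_vacuum fock_inner0_tensor_right Rep_creation)

lemma shifted_inner_commute: "shifted_inner f g = cnj (shifted_inner g f)"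
proof (rule sesquilinear_fock_eqI[of shifted_inner "\<lambda>f g. cnj (shifted_inner g f)"])
  fix xs ys :: "'h list"
  show "shifted_inner (tensor xs) (tensor ys) = cnj (shifted_inner (tensor ys) (tensor xs))"
    by (cases xs; cases ys)
      (simp_all add: creation_tensor[symmetric] shifted_inner_vacuum shifted_inner_vacuum_right
        shifted_inner_creation cinner_commute[symmetric])
qed (unfold clinear_iff, auto simp: shifted_inner_left shifted_inner_right scaleC_complex_def)

lemma shifted_inner_creation_sum_orthogonal:
  "(\<And>y h. (y, h) \<in> set L \<Longrightarrow> cinner x y = 0) \<Longrightarrow> shifted_inner (creation x g) (creation_sum L) = 0"
proof (induction L)
  case Nil
  show ?case using clinear_0[OF clinear_shifted_inner] by simp
next
  case (Cons a L)
  obtain y h where a: "a = (y, h)" by (cases a)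
  have "cinner x y = 0" "shifted_inner (creation x g) (creation_sum L) = 0"
    using Cons a by (auto intro: Cons.IH)
  then show ?case by (simp add: a shifted_inner_right shifted_inner_creation)
qed

text \<open>Positivity of a tensor product of two positive forms, by Gram-Schmidt: subtracting from all first legs
their component along the first one splits off a summand orthogonal to the rest.\<close>

lemma shifted_inner_creation_sum_nonneg: "Re (shifted_inner (creation_sum L) (creation_sum L)) \<ge> 0"
proof (induction "length L" arbitrary: L)
  case 0
  then show ?case using clinear_0[OF clinear_shifted_inner] by simp
next
  case (Suc n)
  then obtain x g L' where L: "L = (x, g) # L'" "length L' = n" by (cases L) auto
  \<comment> \<open>for \<open>x = 0\<close> the quotient is \<open>0\<close> and orthogonality to \<open>x\<close> is trivial\<close>
  define c where "c y = cinner x y / cinner x x" for y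
  define L'' where "L'' = map (\<lambda>(y, h). (y - c y *\<^sub>C x, h)) L'"
  have split: "\<exists>k. creation_sum M = creation x k + creation_sum (map (\<lambda>(y, h). (y - c y *\<^sub>C x, h)) M)" for M
  proof (induction M)
    case Nil
    show ?case by (rule exI[of _ 0]) (simp add: clinear_0[OF clinear_creation])
  next
    case (Cons a M)
    then obtain k where k: "creation_sum M = creation x k + creation_sum (map (\<lambda>(y, h). (y - c y
        *\<^sub>C x, h)) M)"
      by blast
    obtain y h where a: "a = (y, h)" by (cases a)
    have "creation y h = creation ((y - c y *\<^sub>C x) + c y *\<^sub>C x) h" by simp
    also have "\<dots> = creation (y - c y *\<^sub>C x) h + creation x (c y *\<^sub>C h)"
      unfolding creation_add_left creation_scaleC_left clinear_scale[OF clinear_creation] ..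
    finally have "creation_sum (a # M) = creation x (k + c y *\<^sub>C h) + creation_sum (map (\<lambda>(y, h).
        (y - c y *\<^sub>C x, h)) (a # M))"
      by (simp add: a k clinear_add[OF clinear_creation])
    then show ?case by blast
  qed
  then obtain k where k: "creation_sum L' = creation x k + creation_sum L''"
    unfolding L''_def by blast
  define h where "h = g + k"
  have S: "creation_sum L = creation x h + creation_sum L''"
    by (simp add: L k h_def clinear_add[OF clinear_creation] add.assoc)
  have orth: "cinner x z = 0" if "(z, w) \<in> set L''" for z w
  proof -
    from that obtain y where "z = y - c y *\<^sub>C x" by (auto simp: L''_def)
    then show ?thesis by (cases "cinner x x = 0")
      (auto simp: cinner_diff cinner_scaleC_right c_def cinner_self)
  qed
  have 1: "shifted_inner (creation x h) (creation_sum L'') = 0"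
    by (rule shifted_inner_creation_sum_orthogonal[OF orth])
  then have 2: "shifted_inner (creation_sum L'') (creation x h) = 0"
    by (subst shifted_inner_commute) simp
  have 3: "Re (shifted_inner (creation_sum L'') (creation_sum L'')) \<ge> 0"
    using Suc(2) L by (intro Suc(1)) (simp add: L''_def)
  have 4: "shifted_inner (creation x h) (creation x h) = of_real ((norm x)\<^sup>2 * (norm (J h))\<^sup>2)"
    by (simp add: shifted_inner_creation cinner_self)
  show ?case
    using 3
    by (simp add: S shifted_inner_left shifted_inner_right 1 2 4 del: of_real_mult of_real_power)
qed

lemma shifted_inner_nonneg: "Re (shifted_inner f f) \<ge> 0"
proof -
  obtain c L where f: "f = c *\<^sub>C vacuum + creation_sum L" using fock_decomposition by blast
  have "shifted_inner vacuum (creation_sum L) = 0"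
    by (induction L) (auto simp: clinear_0[OF clinear_shifted_inner] shifted_inner_right
        shifted_inner_vacuum)
  moreover have "shifted_inner (creation_sum L) vacuum = 0"
    by (subst shifted_inner_commute) (simp add: calculation)
  ultimately have "shifted_inner f f = of_real ((cmod c)\<^sup>2) + shifted_inner (creation_sum L)
      (creation_sum L)"
    unfolding complex_norm_square
    by (simp add: f shifted_inner_left shifted_inner_right shifted_inner_vacuum mult.commute)
  then show ?thesis using shifted_inner_creation_sum_nonneg[of L] by simp
qed

definition shifted_form :: "'h fock \<Rightarrow> 'h fock \<Rightarrow> real" where
  "shifted_form f g = Re (shifted_inner f g)"

sublocale semi_inner shifted_form
proof
  show "bilinear shifted_form"
    unfolding bilinear_def
    by (auto intro!: linearI simp: shifted_form_def shifted_inner_left shifted_inner_right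
        scaleC_of_real[symmetric])
  show "shifted_form f g = shifted_form g f" for f g
    using arg_cong[OF shifted_inner_commute[of f g], of Re] by (simp add: shifted_form_def)
  show "shifted_form f f \<ge> 0" for f by (simp add: shifted_form_def shifted_inner_nonneg)
qed

lemma shifted_form_scaleC: "seminorm (c *\<^sub>C f) = cmod c * seminorm f"
proof -
  have "shifted_inner (c *\<^sub>C f) (c *\<^sub>C f) = of_real ((cmod c)\<^sup>2) * shifted_inner f f"
    unfolding complex_norm_square by (simp add: shifted_inner_left shifted_inner_right)
  then show ?thesis by (simp add: shifted_form_def real_sqrt_mult del: of_real_power)
qed

lemma shifted_inner_coset_sum: "shifted_inner f (coset_sum g) = cinner (J f) (J g)"
  by (simp add: shifted_inner_def symmetrizer_factorization[symmetric] cinner_J)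

text \<open>Composing with \<open>coset_sum\<close> turns the shifted form into the inner product of the Fock space
(\<open>shifted_inner_coset_sum\<close>), which is Hermitian. Hence \<open>coset_sum\<close> is symmetric for the shifted form.\<close>

lemma shifted_form_coset_sum: "shifted_form f (coset_sum g) = shifted_form (coset_sum f) g"
proof -
  have "shifted_inner f (coset_sum g) = cnj (shifted_inner g (coset_sum f))"
    unfolding shifted_inner_coset_sum by (rule cinner_commute)
  then show ?thesis using sym[of "coset_sum f" g] by (simp add: shifted_form_def)
qed

lemma clinear_coset_sum_pow: "clinear (coset_sum ^^ m)"
proof (induction m)
  case (Suc m)
  then show ?case using clinear_compose[OF clinear_coset_sum Suc] by (simp add: o_def)
qed (auto simp: clinear_iff)

text \<open>A bound, independent of the tensor power, for the sum of the absolute values of the coefficients of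
\<open>coset_sum\<close>.\<close>

abbreviation coset_const :: real where "coset_const \<equiv> 2 / (1 - \<bar>q\<bar>)"

lemma coset_const_nonneg: "coset_const \<ge> 0"
  using q by simp

text \<open>All powers of \<open>coset_sum\<close> stay in the span of the finite orbit of the tensor under signed permutations.
Each application multiplies the sum of the coefficients by at most \<open>coset_const\<close>, and the largest
seminorm on the orbit is absorbed in \<open>K\<close>.\<close>

lemma coset_sum_growth_tensor: "\<exists>K. \<forall>m. seminorm ((coset_sum ^^ m) (tensor xs)) \<le> K * coset_const ^ m"
proof -
  define N where "N = length xs"
  define Orb where "Orb = (\<lambda>\<sigma>. act bar \<sigma> xs) ` coxB N"
  have "finite (coxB N)"
    by (rule finite_subset[of _ "{\<sigma>. \<sigma> permutes ({- int N..int N} - {0})}"])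
      (auto simp: coxB_def intro: finite_permutations)
  then have fin: "finite Orb" by (simp add: Orb_def)
  define K where "K = (\<Sum>ys\<in>Orb. seminorm (tensor ys))"
  have K: "seminorm (tensor ys) \<le> K" if "ys \<in> Orb" for ys
    unfolding K_def using fin that pos by (intro member_le_sum) auto
  have "K \<ge> 0" unfolding K_def using pos by (intro sum_nonneg) auto
  have "\<forall>ys\<in>Orb. seminorm ((coset_sum ^^ m) (tensor ys)) \<le> K * coset_const ^ m" for m
  proof (induction m)
    case 0
    show ?case using K by simp
  next
    case (Suc m)
    show ?case
    proof
      fix ys assume ys: "ys \<in> Orb"
      have len: "length ys = N" using ys by (auto simp: Orb_def N_def)
      define t where "t p = tensor (act bar (coset_rep N p) ys)" for p
      have t_Orb: "act bar (coset_rep N p) ys \<in> Orb" if "p \<in> coset_positions N" for p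
      proof -
        obtain \<sigma> where \<sigma>: "\<sigma> \<in> coxB N" "ys = act bar \<sigma> xs" using ys by (auto simp: Orb_def)
        have "act bar (coset_rep N p) ys = act bar (coset_rep N p \<circ> \<sigma>) xs"
          using act_comp[of "coset_rep N p" xs \<sigma> bar] coset_positions_coxB[OF that] \<sigma> bar_bar
          by (simp add: N_def)
        then show ?thesis
          using coxB_comp[OF coset_positions_coxB[OF that] \<sigma>(1)] by (auto simp: Orb_def)
      qed
      have "(coset_sum ^^ Suc m) (tensor ys) = (\<Sum>p\<in>coset_positions N. (complex_of_real q ^ depth N
          p) *\<^sub>C (coset_sum ^^ m) (t p))"
        by (simp only: funpow_Suc_right o_apply coset_sum_tensor len clinear_sum[OF clinear_coset_sum_pow]
            clinear_scale[OF clinear_coset_sum_pow] t_def)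
      then have "seminorm ((coset_sum ^^ Suc m) (tensor ys)) \<le>
          (\<Sum>p\<in>coset_positions N. \<bar>q\<bar> ^ depth N p * seminorm ((coset_sum ^^ m) (t p)))"
        using triangle_sum[OF finite_coset_positions, of "\<lambda>p. (complex_of_real q ^ depth N p) *\<^sub>C
            (coset_sum ^^ m) (t p)" N]
        by (simp only: shifted_form_scaleC norm_power norm_of_real)
      also have "\<dots> \<le> (\<Sum>p\<in>coset_positions N. \<bar>q\<bar> ^ depth N p * (K * coset_const ^ m))"
        using Suc t_Orb unfolding t_def by (intro sum_mono mult_left_mono) auto
      also have "\<dots> = (\<Sum>p\<in>coset_positions N. \<bar>q\<bar> ^ depth N p) * (K * coset_const ^ m)"
        by (simp only: sum_distrib_right)
      also have "\<dots> \<le> coset_const * (K * coset_const ^ m)"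
        using sum_coset_positions_le[OF q] \<open>K \<ge> 0\<close> coset_const_nonneg
        by (intro mult_right_mono mult_nonneg_nonneg zero_le_power) auto
      finally show "seminorm ((coset_sum ^^ Suc m) (tensor ys)) \<le> K * coset_const ^ Suc m"
        by (simp only: power_Suc mult.left_commute)
    qed
  qed
  moreover have "xs \<in> Orb" unfolding Orb_def using coxB_id[of N] act_id[of bar xs] by (metis imageI)
  ultimately show ?thesis by blast
qed

lemma coset_sum_growth: "\<exists>K. \<forall>m. seminorm ((coset_sum ^^ m) f) \<le> K * coset_const ^ m"
proof (induction f rule: fock_induct)
  case zero
  have "(coset_sum ^^ m) 0 = 0" for m by (rule clinear_0[OF clinear_coset_sum_pow])
  then show ?case using bilinear_lzero[OF bilin] by (intro exI[of _ 0]) auto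
next
  case (step f c xs)
  then obtain K where K: "\<And>m. seminorm ((coset_sum ^^ m) f) \<le> K * coset_const ^ m" by blast
  obtain L where L: "\<And>m. seminorm ((coset_sum ^^ m) (tensor xs)) \<le> L * coset_const ^ m"
    using coset_sum_growth_tensor by blast
  have "seminorm ((coset_sum ^^ m) (f + c *\<^sub>C tensor xs)) \<le> (K + cmod c * L) * coset_const ^ m" for m
  proof -
    have "seminorm ((coset_sum ^^ m) (f + c *\<^sub>C tensor xs)) \<le>
        seminorm ((coset_sum ^^ m) f) + cmod c * seminorm ((coset_sum ^^ m) (tensor xs))"
      using triangle[of "(coset_sum ^^ m) f" "c *\<^sub>C (coset_sum ^^ m) (tensor xs)"]
      by (simp only: clinear_add[OF clinear_coset_sum_pow] clinear_scale[OF clinear_coset_sum_pow]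
          shifted_form_scaleC)
    also have "\<dots> \<le> K * coset_const ^ m + cmod c * (L * coset_const ^ m)"
      by (intro add_mono mult_left_mono K L) simp
    finally show ?thesis by (simp only: distrib_right mult.assoc)
  qed
  then show ?case by blast
qed

text \<open>For \<open>x \<otimes> f\<close> the shifted form is \<open>\<parallel>x\<parallel>\<^sup>2 \<parallel>f\<parallel>\<^sup>2\<close>, and its value against \<open>coset_sum\<close> is the squared norm
in the Fock space.\<close>

lemma creation_bound: "norm (J (creation x f)) \<le> (sqrt coset_const * norm x) * norm (J f)"
proof -
  obtain K where K: "\<And>m. seminorm ((coset_sum ^^ m) (creation x f)) \<le> K * coset_const ^ m"
    using coset_sum_growth by blast
  have "shifted_form (creation x f) (coset_sum (creation x f)) \<le> coset_const * shifted_form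
      (creation x f) (creation x f)"
    by (rule symmetric_operator_bound[OF shifted_form_coset_sum coset_const_nonneg K])
  moreover have "shifted_form (creation x f) (coset_sum (creation x f)) = (norm (J (creation x f)))\<^sup>2"
    by (simp add: shifted_form_def shifted_inner_coset_sum cinner_self del: of_real_power)
  moreover have "shifted_form (creation x f) (creation x f) = (norm x)\<^sup>2 * (norm (J f))\<^sup>2"
    by (simp add: shifted_form_def shifted_inner_creation cinner_self del: of_real_power)
  ultimately have "(norm (J (creation x f)))\<^sup>2 \<le> coset_const * ((norm x)\<^sup>2 * (norm (J f))\<^sup>2)"
    by simp
  also have "\<dots> = ((sqrt coset_const * norm x) * norm (J f))\<^sup>2"
    using coset_const_nonneg by (simp only: power_mult_distrib real_sqrt_pow2 mult.assoc)
  finally show ?thesis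
    by (rule power2_le_imp_le) (intro mult_nonneg_nonneg real_sqrt_ge_zero coset_const_nonneg norm_ge_zero)
qed

lemma eq_if_cinner_J:
  assumes "\<And>f. cinner \<xi> (J f) = cinner \<eta> (J f)"
  shows "\<xi> = \<eta>"
proof -
  \<comment> \<open>both sides are continuous in the right argument and agree on the dense range of \<open>J\<close>\<close>
  have cont: "continuous_on UNIV (cinner \<zeta>)" for \<zeta> :: 'k
    by (auto simp: continuous_on_def intro: tendsto_cinner tendsto_const)
  have "cinner \<xi> = cinner \<eta>"
    by (rule dense_eqI[OF cont cont J_dense]) (use assms in auto)
  then show ?thesis using cinner_eqI[of \<xi> \<eta>] by simp
qed

lemma bounded_clinear_creation_op: "bounded_clinear (creation_op J x)"
  and creation_op_J: "creation_op J x (J f) = J (creation x f)"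
  unfolding creation_op_def
  by (fact bounded_clinear_extension[OF clinear_J J_dense clinear_creation creation_bound])
    (fact extension_apply[OF clinear_J J_dense clinear_creation creation_bound])

lemma bounded_clinear_gaussian: "bounded_clinear (gaussian J x)"
  and adj_gaussian: "adj (gaussian J x) = gaussian J x"
proof -
  note b = bounded_clinear_creation_op[of x]
  show "bounded_clinear (gaussian J x)"
    unfolding gaussian_def annihilation_op_def
    by (intro bounded_clinear_add bounded_clinear_adj b)
  show "adj (gaussian J x) = gaussian J x"
    unfolding gaussian_def annihilation_op_def
    by (simp add: adj_add bounded_clinear_adj b adj_adj add.commute)
qed

end

section \<open>Fourth moments of the vacuum state\<close>

context type_D_fock
begin

lemma cinner_annihilation: "cinner (annihilation_op J x \<xi>) (J f) = cinner \<xi> (J (creation x f))"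
  unfolding annihilation_op_def
  by (simp add: cinner_adj_left[OF bounded_clinear_creation_op] creation_op_J)

lemma cinner_vacuum: "cinner (J vacuum) (J f) = Rep_fock f []"
proof -
  have "cinner (J f) (J vacuum) = cnj (Rep_fock f [])"
    by (simp add: cinner_J symmetrizer_short fock_inner0_tensor_right)
  then show ?thesis by (metis cinner_commute complex_cnj_cnj)
qed

lemma annihilation_vacuum: "annihilation_op J x (J vacuum) = 0"
  by (rule eq_if_cinner_J) (simp add: cinner_annihilation cinner_vacuum Rep_creation)

lemma annihilation_tensor1: "annihilation_op J x (J (tensor [y])) = cinner x y *\<^sub>C J vacuum"
proof (rule eq_if_cinner_J)
  fix f
  have "cinner (J (creation x f)) (J (tensor [y])) = cinner x y * cnj (Rep_fock f [])"
    using fock_inner0_creation[of x f y vacuum]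
    by (simp add: cinner_J symmetrizer_short creation_tensor fock_inner0_tensor_right)
  then have "cinner (J (tensor [y])) (J (creation x f)) = cnj (cinner x y) * Rep_fock f []"
    by (metis cinner_commute complex_cnj_cnj complex_cnj_mult)
  then show "cinner (annihilation_op J x (J (tensor [y]))) (J f) = cinner (cinner x y *\<^sub>C J vacuum) (J f)"
    by (simp add: cinner_annihilation cinner_simps cinner_vacuum)
qed

lemma gaussian_vacuum: "gaussian J x (J vacuum) = J (tensor [x])"
  by (simp add: gaussian_def annihilation_vacuum creation_op_J creation_tensor)

lemma gaussian_tensor1: "gaussian J x (J (tensor [y])) = cinner x y *\<^sub>C J vacuum + J (tensor [x, y])"
  by (simp add: gaussian_def annihilation_tensor1 creation_op_J creation_tensor)

text \<open>The four elements of \<open>D(2)\<close> are the four coset representatives, as the subgroup is trivial.\<close>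

lemma symmetrizer_2:
  "P (tensor [x, y]) = tensor [x, y] + complex_of_real q *\<^sub>C tensor [y, x]
     + complex_of_real q *\<^sub>C tensor [bar y, bar x] + (complex_of_real q)\<^sup>2 *\<^sub>C tensor [bar x, bar y]"
proof -
  have 2: "shifted_symmetrizer (tensor [u, v]) = tensor [u, v]" for u v
    by (simp add: shifted_symmetrizer_tensor symmetrizer_short creation_tensor)
  have gens: "swap 1 \<in> gensD 2" "hat_swap 2 \<in> gensD 2" by (auto simp: gensD_def)
  have c2: "coset_rep 2 2 = swap 1"
    using coset_rep_move[of 2 1 "swap 1"] gens by (simp add: coset_rep_1 positions_def swap_apply)
  have cm2: "coset_rep 2 (- 2) = hat_swap 2"
    using coset_rep_move[of 2 1 "hat_swap 2"] gens
    by (simp add: coset_rep_1 positions_def hat_swap_apply)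
  have cm1: "coset_rep 2 (- 1) = swap 1 \<circ> hat_swap 2"
    using coset_rep_move[of 2 2 "hat_swap 2"] gens by (simp add: c2 positions_def hat_swap_apply)
  have a1: "act bar (swap 1) [u, v] = [v, u]" for u v
    using act_swap[of bar "[]" u v "[]"] by simp
  have a2: "act bar (hat_swap 2) [u, v] = [bar v, bar u]" for u v
    using act_hat_swap[of bar "[]" u v] by (simp add: numeral_2_eq_2)
  have a3: "act bar (swap 1 \<circ> hat_swap 2) [u, v] = [bar u, bar v]" for u v
    using act_comp[of "swap 1" "[u, v]" "hat_swap 2" bar] gens gensD_coxB[of 2] bar_bar
    by (simp add: a1[unfolded One_nat_def] a2 numeral_2_eq_2[symmetric] subset_eq)
  have pos: "coset_positions 2 = {1, 2, - 2, - 1}" by (auto simp: coset_positions_def positions_def)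
  have "coset_sum (tensor [x, y]) = (\<Sum>p\<in>{1, 2, - 2, - 1}.
      (complex_of_real q ^ depth 2 p) *\<^sub>C tensor (act bar (coset_rep 2 p) [x, y]))"
    using coset_sum_tensor[of "[x, y]"]
    by (simp only: pos[symmetric] list.size numeral_2_eq_2 add_0 add_Suc plus_nat.simps)
  also have "\<dots> = tensor [x, y] + complex_of_real q *\<^sub>C tensor [y, x]
     + complex_of_real q *\<^sub>C tensor [bar y, bar x] + (complex_of_real q)\<^sup>2 *\<^sub>C tensor [bar x, bar y]"
    by (simp add: coset_rep_1 act_id c2 cm2 cm1 a1[unfolded One_nat_def] a1 a2 a3 depth_def
        scaleC_one add.assoc
        del: One_nat_def)
  finally show ?thesis
    by (simp add: symmetrizer_factorization clinear_add[OF clinear_shifted_symmetrizer]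
        clinear_scale[OF clinear_shifted_symmetrizer] 2)
qed

text \<open>By selfadjointness two of the operators act on the left vacuum vector, so only
vectors of degree at most two occur.\<close>

lemma fourth_moment:
  "vacuum_state J (gaussian J a \<circ> gaussian J b \<circ> gaussian J c \<circ> gaussian J d) =
     cinner a b * cinner c d + cinner b c * cinner a d + q * (cinner b d * cinner a c)
     + q * (cinner b (bar d) * cinner a (bar c)) + q\<^sup>2 * (cinner b (bar c) * cinner a (bar d))"
proof -
  have adj: "cinner \<xi> (gaussian J x \<eta>) = cinner (gaussian J x \<xi>) \<eta>" for x \<xi> \<eta>
    using cinner_adj_left[OF bounded_clinear_gaussian, of x \<xi> \<eta>] by (simp add: adj_gaussian)
  have 0: "cinner (J vacuum) (J (tensor [u, v])) = 0" "cinner (J (tensor [u, v])) (J vacuum) = 0" for u v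
    by (simp_all add: cinner_vacuum cinner_commute[of "J (tensor [u, v])"] tensor.rep_eq
        simple_form_Cons_Nil)
  have 1: "cinner (J vacuum) (J vacuum) = 1"
    by (simp add: cinner_vacuum tensor.rep_eq simple_form_Nil)
  have "vacuum_state J (gaussian J a \<circ> gaussian J b \<circ> gaussian J c \<circ> gaussian J d) =
      cinner (gaussian J b (gaussian J a (J vacuum))) (gaussian J c (gaussian J d (J vacuum)))"
    by (simp add: vacuum_state_def adj)
  also have "\<dots> = cinner a b * cinner c d + cinner (J (tensor [b, a])) (J (tensor [c, d]))"
    by (simp add: gaussian_vacuum gaussian_tensor1 cinner_simps cinner_add_right cinner_scaleC_right 0 1
        cinner_commute[symmetric] bounded_clinearD[OF bounded_clinear_gaussian])
  also have "cinner (J (tensor [b, a])) (J (tensor [c, d])) = cinner b c * cinner a d + q *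
      (cinner b d * cinner a c)
     + q * (cinner b (bar d) * cinner a (bar c)) + q\<^sup>2 * (cinner b (bar c) * cinner a (bar d))"
    by (simp add: cinner_J symmetrizer_2 fock_inner0_tensor_left plus_fock.rep_eq scaleC_fock.rep_eq
        tensor.rep_eq simple_form_Cons_Cons simple_form_Nil)
  finally show ?thesis by (simp only: add.assoc)
qed

end

lemma real_hilbert_form_commute:
  assumes "real_hilbert_form HR" "x \<in> HR" "y \<in> HR"
  shows "cinner x y = cinner y x"
  using assms cinner_commute[of x y] by (auto simp: real_hilbert_form_def Reals_cnj_iff)

text \<open>The real form spans the Hilbert space over the complex numbers.\<close>

lemma real_hilbert_form_orthogonal:
  assumes "real_hilbert_form HR" "\<And>c. c \<in> HR \<Longrightarrow> cinner c z = 0"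
  shows "z = 0"
proof -
  have "\<exists>!(x, y). x \<in> HR \<and> y \<in> HR \<and> z = x + \<i> *\<^sub>C y"
    using assms(1) by (simp add: real_hilbert_form_def)
  then obtain x y where "x \<in> HR" "y \<in> HR" "z = x + \<i> *\<^sub>C y" by auto
  then have "cinner z z = 0"
    using assms(2) by (metis add.right_neutral cinner_simps mult_zero_right)
  then show ?thesis by (simp add: cinner_self)
qed

text \<open>The hypothesis \<open>cyc\<close> is the invariance of the fourth moment under rotation of the arguments, with the
terms free of \<open>bar\<close> cancelled and a factor \<open>q\<close> removed. Since \<open>bar\<close> may fail to preserve \<open>HR\<close>, the form
\<open>\<beta> x y = \<langle>x, bar y\<rangle>\<close> can have nonreal values, and its symmetry has to be derived. Then
\<open>\<beta> b c * \<beta> a d = \<beta> a b * \<beta> d c\<close>, so \<open>\<beta>\<close> has rank at most one: any vector \<open>b\<close> with \<open>\<beta> a b = 0\<close>, for a fixed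
\<open>a\<close> with \<open>\<beta> a a \<noteq> 0\<close>, is in the kernel. If there is no such \<open>a\<close>, then \<open>\<beta>\<close> vanishes by polarization.\<close>

lemma no_cyclic_fourth_moment:
  fixes bar :: "'h::complex_hilbert \<Rightarrow> 'h" and q :: real
  assumes q: "\<bar>q\<bar> < 1" and bar: "selfadjoint_involution bar" and HR: "real_hilbert_form HR"
    and dim: "B \<subseteq> HR" "independent B" "card B = 2"
    and cyc: "\<And>a b c d. \<lbrakk>a \<in> HR; b \<in> HR; c \<in> HR; d \<in> HR\<rbrakk> \<Longrightarrow>
      cinner a (bar c) * (cinner b (bar d) - cinner d (bar b)) +
      q * (cinner b (bar c) * cinner a (bar d) - cinner a (bar b) * cinner d (bar c)) = 0"
    and q0: "q \<noteq> 0"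
  shows False
proof -
  define \<beta> where "\<beta> x y = cinner x (bar y)" for x y
  have bl: "bounded_clinear bar" and sa: "cinner (bar x) y = cinner x (bar y)" and inv: "bar (bar
      x) = x" for x y
    using bar by (auto simp: selfadjoint_involution_def)
  note bc = bounded_clinearD[OF bl]
  have rel: "\<beta> a c * (\<beta> b d - \<beta> d b) + q * (\<beta> b c * \<beta> a d - \<beta> a b * \<beta> d c) = 0"
    if "a \<in> HR" "b \<in> HR" "c \<in> HR" "d \<in> HR" for a b c d
    using cyc[OF that] by (simp add: \<beta>_def)
  have add: "\<beta> (x + y) z = \<beta> x z + \<beta> y z" "\<beta> z (x + y) = \<beta> z x + \<beta> z y" for x y z
    by (simp_all add: \<beta>_def cinner_simps cinner_add_right bc)
  have herm: "\<beta> y x = cnj (\<beta> x y)" for x y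
    unfolding \<beta>_def by (metis cinner_commute sa)
  have sub: "subspace HR" using HR by (simp add: real_hilbert_form_def)
  have diag: "\<beta> a a = 0 \<or> \<beta> a d = \<beta> d a" if "a \<in> HR" "d \<in> HR" for a d
  proof -
    have "(1 + q) * (\<beta> a a * (\<beta> a d - \<beta> d a)) = 0"
      using rel[of a a a d] that by (simp add: algebra_simps)
    moreover have "complex_of_real (1 + q) \<noteq> 0" using q by (subst of_real_eq_0_iff) auto
    ultimately show ?thesis by (simp add: eq_iff_diff_eq_0[symmetric])
  qed
  have symm: "\<beta> a d = \<beta> d a" if ad: "a \<in> HR" "d \<in> HR" for a d
  proof (rule ccontr)
    assume ne: "\<beta> a d \<noteq> \<beta> d a"
    \<comment> \<open>apply \<open>diag\<close> to \<open>a\<close>, to \<open>d\<close> and to \<open>a + d\<close>: the real part of \<open>\<beta> a d\<close> vanishes as well\<close>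
    have aa: "\<beta> a a = 0" "\<beta> d d = 0" using diag ad ne by metis+
    have "a + d \<in> HR" using sub ad by (simp add: subspace_add)
    moreover have "\<beta> (a + d) d \<noteq> \<beta> d (a + d)" using ne by (simp add: add)
    ultimately have "\<beta> (a + d) (a + d) = 0" using diag ad by blast
    then have m: "\<beta> d a = - \<beta> a d" by (simp add: add aa eq_neg_iff_add_eq_0 add.commute)
    have "(2 + q) * (\<beta> a d)\<^sup>2 = 0"
      using rel[of a a d d] ad by (simp add: aa m power2_eq_square algebra_simps)
    moreover have "complex_of_real (2 + q) \<noteq> 0" using q by (subst of_real_eq_0_iff) auto
    ultimately have "\<beta> a d = 0" by simp
    then show False using ne m by simp
  qed
  have rank1: "\<beta> b c * \<beta> a d = \<beta> a b * \<beta> d c" if "a \<in> HR" "b \<in> HR" "c \<in> HR" "d \<in> HR" for a b c d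
    using rel[OF that] symm[OF that(2,4)] q0 by simp
  have nondeg: "b = 0" if b: "b \<in> HR" "\<And>c. c \<in> HR \<Longrightarrow> \<beta> b c = 0" for b
  proof -
    have "bar b = 0"
      by (rule real_hilbert_form_orthogonal[OF HR]) (use b symm \<beta>_def in metis)
    then show ?thesis using inv[of b] bc(4) by simp
  qed
  obtain u v where uv: "B = {u, v}" "u \<noteq> v" using dim(3) by (meson card_2_iff)
  have uvHR: "u \<in> HR" "v \<in> HR" using uv dim(1) by auto
  have u0: "u \<noteq> 0" using dim(2) uv dependent_zero by (metis insertI1)
  show False
  proof (cases "\<exists>a\<in>HR. \<beta> a a \<noteq> 0")
    case False
    have "\<beta> u c = 0" if c: "c \<in> HR" for c
    proof -
      have "u + c \<in> HR" using sub uvHR c by (simp add: subspace_add)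
      then have "\<beta> (u + c) (u + c) = 0" using False by blast
      then have "2 * \<beta> u c = 0" using False uvHR(1) c symm[OF uvHR(1) c] by (simp add: add)
      then show ?thesis by simp
    qed
    then show False using nondeg[OF uvHR(1)] u0 by blast
  next
    case True
    then obtain a where a: "a \<in> HR" "\<beta> a a \<noteq> 0" by blast
    have real: "\<beta> a x = complex_of_real (Re (\<beta> a x))" if "x \<in> HR" for x
      using symm[OF a(1) that] herm[of a x] by (metis Reals_cnj_iff of_real_Re)
    \<comment> \<open>a nonzero real combination of \<open>u\<close> and \<open>v\<close> in the kernel of \<open>\<beta> a\<close>\<close>
    define s t where "s = Re (\<beta> a v)" and "t = - Re (\<beta> a u)"
    define b where "b = (if s = 0 \<and> t = 0 then u else s *\<^sub>R u + t *\<^sub>R v)"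
    have bHR: "b \<in> HR" using sub uvHR by (simp add: b_def subspace_add subspace_scale)
    have scale: "\<beta> a (r *\<^sub>R x) = r * \<beta> a x" for r x
      by (simp add: \<beta>_def scaleC_of_real[symmetric] bc cinner_scaleC_right)
    have "\<beta> a b = 0"
    proof (cases "s = 0 \<and> t = 0")
      case True
      then show ?thesis using real[OF uvHR(1)] by (simp add: b_def t_def)
    next
      case False
      then have "\<beta> a b = s * \<beta> a u + t * \<beta> a v" by (simp only: b_def if_False add scale)
      also have "\<dots> = s * complex_of_real (Re (\<beta> a u)) + t * complex_of_real (Re (\<beta> a v))"
        by (simp only: real[OF uvHR(1), symmetric] real[OF uvHR(2), symmetric])
      also have "\<dots> = 0" by (simp add: s_def t_def)
      finally show ?thesis .
    qed
    then have "\<beta> b c = 0" if "c \<in> HR" for c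
      using rank1[OF a(1) bHR that a(1)] a(2) by simp
    then have "b = 0" using nondeg[OF bHR] by blast
    then have st: "s *\<^sub>R u + t *\<^sub>R v = 0" "s \<noteq> 0 \<or> t \<noteq> 0"
      using u0 by (auto simp: b_def split: if_splits)
    have "dependent {u, v}"
      using st uv(2) by (subst real_vector.dependent_finite)
        (auto intro!: exI[of _ "\<lambda>x. if x = u then s else t"])
    then show False using dim(2) uv(1) by simp
  qed
qed

text \<open>Rotating one factor is the trace property for a product of three generators and one generator.\<close>

lemma (in type_D_fock) trace_imp_q_eq_0:
  assumes HR: "real_hilbert_form HR" and dim: "E \<subseteq> HR" "independent E" "card E = 2"
    and trace: "is_trace (vN_generated (gaussian J ` HR)) (vacuum_state J)"
  shows "q = 0"
proof (rule ccontr)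
  assume q0: "q \<noteq> 0"
  show False
  proof (rule no_cyclic_fourth_moment[OF q bar HR dim _ q0])
    fix a b c d assume *: "a \<in> HR" "b \<in> HR" "c \<in> HR" "d \<in> HR"
    note gen = vN_generated_gen[of _ "gaussian J ` HR", OF imageI]
    have "vacuum_state J ((gaussian J a \<circ> gaussian J b \<circ> gaussian J c) \<circ> gaussian J d) =
        vacuum_state J (gaussian J d \<circ> (gaussian J a \<circ> gaussian J b \<circ> gaussian J c))"
      using trace * unfolding is_trace_def by (meson gen vN_generated_comp)
    then have "vacuum_state J (gaussian J a \<circ> gaussian J b \<circ> gaussian J c \<circ> gaussian J d) =
        vacuum_state J (gaussian J d \<circ> gaussian J a \<circ> gaussian J b \<circ> gaussian J c)"
      by (simp add: o_assoc)
    then have "q * (cinner a (bar c) * (cinner b (bar d) - cinner d (bar b)) +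
      q * (cinner b (bar c) * cinner a (bar d) - cinner a (bar b) * cinner d (bar c))) = 0"
      unfolding fourth_moment
      using real_hilbert_form_commute[OF HR, of d a] real_hilbert_form_commute[OF HR, of d c]
        real_hilbert_form_commute[OF HR, of d b] *
      by (simp add: algebra_simps power2_eq_square)
    then show "cinner a (bar c) * (cinner b (bar d) - cinner d (bar b)) +
      q * (cinner b (bar c) * cinner a (bar d) - cinner a (bar b) * cinner d (bar c)) = 0"
      using q0 by simp
  qed
qed

section \<open>The free case\<close>

lemma simple_form_snoc:
  "simple_form (xs @ [x]) [] = 0"
  "simple_form (xs @ [x]) (ys @ [y]) = cinner y x * simple_form xs ys"
  by (auto simp: simple_form_def nth_append intro!: prod.cong)

text \<open>The adjoint of left creation for the undeformed inner product; \<open>annihilate_right\<close> plays this role for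
right creation.\<close>

definition annihilate :: "'h::complex_hilbert \<Rightarrow> 'h fock \<Rightarrow> 'h fock" where
  "annihilate x = tensor_ext (\<lambda>xs. case xs of [] \<Rightarrow> 0 | y # ys \<Rightarrow> cinner x y *\<^sub>C tensor ys)"

definition create_right :: "'h::complex_hilbert \<Rightarrow> 'h fock \<Rightarrow> 'h fock" where
  "create_right x = tensor_ext (\<lambda>xs. tensor (xs @ [x]))"

definition annihilate_right :: "'h::complex_hilbert \<Rightarrow> 'h fock \<Rightarrow> 'h fock" where
  "annihilate_right x = tensor_ext (\<lambda>xs. if xs = [] then 0 else cinner x (last xs) *\<^sub>C tensor (butlast xs))"

lemma annihilate:
  shows clinear_annihilate: "clinear (annihilate x)"
    and annihilate_tensor: "annihilate x (tensor xs) = (case xs of [] \<Rightarrow> 0 | y # ys \<Rightarrow> cinner x y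
        *\<^sub>C tensor ys)"
proof -
  let ?F = "\<lambda>f ys. f (x # ys)"
  have *: "?F (simple_form xs) = Rep_fock (case xs of [] \<Rightarrow> 0 | y # ys \<Rightarrow> cinner x y *\<^sub>C tensor ys)" for xs
    by (cases xs) (auto simp: fun_eq_iff zero_fock.rep_eq scaleC_fock.rep_eq tensor.rep_eq
        simple_form_Nil simple_form_Cons_Cons)
  show "clinear (annihilate x)"
    unfolding annihilate_def by (rule clinear_ext_exists(1)[of ?F, OF _ _ *]) auto
  show "annihilate x (tensor xs) = (case xs of [] \<Rightarrow> 0 | y # ys \<Rightarrow> cinner x y *\<^sub>C tensor ys)"
    unfolding annihilate_def by (rule clinear_ext_exists(2)[of ?F, OF _ _ *]) auto
qed

lemma create_right:
  shows clinear_create_right: "clinear (create_right x)"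
    and create_right_tensor: "create_right x (tensor xs) = tensor (xs @ [x])"
proof -
  let ?F = "\<lambda>f ys. if ys = [] then 0 else cinner (last ys) x * f (butlast ys)"
  have *: "?F (simple_form xs) = Rep_fock (tensor (xs @ [x]))" for xs
  proof
    fix ys show "?F (simple_form xs) ys = Rep_fock (tensor (xs @ [x])) ys"
      by (cases ys rule: rev_cases) (auto simp: tensor.rep_eq simple_form_snoc)
  qed
  show "clinear (create_right x)"
    unfolding create_right_def
    by (rule clinear_ext_exists(1)[of ?F, OF _ _ *]) (auto simp: algebra_simps)
  show "create_right x (tensor xs) = tensor (xs @ [x])"
    unfolding create_right_def
    by (rule clinear_ext_exists(2)[of ?F, OF _ _ *]) (auto simp: algebra_simps)
qed

lemma annihilate_right:
  shows clinear_annihilate_right: "clinear (annihilate_right x)"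
    and annihilate_right_tensor:
      "annihilate_right x (tensor xs) = (if xs = [] then 0 else cinner x (last xs) *\<^sub>C tensor (butlast xs))"
proof -
  let ?F = "\<lambda>f ys. f (ys @ [x])"
  have *: "?F (simple_form xs) = Rep_fock (if xs = [] then 0 else cinner x (last xs) *\<^sub>C tensor
      (butlast xs))" for xs
    by (cases xs rule: rev_cases) (auto simp: fun_eq_iff zero_fock.rep_eq scaleC_fock.rep_eq tensor.rep_eq
        simple_form_Nil simple_form_snoc)
  show "clinear (annihilate_right x)"
    unfolding annihilate_right_def by (rule clinear_ext_exists(1)[of ?F, OF _ _ *]) auto
  show "annihilate_right x (tensor xs) = (if xs = [] then 0 else cinner x (last xs) *\<^sub>C tensor
      (butlast xs))"
    unfolding annihilate_right_def by (rule clinear_ext_exists(2)[of ?F, OF _ _ *]) auto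
qed

lemma Rep_annihilate: "Rep_fock (annihilate x f) ys = Rep_fock f (x # ys)"
proof -
  have "(\<lambda>f. Rep_fock (annihilate x f) ys) = (\<lambda>f. Rep_fock f (x # ys))"
  proof (rule clinear_fock_eqI[OF clinear_compose[OF clinear_Rep clinear_annihilate] clinear_Rep])
    show "Rep_fock (annihilate x (tensor xs)) ys = Rep_fock (tensor xs) (x # ys)" for xs
      by (cases xs) (auto simp: annihilate_tensor zero_fock.rep_eq scaleC_fock.rep_eq tensor.rep_eq
        simple_form_Nil simple_form_Cons_Cons)
  qed
  then show ?thesis by (rule fun_cong)
qed

lemma Rep_annihilate_right: "Rep_fock (annihilate_right x f) ys = Rep_fock f (ys @ [x])"
proof -
  have "(\<lambda>f. Rep_fock (annihilate_right x f) ys) = (\<lambda>f. Rep_fock f (ys @ [x]))"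
  proof (rule clinear_fock_eqI[OF clinear_compose[OF clinear_Rep clinear_annihilate_right] clinear_Rep])
    show "Rep_fock (annihilate_right x (tensor xs)) ys = Rep_fock (tensor xs) (ys @ [x])" for xs
      by (cases xs rule: rev_cases) (auto simp: annihilate_right_tensor zero_fock.rep_eq
          scaleC_fock.rep_eq tensor.rep_eq
        simple_form_Nil simple_form_snoc)
  qed
  then show ?thesis by (rule fun_cong)
qed

lemma fock_inner0_creation_right: "fock_inner0 g (creation x f) = fock_inner0 (annihilate x g) f"
proof -
  have "(\<lambda>f. fock_inner0 g (creation x f)) = fock_inner0 (annihilate x g)"
    by (rule clinear_fock_eqI[OF clinear_compose[OF clinear_fock_inner0 clinear_creation]
        clinear_fock_inner0])
      (simp add: creation_tensor fock_inner0_tensor_right Rep_annihilate)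
  then show ?thesis by (rule fun_cong)
qed

lemma fock_inner0_create_right: "fock_inner0 g (create_right x f) = fock_inner0 (annihilate_right x g) f"
proof -
  have "(\<lambda>f. fock_inner0 g (create_right x f)) = fock_inner0 (annihilate_right x g)"
    by (rule clinear_fock_eqI[OF clinear_compose[OF clinear_fock_inner0 clinear_create_right]
        clinear_fock_inner0])
      (simp add: create_right_tensor fock_inner0_tensor_right Rep_annihilate_right)
  then show ?thesis by (rule fun_cong)
qed

lemma annihilate_right_create_right: "annihilate_right x (create_right x f) = cinner x x *\<^sub>C f"
proof -
  have "(\<lambda>f. annihilate_right x (create_right x f)) = (\<lambda>f. cinner x x *\<^sub>C f)"
    by (rule clinear_fock_eqI[OF clinear_compose[OF clinear_annihilate_right clinear_create_right]
        clinear_scaleC])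
      (simp add: create_right_tensor annihilate_right_tensor)
  then show ?thesis by (rule fun_cong)
qed

text \<open>Creation and annihilation at opposite ends of a tensor commute, except on the vacuum vector, where
annihilating the leg just created at the other end gives \<open>\<langle>x, y\<rangle>\<close> on one side and \<open>\<langle>y, x\<rangle>\<close> on the other.\<close>

lemma left_right_commute:
  assumes "cinner x y = cinner y x"
  shows "creation x (create_right y f + annihilate_right y f) + annihilate x (create_right y f +
      annihilate_right y f) =
    create_right y (creation x f + annihilate x f) + annihilate_right y (creation x f + annihilate x f)"
    (is "?l f = ?r f")
proof -
  note lin = clinear_creation clinear_annihilate clinear_create_right clinear_annihilate_right
  have "?l = ?r"
  proof (rule clinear_fock_eqI)
    show "clinear ?l" "clinear ?r"
      by (simp_all add: clinear_iff clinear_add[OF lin(1)] clinear_add[OF lin(2)] clinear_add[OF lin(3)]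
        clinear_add[OF lin(4)] clinear_scale[OF lin(1)] clinear_scale[OF lin(2)] clinear_scale[OF lin(3)]
        clinear_scale[OF lin(4)] scaleC_add_right)
    fix xs
    have aa: "annihilate x (annihilate_right y f) = annihilate_right y (annihilate x f)" for f
      by (rule fock_eqI) (simp add: Rep_annihilate Rep_annihilate_right)
    show "?l (tensor xs) = ?r (tensor xs)"
      using assms
      by (cases xs) (simp_all add: clinear_add[OF lin(1)] clinear_add[OF lin(2)] clinear_add[OF lin(3)]
        clinear_add[OF lin(4)] clinear_scale[OF lin(1)] clinear_scale[OF lin(2)] clinear_scale[OF lin(3)]
        clinear_scale[OF lin(4)] creation_tensor create_right_tensor annihilate_tensor
            annihilate_right_tensor
        clinear_0[OF lin(1)] clinear_0[OF lin(2)] clinear_0[OF lin(3)] clinear_0[OF lin(4)] aa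
        scaleC_scaleC mult.commute)
  qed
  then show ?thesis by (rule fun_cong)
qed

locale free_fock = type_D_fock q bar J
  for q :: real and bar :: "'h::complex_hilbert \<Rightarrow> 'h" and J :: "'h fock \<Rightarrow> 'k::complex_hilbert" +
  assumes q0: "q = 0"
begin

text \<open>With the convention \<open>0 ^ 0 = 1\<close> only the element of length zero contributes.\<close>

lemma symmetrizer_id: "P f = f"
proof -
  have "P = (\<lambda>f. f)"
  proof (rule clinear_fock_eqI[OF clinear_symmetrizer[OF bar]])
    fix xs :: "'h list"
    have "len (length xs) \<sigma> = 0 \<longleftrightarrow> \<sigma> = id" if "\<sigma> \<in> coxD (length xs)" for \<sigma>
    proof
      assume "len (length xs) \<sigma> = 0"
      then show "\<sigma> = id" using len_word_ex[OF that] by (metis length_0_conv word_prod_simps(1))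
    qed (simp only: len_id)
    then have "P (tensor xs) = (\<Sum>\<sigma>\<in>coxD (length xs). if \<sigma> = id then tensor xs else 0)"
      unfolding symmetrizer_tensor[OF bar]
      by (intro sum.cong refl) (auto simp: q0 power_0_left scaleC_one act_id)
    then show "P (tensor xs) = tensor xs"
      by (simp add: finite_coxD coxD_id)
  qed (simp add: clinear_iff)
  then show ?thesis by (rule fun_cong)
qed

lemma cinner_J_free: "cinner (J f) (J g) = fock_inner0 f g"
  by (simp add: cinner_J symmetrizer_id)

lemma gaussian_J: "gaussian J x (J f) = J (creation x f + annihilate x f)"
proof -
  have "annihilation_op J x (J f) = J (annihilate x f)"
    unfolding annihilation_op_def
    by (rule eq_if_cinner_J)
      (simp add: cinner_adj_left[OF bounded_clinear_creation_op] creation_op_J cinner_J_free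
        fock_inner0_creation_right)
  then show ?thesis by (simp add: gaussian_def creation_op_J clinear_add[OF clinear_J] add.commute)
qed

definition creation_right_op :: "'h \<Rightarrow> 'k \<Rightarrow> 'k" where
  "creation_right_op x = extension J (create_right x)"

definition gaussian_right :: "'h \<Rightarrow> 'k \<Rightarrow> 'k" where
  "gaussian_right x = (\<lambda>\<xi>. adj (creation_right_op x) \<xi> + creation_right_op x \<xi>)"

lemma create_right_bound: "norm (J (create_right x f)) \<le> norm x * norm (J f)"
proof -
  have "cinner (J (create_right x f)) (J (create_right x f)) = cnj (cinner x x) * cinner (J f) (J f)"
    by (simp add: cinner_J_free fock_inner0_create_right annihilate_right_create_right
        fock_inner0_scaleC_left)
  then have "complex_of_real ((norm (J (create_right x f)))\<^sup>2) = complex_of_real ((norm x * norm (J f))\<^sup>2)"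
    by (simp add: cinner_self power_mult_distrib)
  then have "(norm (J (create_right x f)))\<^sup>2 = (norm x * norm (J f))\<^sup>2"
    by (simp only: of_real_eq_iff)
  then show ?thesis by (simp add: power2_eq_iff_nonneg)
qed

lemma creation_right_op:
  shows bounded_clinear_creation_right_op: "bounded_clinear (creation_right_op x)"
    and creation_right_op_J: "creation_right_op x (J f) = J (create_right x f)"
  unfolding creation_right_op_def
  by (fact bounded_clinear_extension[OF clinear_J J_dense clinear_create_right create_right_bound])
    (fact extension_apply[OF clinear_J J_dense clinear_create_right create_right_bound])

lemma bounded_clinear_gaussian_right: "bounded_clinear (gaussian_right x)"
  and adj_gaussian_right: "adj (gaussian_right x) = gaussian_right x"
proof -
  note b = bounded_clinear_creation_right_op[of x]
  show "bounded_clinear (gaussian_right x)"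
    unfolding gaussian_right_def by (intro bounded_clinear_add bounded_clinear_adj b)
  show "adj (gaussian_right x) = gaussian_right x"
    unfolding gaussian_right_def by (simp add: adj_add bounded_clinear_adj b adj_adj add.commute)
qed

lemma gaussian_right_J: "gaussian_right x (J f) = J (create_right x f + annihilate_right x f)"
proof -
  have "adj (creation_right_op x) (J f) = J (annihilate_right x f)"
    by (rule eq_if_cinner_J)
      (simp add: cinner_adj_left[OF bounded_clinear_creation_right_op] creation_right_op_J
        cinner_J_free fock_inner0_create_right)
  then show ?thesis
    by (simp add: gaussian_right_def creation_right_op_J clinear_add[OF clinear_J] add.commute)
qed

lemma gaussian_commute:
  assumes "cinner x y = cinner y x"
  shows "gaussian J x (gaussian_right y \<xi>) = gaussian_right y (gaussian J x \<xi>)"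
proof -
  have "gaussian J x \<circ> gaussian_right y = gaussian_right y \<circ> gaussian J x"
    by (rule bounded_clinear_dense_eqI[OF _ _ J_dense])
      (auto simp: bounded_clinear_comp bounded_clinear_gaussian bounded_clinear_gaussian_right
        gaussian_J gaussian_right_J left_right_commute[OF assms])
  then show ?thesis by (simp add: fun_eq_iff)
qed

text \<open>By \<open>gaussian_J\<close> a Gaussian operator is creation up to a contraction of lower degree, so
tensors are reached by induction on the degree. The first leg of a tensor is split into its real and imaginary part.\<close>

lemma gaussian_cyclic:
  assumes HR: "real_hilbert_form HR"
    and D: "J vacuum \<in> D" and add: "\<And>\<xi> \<eta>. \<xi> \<in> D \<Longrightarrow> \<eta> \<in> D \<Longrightarrow> \<xi> + \<eta> \<in> D"
    and scale: "\<And>c \<xi>. \<xi> \<in> D \<Longrightarrow> c *\<^sub>C \<xi> \<in> D"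
    and gauss: "\<And>x \<xi>. x \<in> HR \<Longrightarrow> \<xi> \<in> D \<Longrightarrow> gaussian J x \<xi> \<in> D"
  shows "closure D = UNIV"
proof -
  have tens: "J (tensor xs) \<in> D" for xs
  proof (induction xs rule: length_induct)
    case (1 xs)
    show ?case
    proof (cases xs)
      case Nil
      then show ?thesis using D by simp
    next
      case (Cons x ys)
      have ys: "J (tensor ys) \<in> D" using 1 Cons by simp
      have real: "J (creation a (tensor ys)) \<in> D" if a: "a \<in> HR" for a
      proof -
        have g: "gaussian J a (J (tensor ys)) \<in> D" by (rule gauss[OF a ys])
        show ?thesis
        proof (cases ys)
          case Nil
          then show ?thesis using g by (simp add: gaussian_J annihilate_tensor)
        next
          case (Cons z zs)
          have "J (tensor zs) \<in> D" using 1 \<open>xs = x # ys\<close> Cons by simp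
          then have "gaussian J a (J (tensor ys)) + (- cinner a z) *\<^sub>C J (tensor zs) \<in> D"
            by (intro add g scale)
          moreover have "gaussian J a (J (tensor ys)) + (- cinner a z) *\<^sub>C J (tensor zs) = J
              (creation a (tensor ys))"
          proof -
            have "cinner a z *\<^sub>C J (tensor zs) + (- cinner a z) *\<^sub>C J (tensor zs) = 0"
              by (simp add: scaleC_add_left[symmetric])
            then show ?thesis
              by (simp add: gaussian_J annihilate_tensor Cons clinear_add[OF clinear_J]
                  clinear_scale[OF clinear_J] add.assoc)
          qed
          ultimately show ?thesis by simp
        qed
      qed
      have "\<exists>!(a, b). a \<in> HR \<and> b \<in> HR \<and> x = a + \<i> *\<^sub>C b"
        using HR by (simp add: real_hilbert_form_def)
      then obtain a b where ab: "a \<in> HR" "b \<in> HR" "x = a + \<i> *\<^sub>C b" by auto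
      have "J (tensor xs) = J (creation a (tensor ys)) + \<i> *\<^sub>C J (creation b (tensor ys))"
        by (simp add: Cons creation_tensor[symmetric] ab(3) creation_add_left creation_scaleC_left
            clinear_add[OF clinear_J] clinear_scale[OF clinear_J])
      then show ?thesis using add[OF real[OF ab(1)] scale[OF real[OF ab(2)]]] by simp
    qed
  qed
  have "J f \<in> D" for f
  proof (induction f rule: fock_induct)
    case zero
    show ?case using scale[OF D, of 0] by (simp add: clinear_0[OF clinear_J])
  next
    case (step f c xs)
    then show ?case
      using add[OF step scale[OF tens]]
      by (simp add: clinear_add[OF clinear_J] clinear_scale[OF clinear_J])
  qed
  then have "closure (range J) \<subseteq> closure D" by (intro closure_mono) auto
  then show ?thesis using J_dense by auto
qed

lemma vacuum_trace:
  assumes HR: "real_hilbert_form HR"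
  shows "is_trace (vN_generated (gaussian J ` HR)) (vacuum_state J)"
proof -
  let ?S = "gaussian J ` HR"
  have S: "bounded_clinear a \<and> adj a = a" if "a \<in> ?S" for a
    using that bounded_clinear_gaussian adj_gaussian by auto
  have sub: "vN_generated ?S \<subseteq> commutant (commutant ?S)"
    by (rule vN_generated_subset) (use S in metis)
  have mirror: "\<exists>a'\<in>commutant ?S. adj a' = a' \<and> a' (J vacuum) = a (J vacuum)" if "a \<in> ?S" for a
  proof -
    from that obtain x where x: "x \<in> HR" "a = gaussian J x" by auto
    have "gaussian_right x \<in> commutant ?S"
    proof (rule commutantI[OF bounded_clinear_gaussian_right])
      fix g \<xi> assume "g \<in> ?S"
      then obtain y where y: "y \<in> HR" "g = gaussian J y" by auto
      have "cinner y x = cinner x y" by (rule real_hilbert_form_commute[OF HR y(1) x(1)])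
      then show "g (gaussian_right x \<xi>) = gaussian_right x (g \<xi>)" using gaussian_commute y by simp
    qed
    moreover have "gaussian_right x (J vacuum) = a (J vacuum)"
      by (simp add: x gaussian_J gaussian_right_J creation_tensor create_right_tensor
          annihilate_tensor annihilate_right_tensor)
    ultimately show ?thesis using adj_gaussian_right by blast
  qed
  have "cinner (J vacuum) (a (b (J vacuum))) = cinner (J vacuum) (b (a (J vacuum)))"
    if ab: "a \<in> commutant (commutant ?S)" "b \<in> commutant (commutant ?S)" for a b
  proof (rule vector_state_trace[of ?S "J vacuum" a b])
    show "a \<in> commutant (commutant ?S)" "b \<in> commutant (commutant ?S)" by (fact ab)+
    show "bounded_clinear x \<and> adj x = x" if "x \<in> ?S" for x by (rule S[OF that])
    show "\<exists>x'\<in>commutant ?S. adj x' = x' \<and> x' (J vacuum) = x (J vacuum)" if "x \<in> ?S" for x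
      by (rule mirror[OF that])
    show "closure D = UNIV" if "J vacuum \<in> D" "\<And>\<xi> \<eta>. \<xi> \<in> D \<Longrightarrow> \<eta> \<in> D \<Longrightarrow> \<xi> + \<eta> \<in> D"
      "\<And>c \<xi>. \<xi> \<in> D \<Longrightarrow> c *\<^sub>C \<xi> \<in> D" "\<And>a \<xi>. a \<in> ?S \<Longrightarrow> \<xi> \<in> D \<Longrightarrow> a \<xi> \<in> D" for D
      by (rule gaussian_cyclic[OF HR that(1-3) that(4)[OF imageI]])
  qed
  then show ?thesis using sub unfolding is_trace_def vacuum_state_def by (auto simp: subset_iff)
qed

end

theorem proposition4p18:
  fixes q :: real
    and bar :: "'h::complex_hilbert \<Rightarrow> 'h"
    and HR :: "'h set"
    and J :: "'h fock \<Rightarrow> 'k::complex_hilbert"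
  assumes "- 1 < q" and "q < 1"
    and "selfadjoint_involution bar"
    and "real_hilbert_form HR"
    and "\<exists>B \<subseteq> HR. independent B \<and> card B = 2"
    and "is_completion (fock_inner q bar) J"
  shows "is_trace (vN_generated (gaussian J ` HR)) (vacuum_state J) \<longleftrightarrow> q = 0"
proof
  interpret type_D_fock q bar J
    by unfold_locales (use assms in auto)
  obtain B where B: "B \<subseteq> HR" "independent B" "card B = 2" using assms(5) by blast
  show "q = 0" if "is_trace (vN_generated (gaussian J ` HR)) (vacuum_state J)"
    by (rule trace_imp_q_eq_0[OF assms(4) B that])
next
  assume "q = 0"
  then interpret free_fock q bar J
    by unfold_locales (use assms in auto)
  show "is_trace (vN_generated (gaussian J ` HR)) (vacuum_state J)"
    by (rule vacuum_trace[OF assms(4)])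
qed

end
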